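(* Let $p,q,p',q'\in\mathbb{N}_{>0}$, let $l\ge1$, and let $f_1,f_2$ be $\mathbb{C}^l$-valued holomorphic functions on a neighborhood of the origin in $\mathbb{C}\times\mathbb{C}\times\mathbb{C}^l$. Consider the Pfaffian system $$x_2^{q}x_1^{p+1}\frac{\partial \mathbf{y}}{\partial x_1}=f_1(x_1,x_2,\mathbf{y}),\qquad x_1^{p'}x_2^{q'+1}\frac{\partial \mathbf{y}}{\partial x_2}=f_2(x_1,x_2,\mathbf{y}).$$ The following assertions hold: (1) Suppose the system has a formal solution $\hat{\mathbf{y}}$. If $\frac{\partial f_1}{\partial \mathbf{y}}(0,0,\mathbf{0})$ and $\frac{\partial f_2}{\partial \mathbf{y}}(0,0,\mathbf{0})$ are invertible and $x_1^px_2^q\neq x_1^{p'}x_2^{q'}$, then $\hat{\mathbf{y}}$ is convergent. (2) If the system is completely integrable and $\frac{\partial f_1}{\partial \mathbf{y}}(0,0,\mathbf{0})$ is invertible, then the system has a unique formal solution $\hat{\mathbf{y}}$. Moreover $\hat{\mathbf{y}}$ is $1$-summable in $x_1^px_2^q$. (3) If the system is completely integrable and $\frac{\partial f_2}{\partial \mathbf{y}}(0,0,\mathbf{0})$ is invertible, then the system has a unique formal solution $\hat{\mathbf{y}}$. Moreover $\hat{\mathbf{y}}$ is $1$-summable in $x_1^{p'}x_2^{q'}$.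
   Context: $\mathbb{N}$ contains $0$, $\mathbb{N}_{>0}=\mathbb{N}\setminus\{0\}$. A formal solution is a formal power series $\hat{\mathbf{y}}\in\mathbb{C}^l[[x_1,x_2]]$ satisfying both equations of the system. The system is called completely integrable if $f_1(x_1,x_2,\mathbf{0})=f_2(x_1,x_2,\mathbf{0})=\mathbf{0}$ and, on the domains of definition of $f_1,f_2$ (all functions evaluated at $(x_1,x_2,\mathbf{y})$), $$-qx_1^{p'}x_2^{q'}f_1+x_1^{p'}x_2^{q'+1}\frac{\partial f_1}{\partial x_2}+\frac{\partial f_1}{\partial \mathbf{y}}f_2=-p'x_1^{p}x_2^{q}f_2+x_1^{p+1}x_2^{q}\frac{\partial f_2}{\partial x_1}+\frac{\partial f_2}{\partial \mathbf{y}}f_1 .$$ Monomial summability, with $E=\mathbb{C}^l$ and a norm $\|\cdot\|$ on it. $D_r\subset\mathbb{C}$ is the disk of radius $r$ centered at $0$, and $\mathcal{O}_b(U,E)$ is the space of bounded holomorphic $E$-valued maps on the open set $U$. Fix a monomial $x_1^px_2^q$ with $p,q\in\mathbb{N}_{>0}$. Any $\hat g=\sum a_{n,m}x_1^nx_2^m\in E[[x_1,x_2]]$ is written uniquely as $\hat g=\sum_{n\ge0} g_n(x_1,x_2)(x_1^px_2^q)^n$ with $g_n=\sum_{m<p\text{ or }j<q}a_{np+m,nq+j}x_1^mx_2^j$. Let $\mathcal{C}=\bigcup_{r>0}\mathcal{C}_r$, where $\mathcal{C}_r=\mathcal{O}_b(D_r,E)[[x_1]]\cap\mathcal{O}_b(D_r,E)[[x_2]]$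 (coefficients being functions of the other variable). Let $\mathcal{E}^{(p,q)}_r$ be the Banach space (with the supremum norm) of $h\in\mathcal{O}_b(D_r^2,E)$ with $\frac{\partial^{n+m}h}{\partial x_1^n\partial x_2^m}(0,0)=0$ for $n\ge p$ and $m\ge q$. For $\hat g\in\mathcal{C}$ put $\hat T_{p,q}(\hat g)=\sum_{n\ge0} g_nt^n$, a power series in $t$ whose coefficients lie in $\bigcup_{r>0}\mathcal{E}^{(p,q)}_r$. $\Pi_{p,q}(a,b,r)=\{(x_1,x_2)\in\mathbb{C}^2: 0<|x_1|^p,|x_2|^q<r,\ a<\arg(x_1^px_2^q)<b\}$, where any convenient branch of $\arg$ may be used; its bisecting direction is $(a+b)/2$. A proper subsector is $\Pi_{p,q}(a',b',\rho)$ with $a<a'<b'<b$, $0<\rho<r$. For $g$ holomorphic on $\Pi_{p,q}(a,b,r)$ with values in $E$, $\hat g\in\mathcal{C}$ and $s>0$, $g\sim^{(p,q)}_s\hat g$ on $\Pi_{p,q}(a,b,r)$ means: there is $0<r'\le r$ with $\hat T_{p,q}(\hat g)=\sum g_nt^n\in\mathcal{E}^{(p,q)}_{r'}[[t]]$, and for every proper subsector $\Pi'=\Pi_{p,q}(a',b',\rho)$ with $0<\rho<r'$ there are $C,A>0$ such that for all $N\in\mathbb{N}$, $\|g(x_1,x_2)-\sum_{n=0}^{N-1}g_n(x_1,x_2)(x_1^px_2^q)^n\|\le CA^NN!^s|x_1^px_2^q|^N$ on $\Pi'$. For $k>0$, $\hat g\in\mathcal{C}$ is $k$-summable in $x_1^px_2^q$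 in the direction $d$ if there are a sector $\Pi_{p,q}(a,b,r)$ with bisecting direction $d$ and $b-a>\pi/k$, and a holomorphic $E$-valued map $g$ on it with $g\sim^{(p,q)}_{1/k}\hat g$. It is $k$-summable in $x_1^px_2^q$ if this holds for every direction $d$ with finitely many exceptions mod $2\pi$. *)

theory Defs
  imports "HOL-Analysis.Analysis"
begin

text \<open>Real Frechet differentiability on an open set with a complex-linear derivative.\<close>

definition holomorphic2_on ::
  "(complex \<times> complex \<Rightarrow> complex^'m) \<Rightarrow> (complex \<times> complex) set \<Rightarrow> bool" where
  "holomorphic2_on g U \<longleftrightarrow> open U \<and>
     (\<forall>z\<in>U. \<exists>D. (g has_derivative D) (at z) \<and>
        (\<forall>c a b. D (c * a, c * b) = c *s D (a, b)))"

definition holomorphic3_on ::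
  "(complex \<times> complex \<times> (complex^'l) \<Rightarrow> complex^'m) \<Rightarrow> (complex \<times> complex \<times> (complex^'l)) set \<Rightarrow> bool" where
  "holomorphic3_on f U \<longleftrightarrow> open U \<and>
     (\<forall>z\<in>U. \<exists>D. (f has_derivative D) (at z) \<and>
        (\<forall>c a b v. D (c * a, c * b, c *s v) = c *s D (a, b, v)))"

definition dx1 ::
  "(complex \<times> complex \<times> (complex^'l) \<Rightarrow> complex^'m) \<Rightarrow> complex \<Rightarrow> complex \<Rightarrow> complex^'l \<Rightarrow> complex^'m" where
  "dx1 f x1 x2 y = (\<chi> i. deriv (\<lambda>t. f (t, x2, y) $ i) x1)"

definition dx2 ::
  "(complex \<times> complex \<times> (complex^'l) \<Rightarrow> complex^'m) \<Rightarrow> complex \<Rightarrow> complex \<Rightarrow> complex^'l \<Rightarrow> complex^'m" where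
  "dx2 f x1 x2 y = (\<chi> i. deriv (\<lambda>t. f (x1, t, y) $ i) x2)"

definition jac_y ::
  "(complex \<times> complex \<times> (complex^'l) \<Rightarrow> complex^'m) \<Rightarrow> complex \<Rightarrow> complex \<Rightarrow> complex^'l \<Rightarrow> complex^'l^'m" where
  "jac_y f x1 x2 y = (\<chi> i j. deriv (\<lambda>t. f (x1, x2, y + axis j t) $ i) 0)"

text \<open>An element of $\mathbf{C}^l[[x_1,x_2]]$ is given by its components in
  $\mathbf{C}[[x_2]][[x_1]]$: the outer series is in $x_1$, the inner one in $x_2$.\<close>

type_synonym fps2 = "complex fps fps"

definition coeff2 :: "fps2 \<Rightarrow> nat \<Rightarrow> nat \<Rightarrow> complex" where
  "coeff2 u n m = fps_nth (fps_nth u n) m"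

definition vcoeff :: "fps2^'l \<Rightarrow> nat \<Rightarrow> nat \<Rightarrow> complex^'l" where
  "vcoeff u n m = (\<chi> i. coeff2 (u $ i) n m)"

definition X1 :: fps2 where "X1 = fps_X"

definition X2 :: fps2 where "X2 = fps_const fps_X"

definition fdx1 :: "fps2 \<Rightarrow> fps2" where
  "fdx1 u = fps_deriv u"

definition fdx2 :: "fps2 \<Rightarrow> fps2" where
  "fdx2 u = Abs_fps (\<lambda>n. fps_deriv (fps_nth u n))"

definition fps2_convergent :: "fps2^'l \<Rightarrow> bool" where
  "fps2_convergent u \<longleftrightarrow> (\<exists>r>0. \<forall>x1 x2. norm x1 < r \<longrightarrow> norm x2 < r \<longrightarrow>
     (\<lambda>(n, m). (x1 ^ n * x2 ^ m) *s vcoeff u n m) summable_on UNIV)"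

text \<open>The Taylor coefficients at the origin of a map that is holomorphic near the origin; they are
  indexed by the exponents of $x_1$, of $x_2$ and of the components of $y$.\<close>

definition has_taylor ::
  "(complex \<times> complex \<times> (complex^'l) \<Rightarrow> complex^'m) \<Rightarrow> (nat \<Rightarrow> nat \<Rightarrow> ('l \<Rightarrow> nat) \<Rightarrow> complex^'m) \<Rightarrow> bool" where
  "has_taylor f F \<longleftrightarrow> (\<exists>e>0. \<forall>x1 x2 y. norm x1 < e \<longrightarrow> norm x2 < e \<longrightarrow> norm y < e \<longrightarrow>
     ((\<lambda>(a, b, \<alpha>). (x1 ^ a * x2 ^ b * (\<Prod>j\<in>UNIV. y $ j ^ \<alpha> j)) *s F a b \<alpha>)
        has_sum f (x1, x2, y)) UNIV)"

definition taylor ::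
  "(complex \<times> complex \<times> (complex^'l) \<Rightarrow> complex^'m) \<Rightarrow> nat \<Rightarrow> nat \<Rightarrow> ('l \<Rightarrow> nat) \<Rightarrow> complex^'m" where
  "taylor f = (THE F. has_taylor f F)"

text \<open>The series $f(x_1,x_2,u(x_1,x_2))$, obtained by substituting $u$ into the Taylor series of $f$.
  This needs $u(0,0)=0$: then $x_1^a x_2^b u^\alpha$ has order at least $a+b+|\alpha|$, so that only
  the terms with $a+b+|\alpha|\le n+m$ contribute to the coefficient of $x_1^n x_2^m$.\<close>

definition fsubst ::
  "(complex \<times> complex \<times> (complex^'l) \<Rightarrow> complex^'m) \<Rightarrow> fps2^'l \<Rightarrow> fps2^'m" where
  "fsubst f u = (\<chi> i. Abs_fps (\<lambda>n. Abs_fps (\<lambda>m.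
     \<Sum>(a, b, \<alpha>) \<in> {(a, b, \<alpha>). a + b + (\<Sum>j\<in>UNIV. \<alpha> j) \<le> n + m}.
       taylor f a b \<alpha> $ i * coeff2 (X1 ^ a * X2 ^ b * (\<Prod>j\<in>UNIV. u $ j ^ \<alpha> j)) n m)))"

text \<open>The condition that the constant term vanishes is the one under which the substitution into
  the germs of f1 and f2 at the origin is defined.\<close>

definition formal_solution ::
  "nat \<Rightarrow> nat \<Rightarrow> nat \<Rightarrow> nat \<Rightarrow>
   (complex \<times> complex \<times> (complex^'l) \<Rightarrow> complex^'l) \<Rightarrow> (complex \<times> complex \<times> (complex^'l) \<Rightarrow> complex^'l) \<Rightarrow>
   fps2^'l \<Rightarrow> bool" where
  "formal_solution p q p' q' f1 f2 u \<longleftrightarrow>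
     vcoeff u 0 0 = 0 \<and>
     (\<chi> i. X2 ^ q * X1 ^ (p + 1) * fdx1 (u $ i)) = fsubst f1 u \<and>
     (\<chi> i. X1 ^ p' * X2 ^ (q' + 1) * fdx2 (u $ i)) = fsubst f2 u"

definition completely_integrable ::
  "nat \<Rightarrow> nat \<Rightarrow> nat \<Rightarrow> nat \<Rightarrow> (complex \<times> complex \<times> (complex^'l)) set \<Rightarrow>
   (complex \<times> complex \<times> (complex^'l) \<Rightarrow> complex^'l) \<Rightarrow> (complex \<times> complex \<times> (complex^'l) \<Rightarrow> complex^'l) \<Rightarrow>
   bool" where
  "completely_integrable p q p' q' U f1 f2 \<longleftrightarrow>
     (\<forall>x1 x2. (x1, x2, 0) \<in> U \<longrightarrow> f1 (x1, x2, 0) = 0 \<and> f2 (x1, x2, 0) = 0) \<and>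
     (\<forall>x1 x2 y. (x1, x2, y) \<in> U \<longrightarrow>
        - ((of_nat q * x1 ^ p' * x2 ^ q') *s f1 (x1, x2, y))
          + (x1 ^ p' * x2 ^ (q' + 1)) *s dx2 f1 x1 x2 y
          + jac_y f1 x1 x2 y *v f2 (x1, x2, y)
        = - ((of_nat p' * x1 ^ p * x2 ^ q) *s f2 (x1, x2, y))
          + (x1 ^ (p + 1) * x2 ^ q) *s dx1 f2 x1 x2 y
          + jac_y f2 x1 x2 y *v f1 (x1, x2, y))"

text \<open>The sequence c consists of the Taylor coefficients at 0 of an element of
  $\mathcal{O}_b(D_r,\mathbf{C}^l)$.\<close>

definition bounded_holomorphic_series :: "real \<Rightarrow> (nat \<Rightarrow> complex^'l) \<Rightarrow> bool" where
  "bounded_holomorphic_series r c \<longleftrightarrow> (\<exists>h.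
     (\<forall>i. (\<lambda>x. h x $ i) holomorphic_on ball 0 r) \<and> bounded (h ` ball 0 r) \<and>
     (\<forall>x\<in>ball 0 r. (\<lambda>n. x ^ n *s c n) sums h x))"

definition C_space :: "(fps2^'l) set" where
  "C_space = {u. \<exists>r>0.
     (\<forall>n. bounded_holomorphic_series r (\<lambda>m. vcoeff u n m)) \<and>
     (\<forall>m. bounded_holomorphic_series r (\<lambda>n. vcoeff u n m))}"

definition E_space :: "nat \<Rightarrow> nat \<Rightarrow> real \<Rightarrow> (complex \<times> complex \<Rightarrow> complex^'l) set" where
  "E_space p q r = {h. holomorphic2_on h (ball 0 r \<times> ball 0 r) \<and> bounded (h ` (ball 0 r \<times> ball 0 r)) \<and>
     (\<forall>n\<ge>p. \<forall>m\<ge>q. \<forall>i.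
        (deriv ^^ n) (\<lambda>x1. (deriv ^^ m) (\<lambda>x2. h (x1, x2) $ i) 0) 0 = 0)}"

text \<open>The coefficient of $x_1^m x_2^j$ in $g_n$, where $\hat g = \sum_n g_n (x_1^p x_2^q)^n$.\<close>

definition block_coeff :: "nat \<Rightarrow> nat \<Rightarrow> fps2^'l \<Rightarrow> nat \<Rightarrow> nat \<Rightarrow> nat \<Rightarrow> complex^'l" where
  "block_coeff p q u n m j = (if m < p \<or> j < q then vcoeff u (n * p + m) (n * q + j) else 0)"

text \<open>The relation that $\hat T_{p,q}(u) = \sum_n G_n t^n$, with coefficients in $\mathcal{E}^{(p,q)}_r$; the
  Taylor series of $G_n$ is the n-th block of u.\<close>

definition T_series ::
  "nat \<Rightarrow> nat \<Rightarrow> real \<Rightarrow> fps2^'l \<Rightarrow> (nat \<Rightarrow> complex \<times> complex \<Rightarrow> complex^'l) \<Rightarrow> bool" where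
  "T_series p q r u G \<longleftrightarrow> (\<forall>n. G n \<in> E_space p q r \<and>
     (\<forall>x1\<in>ball 0 r. \<forall>x2\<in>ball 0 r.
        ((\<lambda>(m, j). (x1 ^ m * x2 ^ j) *s block_coeff p q u n m j) has_sum G n (x1, x2)) UNIV))"

text \<open>A subset of $\mathbf{C}^2$, with any branch of the argument allowed: also for $b-a>2\pi$ no
  covering is taken.\<close>

definition msector :: "nat \<Rightarrow> nat \<Rightarrow> real \<Rightarrow> real \<Rightarrow> real \<Rightarrow> (complex \<times> complex) set" where
  "msector p q a b r = {(x1, x2).
     0 < norm x1 ^ p \<and> norm x1 ^ p < r \<and> 0 < norm x2 ^ q \<and> norm x2 ^ q < r \<and>
     (\<exists>\<theta>. a < \<theta> \<and> \<theta> < b \<and> x1 ^ p * x2 ^ q = of_real (norm (x1 ^ p * x2 ^ q)) * cis \<theta>)}"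

text \<open>The radius of a monomial sector bounds $|x_1|^p$ and $|x_2|^q$, whereas the functions $G_n$
  live on a polydisk whose radius bounds $|x_1|$ and $|x_2|$; the estimate is required at the points
  of the subsector at which all $G_n$ are defined.  Shrinking radii, this is the same as requiring
  it on subsectors contained in the polydisk.\<close>

definition masymptotic ::
  "nat \<Rightarrow> nat \<Rightarrow> real \<Rightarrow> real \<Rightarrow> real \<Rightarrow> real \<Rightarrow> (complex \<times> complex \<Rightarrow> complex^'l) \<Rightarrow> fps2^'l \<Rightarrow> bool" where
  "masymptotic p q s a b r g u \<longleftrightarrow> (\<exists>r' G. 0 < r' \<and> r' \<le> r \<and> T_series p q r' u G \<and>
     (\<forall>a' b' \<rho>. a < a' \<longrightarrow> a' < b' \<longrightarrow> b' < b \<longrightarrow> 0 < \<rho> \<longrightarrow> \<rho> < r' \<longrightarrow>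
       (\<exists>C>0. \<exists>A>0. \<forall>N. \<forall>(x1, x2) \<in> msector p q a' b' \<rho> \<inter> (ball 0 r' \<times> ball 0 r').
          norm (g (x1, x2) - (\<Sum>n<N. (x1 ^ p * x2 ^ q) ^ n *s G n (x1, x2)))
            \<le> C * A ^ N * fact N powr s * norm (x1 ^ p * x2 ^ q) ^ N)))"

definition msummable_dir :: "nat \<Rightarrow> nat \<Rightarrow> real \<Rightarrow> real \<Rightarrow> fps2^'l \<Rightarrow> bool" where
  "msummable_dir p q k d u \<longleftrightarrow> u \<in> C_space \<and>
     (\<exists>a b r g. r > 0 \<and> (a + b) / 2 = d \<and> b - a > pi / k \<and>
        holomorphic2_on g (msector p q a b r) \<and> masymptotic p q (1 / k) a b r g u)"

definition msummable :: "nat \<Rightarrow> nat \<Rightarrow> real \<Rightarrow> fps2^'l \<Rightarrow> bool" where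
  "msummable p q k u \<longleftrightarrow> u \<in> C_space \<and>
     (\<exists>S. finite S \<and>
        (\<forall>d. (\<forall>s\<in>S. \<forall>j::int. d \<noteq> s + 2 * pi * of_int j) \<longrightarrow> msummable_dir p q k d u))"

end

theory Submission
  imports Defs "HOL-Complex_Analysis.Complex_Analysis"
begin

text \<open>Parts (2) and (3): complete integrability makes \<open>u = 0\<close> a solution, and comparing coefficients
  in the equation with invertible linear part shows that it is the only one.

  Part (1): the convergent series \<open>g(x,y)\<close> with \<open>g(x,u) = 0\<close> form a space that is invariant under the
  derivations $D_1 = x_1^{p+1}x_2^q\partial_{x_1} + f_1\partial_y$ and
  $D_2 = x_1^{p'}x_2^{q'+1}\partial_{x_2} + f_2\partial_y$ and contains the obstruction to complete
  integrability.  Hence the common kernel \<open>T\<close> of the differentials $\partial_y g(x,u)$, a subspace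
  over the field $\mathbf{C}((x_2))((x_1))$, is invariant under two commuting connections whose
  leading terms are the given invertible Jacobians.  If \<open>T\<close> were not 0, comparing the trace of the
  commutation relation, multiplied by the inverse of one connection matrix, in the residue field of
  the lexicographic valuation would give $q \dim T = 0$ or $p' \dim T = 0$; this uses
  $(p,q) \neq (p',q')$.  So \<open>T = 0\<close>, which means that \<open>u\<close> solves a system of \<open>l\<close> convergent equations
  whose Jacobian determinant along \<open>u\<close> does not vanish identically.  On all but finitely many lines
  $x_2 = c x_1$ a majorant argument then shows that \<open>u\<close> converges, and by Baire's theorem \<open>u\<close>
  converges as a series in two variables.\<close>

section \<open>Flat connections over a valuation ring\<close>

text \<open>Part (1) does not assume complete integrability. What replaces it:
  \<open>\<delta>1 = x_2^q x_1^(p+1) d/dx_1\<close> and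
  \<open>\<delta>2 = x_1^p' x_2^(q'+1) d/dx_2\<close> satisfy a fixed commutation relation, and
  applying it to the components of u shows that the obstruction vanishes along u. Its differential
  is the curvature, so the curvature is zero on T without any hypothesis. The trace argument needs
  the quotient of the two monomials, in one order or the other, to be infinitely small. In the ring
  of power series neither monomial need divide the other; a valuation that orders all monomials
  totally repairs this, and the lexicographic one is invariant under the Euler operators x_i d/dx_i.
  The determinant of the relations is only known to be a nonzero series, in general not a unit, and
  in two variables there is no simple way to divide by it. On a line through the origin it becomes a
  power of t times a unit, which one-variable majorants can handle. Restriction to lines loses
  nothing, because the homogeneous part of degree k is a polynomial in the slope.\<close>

definition mmap :: "('a \<Rightarrow> 'b) \<Rightarrow> 'a^'n^'m \<Rightarrow> 'b^'n^'m" where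
  "mmap f A = (\<chi> i j. f (A $ i $ j))"

lemma mmap_nth [simp]: "mmap f A $ i $ j = f (A $ i $ j)"
  by (simp add: mmap_def)

text \<open>Keeps all matrices square: a basis of a subspace of dimension \<open>card S\<close> is
  stored as an n x n matrix whose columns outside \<open>S\<close> are zero, and
  \<open>coord_proj S\<close> plays the identity matrix of size \<open>card S\<close>.\<close>

definition coord_proj :: "'n set \<Rightarrow> 'a::zero_neq_one^'n^'n" where
  "coord_proj S = (\<chi> i j. if i = j \<and> i \<in> S then 1 else 0)"

lemma coord_proj_mult_nth:
  fixes A :: "'a::comm_ring_1^'n^'n::finite"
  shows "(coord_proj S ** A) $ i $ j = (if i \<in> S then A $ i $ j else 0)"
proof -
  have "(\<Sum>k\<in>UNIV. (if i = k \<and> i \<in> S then 1 else 0) * A $ k $ j) =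
        (\<Sum>k\<in>UNIV. if k = i then if i \<in> S then A $ k $ j else 0 else 0)"
    by (intro sum.cong) auto
  then show ?thesis by (simp add: coord_proj_def matrix_matrix_mult_def)
qed

lemma matrix_sub_rdistrib:
  fixes A B :: "'a::ring_1^'n^'m" and C :: "'a^'k^'n::finite"
  shows "(A - B) ** C = A ** C - B ** C"
  by (simp add: matrix_matrix_mult_def vec_eq_iff sum_subtractf left_diff_distrib)

lemma matrix_add_rdistrib:
  fixes A B :: "'a::ring_1^'n^'m" and C :: "'a^'k^'n::finite"
  shows "(A + B) ** C = A ** C + B ** C"
  by (simp add: matrix_matrix_mult_def vec_eq_iff sum.distrib distrib_right)

lemma matrix_sub_ldistrib:
  fixes B C :: "'a::ring_1^'k^'n::finite" and A :: "'a^'n^'m"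
  shows "A ** (B - C) = A ** B - A ** C"
  by (simp add: matrix_matrix_mult_def vec_eq_iff sum_subtractf right_diff_distrib)

lemma mult_coord_proj_nth:
  fixes A :: "'a::comm_ring_1^'n^'n::finite"
  shows "(A ** coord_proj S) $ i $ j = (if j \<in> S then A $ i $ j else 0)"
proof -
  have "(\<Sum>k\<in>UNIV. A $ i $ k * (if k = j \<and> k \<in> S then 1 else 0)) =
        (\<Sum>k\<in>UNIV. if k = j then if j \<in> S then A $ i $ k else 0 else 0)"
    by (intro sum.cong) auto
  then show ?thesis by (simp add: coord_proj_def matrix_matrix_mult_def)
qed

section \<open>Derivations, and valuation rings with a residue map\<close>

locale derivation =
  fixes D :: "'k::field \<Rightarrow> 'k"
  assumes add: "D (x + y) = D x + D y"
    and mult: "D (x * y) = D x * y + x * D y"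
begin

lemma zero [simp]: "D 0 = 0" using add[of 0 0] by (metis add.right_neutral add_left_cancel)
lemma one [simp]: "D 1 = 0" using mult[of 1 1] by (metis add.right_neutral add_left_cancel mult.right_neutral mult_1)
lemma uminus: "D (- x) = - D x" using add[of x "- x"] by (simp add: add_eq_0_iff)
lemma diff: "D (x - y) = D x - D y" using add[of x "- y"] by (simp add: uminus)
lemma sum: "D (sum f A) = (\<Sum>x\<in>A. D (f x))"
  by (induction A rule: infinite_finite_induct) (auto simp: add)

lemma mmap_mult:
  "mmap D (A ** B) = mmap D A ** B + A ** mmap D B"
  by (simp add: vec_eq_iff matrix_matrix_mult_def sum mult sum.distrib)

lemma mmap_diff: "mmap D (A - B) = mmap D A - mmap D B"
  by (simp add: vec_eq_iff diff)

end

text \<open>By \<open>inverse_in\<close> an element of nonzero residue is a unit, so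
  \<open>\<rho>\<close> is reduction modulo the maximal ideal. Its values outside
  \<open>\<O>\<close> carry no meaning.\<close>

locale valuation_ring =
  fixes \<O> :: "'k::field set" and \<rho> :: "'k \<Rightarrow> complex"
  assumes zero_in [simp]: "0 \<in> \<O>" and one_in [simp]: "1 \<in> \<O>"
    and add_in: "x \<in> \<O> \<Longrightarrow> y \<in> \<O> \<Longrightarrow> x + y \<in> \<O>"
    and uminus_in: "x \<in> \<O> \<Longrightarrow> - x \<in> \<O>"
    and mult_in: "x \<in> \<O> \<Longrightarrow> y \<in> \<O> \<Longrightarrow> x * y \<in> \<O>"
    and total: "x \<in> \<O> \<or> inverse x \<in> \<O>"
    and residue_one [simp]: "\<rho> 1 = 1"
    and residue_add: "x \<in> \<O> \<Longrightarrow> y \<in> \<O> \<Longrightarrow> \<rho> (x + y) = \<rho> x + \<rho> y"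
    and residue_mult: "x \<in> \<O> \<Longrightarrow> y \<in> \<O> \<Longrightarrow> \<rho> (x * y) = \<rho> x * \<rho> y"
    and inverse_in: "x \<in> \<O> \<Longrightarrow> \<rho> x \<noteq> 0 \<Longrightarrow> inverse x \<in> \<O>"
begin

lemma residue_zero [simp]: "\<rho> 0 = 0" using residue_add[of 0 0] by simp

lemma residue_uminus: "x \<in> \<O> \<Longrightarrow> \<rho> (- x) = - \<rho> x"
  using residue_add[of x "- x"] by (simp add: uminus_in add_eq_0_iff)

lemma diff_in: "x \<in> \<O> \<Longrightarrow> y \<in> \<O> \<Longrightarrow> x - y \<in> \<O>"
  using add_in[of x "- y"] by (simp add: uminus_in)

lemma residue_diff: "x \<in> \<O> \<Longrightarrow> y \<in> \<O> \<Longrightarrow> \<rho> (x - y) = \<rho> x - \<rho> y"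
  using residue_add[of x "- y"] by (simp add: uminus_in residue_uminus)

lemma sum_in: "(\<And>x. x \<in> A \<Longrightarrow> f x \<in> \<O>) \<Longrightarrow> sum f A \<in> \<O>"
  by (induction A rule: infinite_finite_induct) (auto simp: add_in)

lemma residue_sum: "(\<And>x. x \<in> A \<Longrightarrow> f x \<in> \<O>) \<Longrightarrow> \<rho> (sum f A) = (\<Sum>x\<in>A. \<rho> (f x))"
  by (induction A rule: infinite_finite_induct) (auto simp: residue_add sum_in)

lemma prod_in: "(\<And>x. x \<in> A \<Longrightarrow> f x \<in> \<O>) \<Longrightarrow> prod f A \<in> \<O>"
  by (induction A rule: infinite_finite_induct) (auto simp: mult_in)

lemma residue_prod: "(\<And>x. x \<in> A \<Longrightarrow> f x \<in> \<O>) \<Longrightarrow> \<rho> (prod f A) = (\<Prod>x\<in>A. \<rho> (f x))"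
  by (induction A rule: infinite_finite_induct) (auto simp: residue_mult prod_in)

lemma of_nat_in: "of_nat n \<in> \<O>"
  by (induction n) (auto simp: add_in)

lemma residue_of_nat: "\<rho> (of_nat n) = of_nat n"
  by (induction n) (auto simp: residue_add of_nat_in)

lemma of_int_in: "of_int n \<in> \<O>"
  by (cases n rule: int_diff_cases) (auto simp: diff_in of_nat_in)

lemma residue_of_int: "\<rho> (of_int n) = of_int n"
  by (cases n rule: int_diff_cases) (auto simp: residue_diff of_nat_in residue_of_nat)

definition integral_matrix :: "'k^'n^'m \<Rightarrow> bool" where
  "integral_matrix A \<longleftrightarrow> (\<forall>i j. A $ i $ j \<in> \<O>)"

lemma integral_matrix_mult: "integral_matrix A \<Longrightarrow> integral_matrix B \<Longrightarrow> integral_matrix (A ** B)"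
  by (auto simp: integral_matrix_def matrix_matrix_mult_def intro!: sum_in mult_in)

lemma residue_matrix_mult:
  "integral_matrix A \<Longrightarrow> integral_matrix B \<Longrightarrow> mmap \<rho> (A ** B) = mmap \<rho> A ** mmap \<rho> B"
  by (auto simp: integral_matrix_def matrix_matrix_mult_def vec_eq_iff residue_sum residue_mult mult_in)

lemma integral_matrix_add: "integral_matrix A \<Longrightarrow> integral_matrix B \<Longrightarrow> integral_matrix (A + B)"
  by (auto simp: integral_matrix_def add_in)

lemma integral_matrix_diff: "integral_matrix A \<Longrightarrow> integral_matrix B \<Longrightarrow> integral_matrix (A - B)"
  by (auto simp: integral_matrix_def diff_in)

lemma residue_matrix_diff:
  "integral_matrix A \<Longrightarrow> integral_matrix B \<Longrightarrow> mmap \<rho> (A - B) = mmap \<rho> A - mmap \<rho> B"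
  by (auto simp: integral_matrix_def vec_eq_iff residue_diff)

lemma residue_matrix_add:
  "integral_matrix A \<Longrightarrow> integral_matrix B \<Longrightarrow> mmap \<rho> (A + B) = mmap \<rho> A + mmap \<rho> B"
  by (auto simp: integral_matrix_def vec_eq_iff residue_add)

lemma integral_coord_proj: "integral_matrix (coord_proj S)"
  by (auto simp: integral_matrix_def coord_proj_def)

lemma residue_coord_proj: "mmap \<rho> (coord_proj S) = coord_proj S"
  by (auto simp: vec_eq_iff coord_proj_def)

lemma trace_in: "integral_matrix A \<Longrightarrow> trace A \<in> \<O>"
  by (auto simp: trace_def integral_matrix_def intro!: sum_in)

lemma residue_trace: "integral_matrix A \<Longrightarrow> \<rho> (trace A) = trace (mmap \<rho> A)"
  by (auto simp: trace_def integral_matrix_def residue_sum)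

lemma det_in: "integral_matrix A \<Longrightarrow> det A \<in> \<O>"
  by (auto simp: det_def integral_matrix_def intro!: sum_in mult_in prod_in of_int_in)

lemma residue_det: "integral_matrix A \<Longrightarrow> \<rho> (det A) = det (mmap \<rho> A)"
  by (auto simp: det_def integral_matrix_def residue_sum residue_mult residue_prod residue_of_int
      mult_in prod_in of_int_in intro!: sum.cong)

text \<open>Cramer's rule: the determinant has nonzero residue and is therefore a unit of
  \<open>\<O>\<close>, and the numerators are determinants of integral matrices.\<close>

lemma integral_inverse:
  fixes A :: "'k^'n^'n"
  assumes A: "integral_matrix A" and det: "det (mmap \<rho> A) \<noteq> 0"
  obtains X where "integral_matrix X" "X ** A = mat 1" "A ** X = mat 1"
proof -
  have r: "\<rho> (det A) \<noteq> 0" using det residue_det[OF A] by simp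
  then have nz: "det A \<noteq> 0" by auto
  then have "invertible A" by (simp add: invertible_det_nz)
  then obtain X where X: "X ** A = mat 1" "A ** X = mat 1" by (auto simp: invertible_def)
  have "X $ i $ j \<in> \<O>" for i j
  proof -
    have "A *v column j X = column j (mat 1)"
      by (simp flip: X(2)) (simp add: vec_eq_iff column_def matrix_vector_mult_def matrix_matrix_mult_def)
    then have "column j X = (\<chi> k. det (\<chi> i j'. if j' = k then column j (mat 1) $ i else A $ i $ j') / det A)"
      using cramer[OF nz] by blast
    then have "X $ i $ j = det (\<chi> i' j'. if j' = i then column j (mat 1) $ i' else A $ i' $ j') / det A"
      by (metis (no_types, lifting) column_def vec_lambda_beta)
    moreover have "det (\<chi> i' j'. if j' = i then column j (mat 1) $ i' else A $ i' $ j') \<in> \<O>"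
      by (rule det_in) (use A in \<open>auto simp: integral_matrix_def column_def mat_def\<close>)
    ultimately show ?thesis
      using inverse_in[OF det_in[OF A] r] by (simp add: divide_inverse mult_in)
  qed
  then show ?thesis using X that by (auto simp: integral_matrix_def)
qed

text \<open>An entry of least valuation, found by comparing the current candidate with one more
  index at a time; transitivity of the comparison is multiplication of quotients in
  \<open>\<O>\<close>.\<close>

lemma exists_dominating_entry:
  fixes w :: "'k^'n"
  assumes "w \<noteq> 0"
  shows "\<exists>j. w $ j \<noteq> 0 \<and> (\<forall>i. w $ i / w $ j \<in> \<O>)"
proof -
  have "\<exists>j. w $ j \<noteq> 0 \<and> (\<forall>i\<in>I. w $ i / w $ j \<in> \<O>)" if "finite I" for I
    using that
  proof (induction I rule: finite_induct)
    case empty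
    then show ?case using assms by (auto simp: vec_eq_iff)
  next
    case (insert k I)
    then obtain j where j: "w $ j \<noteq> 0" "\<forall>i\<in>I. w $ i / w $ j \<in> \<O>" by auto
    show ?case
    proof (cases "w $ k / w $ j \<in> \<O>")
      case True
      then show ?thesis using j by auto
    next
      case False
      then have k: "w $ k \<noteq> 0" "w $ j / w $ k \<in> \<O>"
        using total[of "w $ k / w $ j"] by (auto simp: field_simps)
      have "w $ i / w $ k \<in> \<O>" if "i \<in> I" for i
        using mult_in[of "w $ i / w $ j" "w $ j / w $ k"] that j k by auto
      then show ?thesis using k by (intro exI[of _ k]) auto
    qed
  qed
  from this[of UNIV] show ?thesis by simp
qed

text \<open>Gaussian elimination in which every pivot is an entry of least valuation.\<close>

lemma integral_echelon_form:
  fixes T :: "('k^'n) set"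
  assumes T: "vec.subspace T"
  obtains S and Q :: "'k^'n^'n" where "integral_matrix Q" "Q ** coord_proj S = Q"
    "coord_proj S ** Q = coord_proj S" "\<And>j. column j Q \<in> T" "\<And>v. v \<in> T \<Longrightarrow> Q *v v = v"
proof -
  \<comment> \<open>A partially reduced echelon basis: \<open>S\<close> is the set of pivots used so
    far, and the rows of \<open>Q\<close> in \<open>S\<close> are unit rows.\<close>
  define good where "good S Q \<longleftrightarrow> integral_matrix Q \<and> (\<forall>j. j \<notin> S \<longrightarrow> column j Q = 0) \<and>
     (\<forall>i\<in>S. \<forall>j. Q $ i $ j = (if i = j then 1 else 0)) \<and> (\<forall>j. column j Q \<in> T)" for S and Q :: "'k^'n^'n"
  have "good {} 0"
    using vec.subspace_0[OF T] by (auto simp: good_def integral_matrix_def column_def zero_vec_def)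
  then have ex: "\<exists>S. \<exists>Q. good S Q" by blast
  \<comment> \<open>With as many pivots as possible, \<open>Q\<close> must fix all of
    \<open>T\<close>; otherwise the rest of some vector after reduction would supply another
    pivot.\<close>
  have "\<exists>S. (\<exists>Q. good S Q) \<and> (\<forall>S'. (\<exists>Q. good S' Q) \<longrightarrow> card S' \<le> card S)"
  proof (rule ex_has_greatest_nat)
    show "\<exists>Q. good {} Q" using \<open>good {} 0\<close> by blast
    show "\<forall>S. (\<exists>Q. good S Q) \<longrightarrow> card S < Suc CARD('n)"
      by (auto simp: less_Suc_eq_le intro: card_mono)
  qed
  then obtain S Q where g: "good S Q" and mx: "\<And>S' Q'. good S' Q' \<Longrightarrow> card S' \<le> card S" by blast
  have Qv: "Q *v v = v" if v: "v \<in> T" for v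
  proof (rule ccontr)
    assume ne: "Q *v v \<noteq> v"
    \<comment> \<open>The rest of \<open>v\<close> after reduction by the existing columns: it lies
      in \<open>T\<close> and vanishes in all pivot rows.\<close>
    define w where "w = v - Q *v v"
    have "Q *v v \<in> T"
    proof -
      have "Q *v v = (\<Sum>j\<in>UNIV. v $ j *s column j Q)"
        by (simp add: matrix_mult_sum)
      also have "\<dots> \<in> T" using g T
        by (intro vec.subspace_sum[OF T] vec.subspace_scale[OF T]) (auto simp: good_def)
      finally show ?thesis .
    qed
    then have wT: "w \<in> T" unfolding w_def by (intro vec.subspace_diff[OF T] v)
    have wS: "w $ i = 0" if "i \<in> S" for i
    proof -
      have "(Q *v v) $ i = (\<Sum>j\<in>UNIV. if j = i then v $ j else 0)"
        unfolding matrix_vector_mult_def vec_lambda_beta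
        using g that by (intro sum.cong) (auto simp: good_def)
      then show ?thesis by (simp add: w_def)
    qed
    have "w \<noteq> 0" using ne by (simp add: w_def)
    then obtain j where j: "w $ j \<noteq> 0" "\<And>i. w $ i / w $ j \<in> \<O>"
      using exists_dominating_entry by blast
    define w' where "w' = inverse (w $ j) *s w"
    have w': "w' \<in> T" "w' $ j = 1" "\<And>i. w' $ i \<in> \<O>" "\<And>i. i \<in> S \<Longrightarrow> w' $ i = 0"
      using j wS by (auto simp: w'_def vec.subspace_scale[OF T wT] divide_inverse mult.commute)
    have "j \<notin> S" using j wS by auto
    \<comment> \<open>One elimination step: \<open>w'\<close> becomes column \<open>j\<close>, and
      row \<open>j\<close> of the old columns is cleared. Integrality survives because the pivot
      dominates all entries of \<open>w\<close>.\<close>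
    define Q' :: "'k^'n^'n" where "Q' = (\<chi> i k. if k = j then w' $ i else Q $ i $ k - Q $ j $ k * w' $ i)"
    have col: "column k Q' = (if k = j then w' else column k Q - Q $ j $ k *s w')" for k
      by (auto simp: Q'_def column_def vec_eq_iff)
    have z: "Q $ i $ k = 0" if "k \<notin> S" for i k
      using g that by (auto simp: good_def column_def vec_eq_iff)
    have "good (insert j S) Q'"
      unfolding good_def
    proof (intro conjI allI ballI impI)
      show "integral_matrix Q'" using g w' by (auto simp: Q'_def good_def integral_matrix_def intro!: diff_in mult_in)
    next
      fix k assume "k \<notin> insert j S"
      then show "column k Q' = 0" using z by (auto simp: Q'_def column_def vec_eq_iff)
    next
      fix i k assume "i \<in> insert j S"
      then show "Q' $ i $ k = (if i = k then 1 else 0)"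
        using g w' \<open>j \<notin> S\<close> by (auto simp: Q'_def good_def)
    next
      fix k show "column k Q' \<in> T" unfolding col
        using g w' T by (auto simp: good_def intro!: vec.subspace_diff vec.subspace_scale)
    qed
    then have "card (insert j S) \<le> card S" by (rule mx)
    then show False using \<open>j \<notin> S\<close> by simp
  qed
  show ?thesis
  proof (rule that[of Q S])
    show "integral_matrix Q" "\<And>j. column j Q \<in> T" using g by (auto simp: good_def)
    have z: "Q $ i $ k = 0" if "k \<notin> S" for i k
      using g that by (auto simp: good_def column_def vec_eq_iff)
    show "Q ** coord_proj S = Q" using z by (simp add: vec_eq_iff mult_coord_proj_nth)
    show "coord_proj S ** Q = coord_proj S"
      using g by (auto simp: vec_eq_iff coord_proj_mult_nth good_def) (auto simp: coord_proj_def)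
  qed (fact Qv)
qed

text \<open>In an echelon basis of \<open>T\<close> the two connections \<open>\<pi> E1 - A\<close> and \<open>\<pi>' E2 - B\<close> have
  matrices \<open>A'\<close> and \<open>B'\<close>, and \<open>A'\<close> is invertible over the valuation ring because \<open>A\<close> is.
  Multiplying the commutation relation by the inverse of \<open>A'\<close> kills the commutator in the trace.\<close>

lemma flat_subspace_trivial:
  fixes A B :: "'k^'n^'n" and T :: "('k^'n) set" and \<pi> \<pi>' :: 'k
  assumes E1: "derivation E1" and E2: "derivation E2"
    and E_in: "\<And>x. x \<in> \<O> \<Longrightarrow> E1 x \<in> \<O>" "\<And>x. x \<in> \<O> \<Longrightarrow> E2 x \<in> \<O>"
    and E_res: "\<And>x. x \<in> \<O> \<Longrightarrow> \<rho> (E1 x) = 0" "\<And>x. x \<in> \<O> \<Longrightarrow> \<rho> (E2 x) = 0"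
    and E_commute: "\<And>x. E1 (E2 x) = E2 (E1 x)"
    and E_pi: "E2 \<pi> = of_nat q * \<pi>" "E1 \<pi>' = of_nat p' * \<pi>'"
    and pi: "\<pi> \<in> \<O>" "\<pi>' \<in> \<O>" "\<pi>' \<noteq> 0" "\<pi> / \<pi>' \<in> \<O>" "\<rho> (\<pi> / \<pi>') = 0"
    and q: "q > 0"
    and AB: "integral_matrix A" "integral_matrix B" and A0: "det (mmap \<rho> A) \<noteq> 0"
    and T: "vec.subspace T"
    and T1: "\<And>v. v \<in> T \<Longrightarrow> (\<chi> i. \<pi> * E1 (v $ i)) - A *v v \<in> T"
    and T2: "\<And>v. v \<in> T \<Longrightarrow> (\<chi> i. \<pi>' * E2 (v $ i)) - B *v v \<in> T"
    and flat: "\<And>v. v \<in> T \<Longrightarrow> (mmap (\<lambda>x. \<pi>' * E2 x) A - mmap (\<lambda>x. \<pi> * E1 x) B + A ** B - B ** A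
        - mmap (\<lambda>x. of_nat q * \<pi>' * x) A + mmap (\<lambda>x. of_nat p' * \<pi> * x) B) *v v = 0"
  shows "T = {0}"
proof -
  define d1 where "d1 x = \<pi> * E1 x" for x
  define d2 where "d2 x = \<pi>' * E2 x" for x
  interpret E1: derivation E1 by fact
  interpret E2: derivation E2 by fact
  interpret d1: derivation d1
    by standard (simp_all add: d1_def E1.add E1.mult algebra_simps)
  interpret d2: derivation d2
    by standard (simp_all add: d2_def E2.add E2.mult algebra_simps)
  \<comment> \<open>The first-order terms come from \<open>E2\<close> hitting \<open>\<pi>\<close>
    and \<open>E1\<close> hitting \<open>\<pi>'\<close>; they are the source of the integers
    \<open>q\<close> and \<open>p'\<close> in the trace.\<close>
  have comm: "d1 (d2 x) - d2 (d1 x) = of_nat p' * \<pi> * d2 x - of_nat q * \<pi>' * d1 x" for x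
    by (simp add: d1_def d2_def E1.mult E2.mult E_pi E_commute algebra_simps)
  obtain S and Q :: "'k^'n^'n" where Q: "integral_matrix Q" "Q ** coord_proj S = Q"
    "coord_proj S ** Q = coord_proj S" "\<And>j. column j Q \<in> T" "\<And>v. v \<in> T \<Longrightarrow> Q *v v = v"
    by (rule integral_echelon_form[OF T]) (rule that)
  let ?P = "coord_proj S :: 'k^'n^'n"
  \<comment> \<open>\<open>Q\<close> is the identity on \<open>T\<close>, applied here column by
    column.\<close>
  have colQ: "Q ** X = X" if "\<And>j. column j X \<in> T" for X :: "'k^'n^'n"
  proof -
    have "column j (Q ** X) = column j X" for j
      using Q(5)[OF that[of j]] by (simp add: column_def matrix_matrix_mult_def matrix_vector_mult_def vec_eq_iff)
    then show ?thesis by (simp add: vec_eq_iff column_def)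
  qed
  define N1 where "N1 = mmap d1 Q - A ** Q"
  define N2 where "N2 = mmap d2 Q - B ** Q"
  have "column j N1 = (\<chi> i. \<pi> * E1 (column j Q $ i)) - A *v column j Q" for j
    by (simp add: N1_def d1_def column_def matrix_matrix_mult_def matrix_vector_mult_def vec_eq_iff)
  then have QN1: "Q ** N1 = N1" using T1[OF Q(4)] by (intro colQ) simp
  have "column j N2 = (\<chi> i. \<pi>' * E2 (column j Q $ i)) - B *v column j Q" for j
    by (simp add: N2_def d2_def column_def matrix_matrix_mult_def matrix_vector_mult_def vec_eq_iff)
  then have QN2: "Q ** N2 = N2" using T2[OF Q(4)] by (intro colQ) simp
  have dP: "mmap d1 ?P = 0" "mmap d2 ?P = 0"
    by (auto simp: vec_eq_iff coord_proj_def)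
  have N1P: "N1 ** ?P = N1"
    using d1.mmap_mult[of Q ?P] by (simp add: N1_def matrix_sub_rdistrib Q(2) dP flip: matrix_mul_assoc)
  have N2P: "N2 ** ?P = N2"
    using d2.mmap_mult[of Q ?P] by (simp add: N2_def matrix_sub_rdistrib Q(2) dP flip: matrix_mul_assoc)
  have PP: "?P ** ?P = ?P" by (simp add: vec_eq_iff coord_proj_mult_nth) (auto simp: coord_proj_def)
  \<comment> \<open>Coordinates of the columns of \<open>N1\<close> in the basis \<open>Q\<close>
    are read off in the pivot rows, where \<open>Q\<close> is the identity.\<close>
  define A' where "A' = ?P ** N1"
  define B' where "B' = ?P ** N2"
  have QA: "Q ** A' = N1" by (simp add: A'_def matrix_mul_assoc Q(2) QN1)
  have QB: "Q ** B' = N2" by (simp add: B'_def matrix_mul_assoc Q(2) QN2)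
  have PA: "?P ** A' = A'" "A' ** ?P = A'"
    by (simp_all add: A'_def matrix_mul_assoc PP) (simp add: N1P flip: matrix_mul_assoc)
  have PB: "?P ** B' = B'" "B' ** ?P = B'"
    by (simp_all add: B'_def matrix_mul_assoc PP) (simp add: N2P flip: matrix_mul_assoc)
  define s where "s c X = mmap (\<lambda>x. c * x) X" for c and X :: "'k^'n^'n"
  have s_mult: "X ** s c Y = s c (X ** Y)" "s c Y ** X = s c (Y ** X)" for c X Y
    by (simp_all add: s_def vec_eq_iff matrix_matrix_mult_def sum_distrib_left ac_simps)
  have s_add: "s c (X + Y) = s c X + s c Y" "s c (X - Y) = s c X - s c Y" for c X Y
    by (simp_all add: s_def vec_eq_iff algebra_simps)
  \<comment> \<open>The curvature of the two connections, including the terms that come from their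
    commutation relation.\<close>
  define M where "M = mmap d2 A - mmap d1 B + A ** B - B ** A - s (of_nat q * \<pi>') A + s (of_nat p' * \<pi>) B"
  have MQ: "M ** Q = 0"
  proof -
    have "column j (M ** Q) = M *v column j Q" for j
      by (simp add: column_def matrix_matrix_mult_def matrix_vector_mult_def vec_eq_iff)
    also have "\<dots> j = 0" for j
      using flat[OF Q(4)[of j]] by (simp add: M_def s_def d1_def[abs_def] d2_def[abs_def])
    finally show ?thesis by (simp add: vec_eq_iff column_def)
  qed
  have dd: "mmap d1 (mmap d2 Q) - mmap d2 (mmap d1 Q) = s (of_nat p' * \<pi>) (mmap d2 Q) - s (of_nat q * \<pi>') (mmap d1 Q)"
    by (simp add: vec_eq_iff s_def comm)
  \<comment> \<open>Both mixed second covariant derivatives of the basis \<open>Q\<close>, written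
    on the left in the coordinates \<open>A'\<close> and \<open>B'\<close>.\<close>
  have "Q ** (mmap d1 B' - mmap d2 A' + A' ** B' - B' ** A')
      = (mmap d1 N2 - A ** N2) - (mmap d2 N1 - B ** N1)"
  proof -
    have 1: "mmap d1 N2 - A ** N2 = Q ** A' ** B' + Q ** mmap d1 B'"
      using d1.mmap_mult[of Q B'] by (simp add: QB QA N1_def matrix_sub_rdistrib flip: matrix_mul_assoc)
    have 2: "mmap d2 N1 - B ** N1 = Q ** B' ** A' + Q ** mmap d2 A'"
      using d2.mmap_mult[of Q A'] by (simp add: QB QA N2_def matrix_sub_rdistrib flip: matrix_mul_assoc)
    show ?thesis unfolding 1 2
      by (simp add: matrix_add_ldistrib matrix_sub_ldistrib matrix_mul_assoc)
  qed
  also have "\<dots> = M ** Q + s (of_nat p' * \<pi>) N2 - s (of_nat q * \<pi>') N1"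
    using dd unfolding M_def N1_def N2_def
    by (simp add: d1.mmap_diff d2.mmap_diff d1.mmap_mult d2.mmap_mult s_add s_mult matrix_add_rdistrib
        matrix_sub_rdistrib matrix_sub_ldistrib matrix_mul_assoc algebra_simps)
  also have "\<dots> = Q ** (s (of_nat p' * \<pi>) B' - s (of_nat q * \<pi>') A')"
    by (simp add: MQ matrix_sub_ldistrib s_mult QA QB)
  \<comment> \<open>The factor \<open>Q\<close> cancels because its pivot rows form
    \<open>?P\<close>.\<close>
  finally have "?P ** (mmap d1 B' - mmap d2 A' + A' ** B' - B' ** A')
      = ?P ** (s (of_nat p' * \<pi>) B' - s (of_nat q * \<pi>') A')"
    by (metis Q(3) matrix_mul_assoc)
  moreover have "?P ** mmap d1 B' = mmap d1 B'" "?P ** mmap d2 A' = mmap d2 A'"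
    using d1.mmap_mult[of ?P B'] d2.mmap_mult[of ?P A'] by (simp_all add: dP PA PB)
  ultimately have key: "mmap d1 B' - mmap d2 A' + A' ** B' - B' ** A'
      = s (of_nat p' * \<pi>) B' - s (of_nat q * \<pi>') A'"
    by (simp add: matrix_add_ldistrib matrix_sub_ldistrib s_mult matrix_mul_assoc PA PB)
  have d_in: "d1 x \<in> \<O>" "d2 x \<in> \<O>" "\<rho> (d1 x) = 0" if "x \<in> \<O>" for x
    using that by (auto simp: d1_def d2_def mult_in pi E_in residue_mult E_res)
  have idQ: "integral_matrix (mmap d1 Q)" "integral_matrix (mmap d2 Q)"
    using Q(1) by (auto simp: integral_matrix_def d_in)
  have iN: "integral_matrix N1" "integral_matrix N2"
    unfolding N1_def N2_def by (intro integral_matrix_diff integral_matrix_mult idQ Q(1) AB)+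
  have iA: "integral_matrix A'" and iB: "integral_matrix B'"
    unfolding A'_def B'_def by (auto intro!: integral_matrix_mult integral_coord_proj iN)
  \<comment> \<open>Modulo the maximal ideal the derivative of \<open>Q\<close> disappears, and only
    the linear map \<open>A\<close> remains.\<close>
  have resN: "mmap \<rho> Q ** mmap \<rho> A' = - (mmap \<rho> A ** mmap \<rho> Q)"
  proof -
    have "mmap \<rho> Q ** mmap \<rho> A' = mmap \<rho> N1"
      using residue_matrix_mult[OF Q(1) iA] QA by simp
    also have "\<dots> = mmap \<rho> (mmap d1 Q) - mmap \<rho> (A ** Q)"
      unfolding N1_def by (intro residue_matrix_diff integral_matrix_mult idQ Q(1) AB)
    also have "mmap \<rho> (mmap d1 Q) = 0"
      using Q(1) by (auto simp: vec_eq_iff integral_matrix_def d_in)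
    finally show ?thesis using residue_matrix_mult[OF AB(1) Q(1)] by simp
  qed
  \<comment> \<open>\<open>A'\<close> is zero outside the pivots; the complementary projection
    completes it to a matrix that can be inverted at full size.\<close>
  define H where "H = A' + (mat 1 - ?P)"
  have imat: "integral_matrix (mat 1)" by (auto simp: integral_matrix_def mat_def)
  have iH: "integral_matrix H" unfolding H_def
    by (intro integral_matrix_add integral_matrix_diff iA imat integral_coord_proj)
  have resH: "mmap \<rho> H = mmap \<rho> A' + (mat 1 - coord_proj S)"
    unfolding H_def
    by (subst residue_matrix_add residue_matrix_diff, (intro integral_matrix_diff iA imat integral_coord_proj)+)+
       (simp add: residue_coord_proj, simp add: vec_eq_iff mat_def)
  let ?R = "coord_proj S :: complex^'n^'n"
  have P0A: "?R ** mmap \<rho> A' = mmap \<rho> A'"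
    using residue_matrix_mult[OF integral_coord_proj iA, of S] by (simp add: PA residue_coord_proj)
  have P0Q: "?R ** mmap \<rho> Q = ?R"
    using residue_matrix_mult[OF integral_coord_proj Q(1), of S] by (simp add: Q(3) residue_coord_proj)
  have P0P0: "?R ** ?R = ?R" by (simp add: vec_eq_iff coord_proj_mult_nth) (auto simp: coord_proj_def)
  \<comment> \<open>A kernel vector is supported on the pivots and killed by the residue of
    \<open>A'\<close>. By \<open>resN\<close> the residue of \<open>A\<close> then kills its image
    under \<open>Q\<close>, so that image is 0, and the pivot rows of \<open>Q\<close> return the
    vector itself.\<close>
  have "x = 0" if x: "mmap \<rho> H *v x = 0" for x
  proof -
    have 0: "mmap \<rho> A' *v x + (x - ?R *v x) = 0"
      using x by (simp add: resH matrix_vector_mult_add_rdistrib matrix_vector_mult_diff_rdistrib)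
    then have "?R *v (mmap \<rho> A' *v x + (x - ?R *v x)) = 0" by simp
    then have 1: "mmap \<rho> A' *v x = 0"
      by (simp add: matrix_vector_right_distrib matrix_vector_mult_diff_distrib matrix_vector_mul_assoc P0A P0P0)
    with 0 have 2: "?R *v x = x" by simp
    have "mmap \<rho> A *v (mmap \<rho> Q *v x) = (- (mmap \<rho> Q ** mmap \<rho> A')) *v x"
      by (simp add: resN matrix_vector_mul_assoc)
    also have "\<dots> = - ((mmap \<rho> Q ** mmap \<rho> A') *v x)"
      by (simp add: matrix_vector_mult_def vec_eq_iff sum_negf)
    also have "\<dots> = 0" by (simp add: 1 flip: matrix_vector_mul_assoc)
    finally have "mmap \<rho> Q *v x = 0"
      using A0 by (metis invertible_det_nz invertible_def matrix_vector_mul_assoc matrix_vector_mul_lid matrix_vector_mult_0_right)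
    then have "?R *v x = 0" using P0Q by (metis matrix_vector_mul_assoc matrix_vector_mult_0_right)
    then show ?thesis using 2 by simp
  qed
  then have "det (mmap \<rho> H) \<noteq> 0"
    by (metis invertible_det_nz invertible_left_inverse matrix_left_invertible_ker)
  then obtain X where X: "integral_matrix X" "X ** H = mat 1" "H ** X = mat 1"
    using integral_inverse[OF iH] by blast
  have HP: "H ** ?P = A'" "?P ** H = A'"
    by (simp_all add: H_def matrix_add_rdistrib matrix_sub_rdistrib matrix_add_ldistrib matrix_sub_ldistrib PA PP)
  have XA: "X ** A' = ?P" "A' ** X = ?P"
    unfolding HP(1)[symmetric] using X by (simp add: matrix_mul_assoc)
      (metis HP X(3) matrix_mul_assoc matrix_mul_rid)
  have tr_s: "trace (s c Y) = c * trace Y" for c Y by (simp add: trace_def s_def sum_distrib_left)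
  have tr: "trace (X ** mmap d1 B') - trace (X ** mmap d2 A') + trace (X ** A' ** B') - trace (X ** B' ** A')
      = of_nat p' * \<pi> * trace (X ** B') - of_nat q * \<pi>' * trace (X ** A')"
    using arg_cong[OF key, of "\<lambda>Y. trace (X ** Y)"]
    by (simp add: matrix_add_ldistrib matrix_sub_ldistrib trace_add trace_sub s_mult tr_s matrix_mul_assoc)
  \<comment> \<open>Cyclicity of the trace: both orders of the product reduce to
    \<open>?P ** B'\<close>, so the commutator contributes nothing.\<close>
  have "trace (X ** B' ** A') = trace (A' ** X ** B')"
    by (metis matrix_mul_assoc trace_mul_sym)
  then have tr2: "trace (X ** A' ** B') - trace (X ** B' ** A') = 0" by (simp add: XA)
  have trP: "trace ?P = of_nat (card S)"
  proof -
    have "trace ?P = (\<Sum>i\<in>UNIV. if i \<in> S then 1 else 0)" by (simp add: trace_def coord_proj_def)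
    then show ?thesis by (simp add: sum.If_cases)
  qed
  have fact: "trace (X ** mmap d1 B') = \<pi> * trace (X ** mmap E1 B')"
    "trace (X ** mmap d2 A') = \<pi>' * trace (X ** mmap E2 A')"
    by (simp_all add: trace_def matrix_matrix_mult_def d1_def d2_def sum_distrib_left ac_simps)
  \<comment> \<open>The trace identity divided by \<open>\<pi>'\<close>, with \<open>card S\<close>
    as the trace of \<open>?P\<close>. Both terms on the right have residue 0: the first contains
    the infinitely small \<open>\<pi> / \<pi>'\<close>, the second contains \<open>E2\<close> of an
    integral matrix.\<close>
  have eq: "of_nat q * of_nat (card S) =
     (\<pi> / \<pi>') * (of_nat p' * trace (X ** B') - trace (X ** mmap E1 B')) + trace (X ** mmap E2 A')"
    using tr tr2 pi(3) by (simp add: XA trP fact field_simps)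
  have iE: "integral_matrix (mmap E1 B')" "integral_matrix (mmap E2 A')"
    using iA iB by (auto simp: integral_matrix_def E_in)
  have "mmap \<rho> (mmap E2 A') = 0" using iA by (auto simp: vec_eq_iff integral_matrix_def E_res)
  then have r2: "\<rho> (trace (X ** mmap E2 A')) = 0"
    using residue_trace[OF integral_matrix_mult[OF X(1) iE(2)]] residue_matrix_mult[OF X(1) iE(2)]
    by (simp add: trace_def)
  have i3: "of_nat p' * trace (X ** B') - trace (X ** mmap E1 B') \<in> \<O>"
    by (intro diff_in mult_in trace_in integral_matrix_mult X iB iE of_nat_in)
  have "\<rho> (of_nat q * of_nat (card S)) = 0"
    unfolding eq
    using residue_add[OF mult_in[OF pi(4) i3] trace_in[OF integral_matrix_mult[OF X(1) iE(2)]]]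
      residue_mult[OF pi(4) i3] by (simp add: pi(5) r2)
  then have "(of_nat (q * card S) :: complex) = 0"
    using residue_of_nat[of "q * card S"] by simp
  then have "S = {}" using q by (simp only: of_nat_eq_0_iff) simp
  then have "Q = 0" using Q(2) by (simp add: vec_eq_iff mult_coord_proj_nth)
  then show ?thesis using Q(5) vec.subspace_0[OF T] by force
qed

end

section \<open>The lexicographic valuation of iterated Laurent series\<close>

notation fls_nth (infixl "$$" 75)

text \<open>Convolution with arbitrary lower bounds for the supports. Applying a map to the
  coefficients can raise the subdegree, so the summation range of the exact formula would
  change.\<close>

lemma fls_times_nth_lower_bound:
  fixes f g :: "'a::semiring_0 fls"
  assumes "\<And>n. n < a \<Longrightarrow> f $$ n = 0" "\<And>n. n < b \<Longrightarrow> g $$ n = 0"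
  shows "(f * g) $$ n = (\<Sum>i=a..n - b. f $$ i * g $$ (n - i))"
proof -
  have "(f * g) $$ n = (\<Sum>i=fls_subdegree f..n - fls_subdegree g. f $$ i * g $$ (n - i))"
    by (rule fls_times_nth(2))
  also have "\<dots> = (\<Sum>i=min a (fls_subdegree f)..max (n - b) (n - fls_subdegree g). f $$ i * g $$ (n - i))"
    by (intro sum.mono_neutral_left) (auto simp: not_le)
  also have "\<dots> = (\<Sum>i=a..n - b. f $$ i * g $$ (n - i))"
    by (intro sum.mono_neutral_right) (auto simp: not_le assms)
  finally show ?thesis .
qed

text \<open>The operator t d/dt. Unlike d/dt it does not lower orders, so it acts on the valuation
  ring, and it kills constant terms, so its residues are 0.\<close>

definition fls_euler :: "'a::comm_ring_1 fls \<Rightarrow> 'a fls" where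
  "fls_euler f = fls_X * fls_deriv f"

lemma fls_euler_nth [simp]: "fls_euler f $$ n = of_int n * f $$ n"
  unfolding fls_euler_def fls_X_times_conv_shift(1) by simp

lemma fls_euler_0 [simp]: "fls_euler 0 = 0"
  by (simp add: fls_euler_def)

lemma derivation_fls_euler: "derivation (fls_euler :: 'a::field fls \<Rightarrow> 'a fls)"
  by standard (simp_all add: fls_euler_def algebra_simps)

definition fls_map :: "('a::zero \<Rightarrow> 'b::zero) \<Rightarrow> 'a fls \<Rightarrow> 'b fls" where
  "fls_map D f = Abs_fls (\<lambda>n. D (f $$ n))"

lemma fls_map_nth: "D 0 = 0 \<Longrightarrow> fls_map D f $$ n = D (f $$ n)"
  unfolding fls_map_def by (rule nth_Abs_fls_lower_bound[of "fls_subdegree f"]) auto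

lemma derivation_fls_map:
  assumes "derivation D"
  shows "derivation (fls_map D)"
proof -
  interpret derivation D by fact
  show ?thesis
  proof
    fix x y :: "'a fls"
    show "fls_map D (x + y) = fls_map D x + fls_map D y"
      by (rule fls_eqI) (simp add: fls_map_nth add)
    let ?a = "fls_subdegree x" and ?b = "fls_subdegree y"
    have "(fls_map D x * y) $$ n = (\<Sum>i=?a..n - ?b. D (x $$ i) * y $$ (n - i))" for n
      by (subst fls_times_nth_lower_bound[of ?a _ ?b]) (auto simp: fls_map_nth)
    moreover have "(x * fls_map D y) $$ n = (\<Sum>i=?a..n - ?b. x $$ i * D (y $$ (n - i)))" for n
      by (subst fls_times_nth_lower_bound[of ?a _ ?b]) (auto simp: fls_map_nth)
    ultimately show "fls_map D (x * y) = fls_map D x * y + x * fls_map D y"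
      by (intro fls_eqI) (simp add: fls_map_nth fls_times_nth(2) sum mult sum.distrib)
  qed
qed

text \<open>The valuation ring of the valuation with $x_1$ infinitely smaller than every power of
  $x_2$; its residue field is $\mathbf{C}$.\<close>

definition lex_ring :: "complex fls fls set" where
  "lex_ring = {f. (\<forall>n<0. f $$ n = 0) \<and> (\<forall>m<0. f $$ 0 $$ m = 0)}"

definition lex_residue :: "complex fls fls \<Rightarrow> complex" where
  "lex_residue f = f $$ 0 $$ 0"

lemma lex_ring_times:
  assumes "f \<in> lex_ring" "g \<in> lex_ring"
  shows "f * g \<in> lex_ring" "lex_residue (f * g) = lex_residue f * lex_residue g"
proof -
  have 1: "(f * g) $$ n = (\<Sum>i=0..n. f $$ i * g $$ (n - i))" for n
    using fls_times_nth_lower_bound[of 0 f 0 g n] assms by (simp add: lex_ring_def)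
  have 2: "(f * g) $$ 0 $$ m = (\<Sum>j=0..m. f $$ 0 $$ j * g $$ 0 $$ (m - j))" for m
    using fls_times_nth_lower_bound[of 0 "f $$ 0" 0 "g $$ 0" m] assms by (simp add: lex_ring_def 1)
  show "f * g \<in> lex_ring" using 1 2 by (auto simp: lex_ring_def)
  show "lex_residue (f * g) = lex_residue f * lex_residue g" using 2[of 0] by (simp add: lex_residue_def)
qed

lemma valuation_ring_lex: "valuation_ring lex_ring lex_residue"
proof -
  have inv0: "inverse f $$ 0 = inverse (f $$ 0)" "\<forall>n<0. inverse f $$ n = 0"
    if "f $$ 0 \<noteq> 0" "\<forall>n<0. f $$ n = 0" for f :: "'a::field fls"
  proof -
    have "fls_subdegree f = 0" using that by (intro fls_subdegree_eqI) auto
    moreover have "f \<noteq> 0" using that by auto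
    ultimately show "inverse f $$ 0 = inverse (f $$ 0)" "\<forall>n<0. inverse f $$ n = 0"
      using fls_inverse_base[of f] by auto
  qed
  show ?thesis
  proof
    fix x :: "complex fls fls"
    show "x \<in> lex_ring \<or> inverse x \<in> lex_ring"
    \<comment> \<open>Lexicographic comparison: the order in the outer variable decides unless it is
      0; then the order of the coefficient at 0 in the inner variable decides.\<close>
    proof (cases "x = 0 \<or> fls_subdegree x \<noteq> 0")
      case True
      then show ?thesis
      proof (cases "fls_subdegree x" "0::int" rule: linorder_cases)
        case less
        then have "fls_subdegree (inverse x) > 0" by simp
        then show ?thesis by (auto simp: lex_ring_def simp del: fls_inverse_subdegree)
      next
        case equal
        then show ?thesis using True by (auto simp: lex_ring_def)
      next
        case greater
        then show ?thesis by (auto simp: lex_ring_def)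
      qed
    next
      case False
      then have x: "x $$ 0 \<noteq> 0" "\<forall>n<0. x $$ n = 0"
        using nth_fls_subdegree_nonzero[of x] by auto
      show ?thesis
      proof (cases "fls_subdegree (x $$ 0) \<ge> 0")
        case True
        then show ?thesis using x by (auto simp: lex_ring_def)
      next
        case False
        then have "fls_subdegree (inverse (x $$ 0)) > 0" by simp
        then show ?thesis using x
          by (auto simp: lex_ring_def inv0 simp del: fls_inverse_subdegree)
      qed
    qed
    show "inverse x \<in> lex_ring" if "x \<in> lex_ring" "lex_residue x \<noteq> 0"
    proof -
      have "x $$ 0 \<noteq> 0" using that by (auto simp: lex_residue_def)
      then show ?thesis
      using that inv0[of x] inv0[of "x $$ 0"]
      by (auto simp: lex_ring_def lex_residue_def)
    qed
  qed (auto simp: lex_ring_times, auto simp: lex_ring_def lex_residue_def)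
qed

interpretation lex: valuation_ring lex_ring lex_residue
  by (rule valuation_ring_lex)

text \<open>The operator x_1 d/dx_1, since x_1 is the outer variable; its companion
  \<open>theta2\<close> is x_2 d/dx_2.\<close>

definition theta1 :: "complex fls fls \<Rightarrow> complex fls fls" where
  "theta1 = fls_euler"

definition theta2 :: "complex fls fls \<Rightarrow> complex fls fls" where
  "theta2 = fls_map fls_euler"

lemma theta_nth [simp]: "theta1 f $$ n = of_int n * f $$ n" "theta2 f $$ n = fls_euler (f $$ n)"
  by (simp_all add: theta1_def theta2_def fls_map_nth)

lemma derivation_theta: "derivation theta1" "derivation theta2"
  unfolding theta1_def theta2_def by (intro derivation_fls_map derivation_fls_euler)+

lemma of_int_fls_nth: "((of_int k :: 'a::comm_ring_1 fls) * g) $$ m = of_int k * g $$ m"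
  by (fact fls_mult_of_int_nth)

lemma theta_lex:
  assumes "f \<in> lex_ring"
  shows "theta1 f \<in> lex_ring" "theta2 f \<in> lex_ring" "lex_residue (theta1 f) = 0" "lex_residue (theta2 f) = 0"
  using assms by (auto simp: lex_ring_def lex_residue_def)

lemma theta_commute: "theta1 (theta2 f) = theta2 (theta1 f)"
  by (rule fls_eqI, rule fls_eqI) (simp add: of_int_fls_nth)

section \<open>Embedding of the power series ring into the field of iterated Laurent series\<close>

definition to_lex :: "fps2 \<Rightarrow> complex fls fls" where
  "to_lex w = fps_to_fls (Abs_fps (\<lambda>n. fps_to_fls (fps_nth w n)))"

lemma to_lex_nth: "to_lex w $$ n = (if n < 0 then 0 else fps_to_fls (fps_nth w (nat n)))"
  by (simp add: to_lex_def)

lemma to_lex_add: "to_lex (v + w) = to_lex v + to_lex w"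
  by (rule fls_eqI) (simp add: to_lex_nth)

lemma to_lex_diff: "to_lex (v - w) = to_lex v - to_lex w"
  by (rule fls_eqI) (simp add: to_lex_nth)

lemma to_lex_0 [simp]: "to_lex 0 = 0" by (rule fls_eqI) (simp add: to_lex_nth)
lemma to_lex_1 [simp]: "to_lex 1 = 1" by (rule fls_eqI) (auto simp: to_lex_nth)

lemma fps_to_fls_sum: "fps_to_fls (sum f A) = (\<Sum>x\<in>A. fps_to_fls (f x))"
  by (induction A rule: infinite_finite_induct) auto

lemma to_lex_mult: "to_lex (v * w) = to_lex v * to_lex w"
proof -
  have "Abs_fps (\<lambda>n. fps_to_fls (fps_nth (v * w) n)) =
     Abs_fps (\<lambda>n. fps_to_fls (fps_nth v n)) * Abs_fps (\<lambda>n. fps_to_fls (fps_nth w n))"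
    by (rule fps_ext) (simp add: fps_mult_nth fps_to_fls_sum fls_times_fps_to_fls)
  then show ?thesis by (simp add: to_lex_def fls_times_fps_to_fls)
qed

lemma to_lex_sum: "to_lex (sum f A) = (\<Sum>x\<in>A. to_lex (f x))"
  by (induction A rule: infinite_finite_induct) (auto simp: to_lex_add)

lemma to_lex_prod: "to_lex (prod f A) = (\<Prod>x\<in>A. to_lex (f x))"
  by (induction A rule: infinite_finite_induct) (auto simp: to_lex_mult)

lemma to_lex_power: "to_lex (w ^ n) = to_lex w ^ n"
  by (induction n) (auto simp: to_lex_mult)

lemma to_lex_of_nat: "to_lex (of_nat n) = of_nat n"
  by (induction n) (auto simp: to_lex_add)

lemma to_lex_of_int: "to_lex (of_int n) = of_int n"
  by (cases n rule: int_diff_cases) (auto simp: to_lex_diff to_lex_of_nat)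

lemma to_lex_eq_iff: "to_lex v = to_lex w \<longleftrightarrow> v = w"
  by (auto simp: to_lex_def fps_eq_iff)

lemma to_lex_in: "to_lex w \<in> lex_ring"
  by (auto simp: lex_ring_def to_lex_nth)

lemma lex_residue_to_lex: "lex_residue (to_lex w) = coeff2 w 0 0"
  by (simp add: lex_residue_def to_lex_nth coeff2_def)

lemma to_lex_det:
  fixes A :: "fps2^'n^'n"
  shows "to_lex (det A) = det (mmap to_lex A)"
  by (simp add: det_def to_lex_sum to_lex_mult to_lex_of_int to_lex_prod)

lemma coeff2_eqI: "(\<And>n m. coeff2 v n m = coeff2 w n m) \<Longrightarrow> v = w"
  by (auto simp: coeff2_def intro!: fps_ext)

lemma theta1_to_lex: "theta1 (to_lex w) = to_lex (X1 * fdx1 w)"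
  by (rule fls_eqI)
    (auto simp: to_lex_nth X1_def fdx1_def fps_X_mult_right_nth not_less simp flip: fps_of_nat fls_of_nat intro!: fls_eqI)

lemma theta2_to_lex: "theta2 (to_lex w) = to_lex (X2 * fdx2 w)"
  by (rule fls_eqI) (auto simp: to_lex_nth X2_def fdx2_def fls_euler_def fls_deriv_fps_to_fls
      fls_times_fps_to_fls)

lemma (in derivation) eigen_power:
  assumes "D x = c * x"
  shows "D (x ^ n) = of_nat n * c * x ^ n"
  by (induction n) (simp_all add: mult assms algebra_simps)

lemma to_lex_X1: "to_lex X1 = fls_X"
  by (rule fls_eqI) (auto simp: to_lex_nth X1_def fps_X_nth)

lemma to_lex_X2: "to_lex X2 = fls_const fls_X"
  by (rule fls_eqI) (auto simp: to_lex_nth X2_def)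

lemma theta_monomial:
  "theta1 (to_lex (X1 ^ p * X2 ^ q)) = of_nat p * to_lex (X1 ^ p * X2 ^ q)"
  "theta2 (to_lex (X1 ^ p * X2 ^ q)) = of_nat q * to_lex (X1 ^ p * X2 ^ q)"
proof -
  interpret t1: derivation theta1 by (rule derivation_theta)
  interpret t2: derivation theta2 by (rule derivation_theta)
  have 1: "theta1 (to_lex X1) = 1 * to_lex X1" "theta1 (to_lex X2) = 0 * to_lex X2"
    by (simp_all add: theta1_to_lex, simp_all add: fdx1_def X1_def X2_def)
  have 2: "fdx2 X1 = 0" "fdx2 X2 = 1"
    by (auto simp: fdx2_def X1_def X2_def fps_eq_iff fps_X_nth fps_one_nth)
  have 3: "theta2 (to_lex X1) = 0 * to_lex X1" "theta2 (to_lex X2) = 1 * to_lex X2"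
    by (simp_all add: theta2_to_lex 2)
  show "theta1 (to_lex (X1 ^ p * X2 ^ q)) = of_nat p * to_lex (X1 ^ p * X2 ^ q)"
    by (simp add: to_lex_mult to_lex_power t1.mult t1.eigen_power[OF 1(1)] t1.eigen_power[OF 1(2)])
  show "theta2 (to_lex (X1 ^ p * X2 ^ q)) = of_nat q * to_lex (X1 ^ p * X2 ^ q)"
    by (simp add: to_lex_mult to_lex_power t2.mult t2.eigen_power[OF 3(1)] t2.eigen_power[OF 3(2)])
qed

lemma to_lex_monomial_nonzero: "to_lex (X1 ^ p * X2 ^ q) \<noteq> 0"
  by (simp add: to_lex_mult to_lex_power to_lex_X1 to_lex_X2)

text \<open>A positive power of x_1 outweighs any negative power of x_2; if the powers of x_1 agree,
  a positive power of x_2 is left. Hence for distinct monomials one of the two quotients lies in the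
  maximal ideal.\<close>

lemma lex_monomial_ratio:
  assumes "p' < p \<or> p' = p \<and> q' < q"
  shows "to_lex (X1 ^ p * X2 ^ q) / to_lex (X1 ^ p' * X2 ^ q') \<in> lex_ring"
    "lex_residue (to_lex (X1 ^ p * X2 ^ q) / to_lex (X1 ^ p' * X2 ^ q')) = 0"
proof -
  let ?r = "to_lex (X1 ^ p * X2 ^ q) / to_lex (X1 ^ p' * X2 ^ q')"
  have "?r \<in> lex_ring \<and> lex_residue ?r = 0"
  proof (cases "p' < p")
    case True
    define c :: "complex fls" where "c = fls_X ^ q / fls_X ^ q'"
    have pw: "fls_const a ^ n = fls_const (a ^ n)" for a :: "complex fls" and n by (induction n) auto
    have "c * fls_X ^ q' = fls_X ^ q"
      unfolding c_def divide_inverse mult.assoc by (subst left_inverse) auto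
    then have h: "fls_const (fls_X ^ q :: complex fls) = fls_const c * fls_const (fls_X ^ q')"
      by simp
    have h': "fls_X ^ p = (fls_X ^ (p - p') * fls_X ^ p' :: complex fls fls)"
      using True by (simp flip: power_add)
    have "?r = fls_X ^ (p - p') * fls_const c"
      by (subst nonzero_divide_eq_eq[OF to_lex_monomial_nonzero])
        (simp only: to_lex_mult to_lex_power to_lex_X1 to_lex_X2 pw h h' ac_simps)
    moreover have "(fls_X ^ (p - p') * fls_const c) $$ n = 0" if "n \<le> 0" for n
      unfolding fls_X_power_times_conv_shift(1) using that True by simp
    ultimately have "?r $$ n = 0" if "n \<le> 0" for n using that by simp
    then show ?thesis by (auto simp: lex_ring_def lex_residue_def)
  next
    case False
    then have eq: "p' = p" "q' < q" using assms by auto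
    have "?r = to_lex (X2 ^ (q - q'))"
      using eq by (subst nonzero_divide_eq_eq[OF to_lex_monomial_nonzero])
        (simp add: ac_simps flip: to_lex_mult power_add)
    moreover have "lex_residue (to_lex X2) = 0"
      by (simp add: lex_residue_to_lex coeff2_def X2_def)
    then have "lex_residue (to_lex (X2 ^ (q - q'))) = 0"
      using eq by (cases "q - q'") (auto simp: to_lex_mult lex_ring_times(2) to_lex_in)
    ultimately show ?thesis by (simp add: to_lex_in)
  qed
  then show "?r \<in> lex_ring" "lex_residue ?r = 0" by auto
qed

section \<open>Power series in several variables and formal substitution\<close>

abbreviation mdeg :: "('v::finite \<Rightarrow> nat) \<Rightarrow> nat" where
  "mdeg \<alpha> \<equiv> sum \<alpha> UNIV"

definition mon :: "('v::finite \<Rightarrow> 'a::comm_monoid_mult) \<Rightarrow> ('v \<Rightarrow> nat) \<Rightarrow> 'a" where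
  "mon u \<alpha> = (\<Prod>j\<in>UNIV. u j ^ \<alpha> j)"

abbreviation add_exp :: "('v \<Rightarrow> nat) \<Rightarrow> ('v \<Rightarrow> nat) \<Rightarrow> 'v \<Rightarrow> nat" where
  "add_exp \<alpha> \<beta> \<equiv> \<lambda>i. \<alpha> i + \<beta> i"

abbreviation unit_exp :: "'v \<Rightarrow> 'v \<Rightarrow> nat" where
  "unit_exp j \<equiv> (\<lambda>_. 0)(j := 1)"

abbreviation inc_exp :: "'v \<Rightarrow> ('v \<Rightarrow> nat) \<Rightarrow> 'v \<Rightarrow> nat" where
  "inc_exp j \<alpha> \<equiv> \<alpha>(j := Suc (\<alpha> j))"

lemma mdeg_inc_exp [simp]: "mdeg (inc_exp j \<alpha>) = Suc (mdeg \<alpha>)"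
proof -
  have "mdeg (inc_exp j \<alpha>) = Suc (\<alpha> j) + sum \<alpha> (UNIV - {j})"
    by (subst sum.remove[of _ j]) auto
  also have "\<dots> = Suc (mdeg \<alpha>)" by (subst (2) sum.remove[of _ j]) auto
  finally show ?thesis .
qed

lemma mon_zero_exp [simp]: "mon u (\<lambda>_. 0) = 1"
  by (simp add: mon_def)

lemma mon_add_exp: "mon u (add_exp \<alpha> \<beta>) = mon u \<alpha> * mon u \<beta>"
  by (simp add: mon_def power_add prod.distrib)

lemma mon_inc_exp: "mon u (inc_exp j \<alpha>) = u j * mon u \<alpha>"
proof -
  have "mon u (inc_exp j \<alpha>) = u j ^ Suc (\<alpha> j) * (\<Prod>i\<in>UNIV - {j}. u i ^ \<alpha> i)"
    unfolding mon_def by (subst prod.remove[of _ j]) (auto intro!: prod.cong)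
  moreover have "mon u \<alpha> = u j ^ \<alpha> j * (\<Prod>i\<in>UNIV - {j}. u i ^ \<alpha> i)"
    unfolding mon_def by (subst prod.remove[of _ j]) auto
  ultimately show ?thesis by (simp add: mult.assoc)
qed

lemma mon_unit_exp: "mon u (unit_exp j) = u j"
  using mon_inc_exp[where u = u and j = j and \<alpha> = "\<lambda>_. 0"] by simp

lemma finite_mdeg_le [simp]: "finite {\<alpha>::'v::finite \<Rightarrow> nat. mdeg \<alpha> \<le> N}"
proof (rule finite_subset)
  show "{\<alpha>::'v \<Rightarrow> nat. mdeg \<alpha> \<le> N} \<subseteq> Pi\<^sub>E UNIV (\<lambda>_. {..N})"
  proof
    fix \<alpha> :: "'v \<Rightarrow> nat" assume "\<alpha> \<in> {\<alpha>. mdeg \<alpha> \<le> N}"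
    then have "\<alpha> j \<le> N" for j using member_le_sum[of j UNIV \<alpha>] by auto
    then show "\<alpha> \<in> Pi\<^sub>E UNIV (\<lambda>_. {..N})" by auto
  qed
qed (auto intro: finite_PiE)

lemma finite_exp_le [simp]: "finite {\<beta>::'v::finite \<Rightarrow> nat. \<beta> \<le> \<alpha>}"
proof (rule finite_subset)
  show "{\<beta>. \<beta> \<le> \<alpha>} \<subseteq> {\<beta>. mdeg \<beta> \<le> mdeg \<alpha>}" by (auto simp: le_fun_def intro: sum_mono)
qed auto

text \<open>Power series in the variables \<open>'v\<close> over the complex numbers are represented by their
  coefficient families.\<close>

definition pd :: "'v \<Rightarrow> (('v \<Rightarrow> nat) \<Rightarrow> complex) \<Rightarrow> ('v \<Rightarrow> nat) \<Rightarrow> complex" where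
  "pd j F \<alpha> = of_nat (Suc (\<alpha> j)) * F (inc_exp j \<alpha>)"

definition pmul :: "(('v::finite \<Rightarrow> nat) \<Rightarrow> complex) \<Rightarrow> (('v \<Rightarrow> nat) \<Rightarrow> complex) \<Rightarrow> ('v \<Rightarrow> nat) \<Rightarrow> complex" where
  "pmul F G \<alpha> = (\<Sum>\<beta>\<in>{\<beta>. \<beta> \<le> \<alpha>}. F \<beta> * G (\<lambda>i. \<alpha> i - \<beta> i))"

definition pmono :: "('v \<Rightarrow> nat) \<Rightarrow> ('v \<Rightarrow> nat) \<Rightarrow> complex" where
  "pmono \<mu> = (\<lambda>\<alpha>. if \<alpha> = \<mu> then 1 else 0)"

definition convergent_ps :: "(('v::finite \<Rightarrow> nat) \<Rightarrow> complex) \<Rightarrow> bool" where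
  "convergent_ps F \<longleftrightarrow> (\<exists>C\<ge>0. \<exists>R\<ge>1. \<forall>\<alpha>. norm (F \<alpha>) \<le> C * R ^ mdeg \<alpha>)"

lemma pd_commute: "pd i (pd j F) = pd j (pd i F)"
  by (cases "i = j") (auto simp: pd_def fun_eq_iff fun_upd_twist)

lemma pd_add: "pd j (\<lambda>\<alpha>. F \<alpha> + G \<alpha>) = (\<lambda>\<alpha>. pd j F \<alpha> + pd j G \<alpha>)"
  by (simp add: pd_def fun_eq_iff algebra_simps)

lemma pd_diff: "pd j (\<lambda>\<alpha>. F \<alpha> - G \<alpha>) = (\<lambda>\<alpha>. pd j F \<alpha> - pd j G \<alpha>)"
  by (simp add: pd_def fun_eq_iff algebra_simps)

lemma pd_sum: "pd j (\<lambda>\<alpha>. \<Sum>i\<in>I. F i \<alpha>) = (\<lambda>\<alpha>. \<Sum>i\<in>I. pd j (F i) \<alpha>)"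
  by (simp add: pd_def fun_eq_iff sum_distrib_left)

lemma pd_cmult: "pd j (\<lambda>\<alpha>. c * F \<alpha>) = (\<lambda>\<alpha>. c * pd j F \<alpha>)"
  by (simp add: pd_def fun_eq_iff)

lemma pd_pmono: "\<mu> j = 0 \<Longrightarrow> pd j (pmono \<mu>) = (\<lambda>_. 0)"
  by (auto simp: pd_def pmono_def fun_eq_iff)

lemma pmul_zero [simp]: "pmul (\<lambda>_. 0) G = (\<lambda>_. 0)"
  by (simp add: pmul_def fun_eq_iff)

lemma pmul_alt: "pmul F G \<alpha> = (\<Sum>(\<beta>, \<gamma>)\<in>{(\<beta>, \<gamma>). add_exp \<beta> \<gamma> = \<alpha>}. F \<beta> * G \<gamma>)"
  unfolding pmul_def
  by (rule sum.reindex_bij_witness[of _ fst "\<lambda>\<beta>. (\<beta>, \<lambda>i. \<alpha> i - \<beta> i)"]) (auto simp: le_fun_def)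

lemma finite_add_exp [simp]: "finite {(\<beta>, \<gamma>). add_exp \<beta> \<gamma> = (\<alpha>::'v::finite \<Rightarrow> nat)}"
proof (rule finite_subset)
  show "{(\<beta>, \<gamma>). add_exp \<beta> \<gamma> = \<alpha>} \<subseteq> {\<beta>. \<beta> \<le> \<alpha>} \<times> {\<beta>. \<beta> \<le> \<alpha>}"
    by (auto simp: le_fun_def)
qed auto

text \<open>Leibniz rule: the factor \<open>\<alpha> j + 1\<close> is split as
  \<open>\<beta> j + \<gamma> j\<close> over the pairs of exponents with sum
  \<open>inc_exp j \<alpha>\<close>, and each half is reindexed by lowering one exponent.\<close>

lemma pd_pmul: "pd j (pmul F G) = (\<lambda>\<alpha>. pmul (pd j F) G \<alpha> + pmul F (pd j G) \<alpha>)"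
proof
  fix \<alpha>
  let ?I = "\<lambda>\<alpha>. {(\<beta>, \<gamma>). add_exp \<beta> \<gamma> = \<alpha>}"
  have "pd j (pmul F G) \<alpha> = (\<Sum>(\<beta>, \<gamma>)\<in>?I (inc_exp j \<alpha>). of_nat (Suc (\<alpha> j)) * (F \<beta> * G \<gamma>))"
    by (simp add: pd_def pmul_alt sum_distrib_left case_prod_unfold)
  also have "\<dots> = (\<Sum>(\<beta>, \<gamma>)\<in>?I (inc_exp j \<alpha>). of_nat (\<beta> j) * F \<beta> * G \<gamma>) +
      (\<Sum>(\<beta>, \<gamma>)\<in>?I (inc_exp j \<alpha>). of_nat (\<gamma> j) * F \<beta> * G \<gamma>)"
    unfolding sum.distrib[symmetric]
  proof (intro sum.cong refl, clarsimp)
    fix \<beta> \<gamma> assume "add_exp \<beta> \<gamma> = inc_exp j \<alpha>"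
    then have "\<beta> j + \<gamma> j = Suc (\<alpha> j)" by (metis fun_upd_same)
    then have "of_nat (Suc (\<alpha> j)) = (of_nat (\<beta> j) + of_nat (\<gamma> j) :: complex)" by (metis of_nat_add)
    then show "(1 + of_nat (\<alpha> j)) * (F \<beta> * G \<gamma>) = of_nat (\<beta> j) * F \<beta> * G \<gamma> + of_nat (\<gamma> j) * F \<beta> * G \<gamma>"
      by (simp add: algebra_simps)
  qed
  also have "(\<Sum>(\<beta>, \<gamma>)\<in>?I (inc_exp j \<alpha>). of_nat (\<beta> j) * F \<beta> * G \<gamma>) = pmul (pd j F) G \<alpha>"
  proof -
    have "(\<Sum>(\<beta>, \<gamma>)\<in>?I (inc_exp j \<alpha>). of_nat (\<beta> j) * F \<beta> * G \<gamma>) =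
       (\<Sum>(\<beta>, \<gamma>)\<in>{(\<beta>, \<gamma>)\<in>?I (inc_exp j \<alpha>). \<beta> j \<noteq> 0}. of_nat (\<beta> j) * F \<beta> * G \<gamma>)"
      by (rule sum.mono_neutral_right) auto
    also have "\<dots> = (\<Sum>(\<beta>, \<gamma>)\<in>?I \<alpha>. pd j F \<beta> * G \<gamma>)"
      by (rule sum.reindex_bij_witness[of _ "\<lambda>(\<beta>, \<gamma>). (inc_exp j \<beta>, \<gamma>)" "\<lambda>(\<beta>, \<gamma>). (\<beta>(j := \<beta> j - 1), \<gamma>)"])
        (auto simp: pd_def fun_eq_iff split: if_splits)
    finally show ?thesis by (simp add: pmul_alt)
  qed
  also have "(\<Sum>(\<beta>, \<gamma>)\<in>?I (inc_exp j \<alpha>). of_nat (\<gamma> j) * F \<beta> * G \<gamma>) = pmul F (pd j G) \<alpha>"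
  proof -
    have "(\<Sum>(\<beta>, \<gamma>)\<in>?I (inc_exp j \<alpha>). of_nat (\<gamma> j) * F \<beta> * G \<gamma>) =
       (\<Sum>(\<beta>, \<gamma>)\<in>{(\<beta>, \<gamma>)\<in>?I (inc_exp j \<alpha>). \<gamma> j \<noteq> 0}. of_nat (\<gamma> j) * F \<beta> * G \<gamma>)"
      by (rule sum.mono_neutral_right) auto
    also have "\<dots> = (\<Sum>(\<beta>, \<gamma>)\<in>?I \<alpha>. F \<beta> * pd j G \<gamma>)"
      by (rule sum.reindex_bij_witness[of _ "\<lambda>(\<beta>, \<gamma>). (\<beta>, inc_exp j \<gamma>)" "\<lambda>(\<beta>, \<gamma>). (\<beta>, \<gamma>(j := \<gamma> j - 1))"])
        (auto simp: pd_def fun_eq_iff split: if_splits)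
    finally show ?thesis by (simp add: pmul_alt)
  qed
  finally show "pd j (pmul F G) \<alpha> = pmul (pd j F) G \<alpha> + pmul F (pd j G) \<alpha>" .
qed

lemma convergent_psE:
  assumes "convergent_ps F" "convergent_ps G"
  obtains C R where "C \<ge> 0" "R \<ge> 1" "\<And>\<alpha>. norm (F \<alpha>) \<le> C * R ^ mdeg \<alpha>" "\<And>\<alpha>. norm (G \<alpha>) \<le> C * R ^ mdeg \<alpha>"
proof -
  obtain C R C' R' where F: "C \<ge> 0" "R \<ge> 1" "\<And>\<alpha>. norm (F \<alpha>) \<le> C * R ^ mdeg \<alpha>"
    and G: "C' \<ge> 0" "R' \<ge> 1" "\<And>\<alpha>. norm (G \<alpha>) \<le> C' * R' ^ mdeg \<alpha>"
    using assms by (auto simp: convergent_ps_def)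
  have "norm (F \<alpha>) \<le> max C C' * max R R' ^ mdeg \<alpha>" for \<alpha>
    by (rule order.trans[OF F(3)]) (use F G in \<open>auto intro!: mult_mono power_mono\<close>)
  moreover have "norm (G \<alpha>) \<le> max C C' * max R R' ^ mdeg \<alpha>" for \<alpha>
    by (rule order.trans[OF G(3)]) (use F G in \<open>auto intro!: mult_mono power_mono\<close>)
  ultimately show ?thesis using that[of "max C C'" "max R R'"] F G by auto
qed

lemma convergent_ps_add:
  assumes "convergent_ps F" "convergent_ps G"
  shows "convergent_ps (\<lambda>\<alpha>. F \<alpha> + G \<alpha>)"
proof -
  obtain C R where *: "C \<ge> 0" "R \<ge> 1" "\<And>\<alpha>. norm (F \<alpha>) \<le> C * R ^ mdeg \<alpha>" "\<And>\<alpha>. norm (G \<alpha>) \<le> C * R ^ mdeg \<alpha>"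
    by (rule convergent_psE[OF assms]) (rule that)
  have "norm (F \<alpha> + G \<alpha>) \<le> (2 * C) * R ^ mdeg \<alpha>" for \<alpha>
    using norm_triangle_ineq[of "F \<alpha>" "G \<alpha>"] *(3,4)[of \<alpha>] by simp
  then show ?thesis unfolding convergent_ps_def using * by (intro exI[of _ "2 * C"]) auto
qed

lemma convergent_ps_cmult:
  assumes "convergent_ps F"
  shows "convergent_ps (\<lambda>\<alpha>. c * F \<alpha>)"
proof -
  obtain C R where *: "C \<ge> 0" "R \<ge> 1" "\<And>\<alpha>. norm (F \<alpha>) \<le> C * R ^ mdeg \<alpha>"
    using assms by (auto simp: convergent_ps_def)
  have "norm (c * F \<alpha>) \<le> (norm c * C) * R ^ mdeg \<alpha>" for \<alpha>
    using mult_left_mono[OF *(3)[of \<alpha>], of "norm c"] by (simp add: norm_mult mult.assoc)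
  then show ?thesis unfolding convergent_ps_def using * by (intro exI[of _ "norm c * C"]) auto
qed

lemma convergent_ps_diff:
  "convergent_ps F \<Longrightarrow> convergent_ps G \<Longrightarrow> convergent_ps (\<lambda>\<alpha>. F \<alpha> - G \<alpha>)"
  using convergent_ps_add[of F "\<lambda>\<alpha>. (-1) * G \<alpha>"] convergent_ps_cmult[of G "-1"] by simp

lemma convergent_ps_finite: 
  assumes "finite {\<alpha>. F \<alpha> \<noteq> 0}"
  shows "convergent_ps F"
proof -
  have "norm (F \<alpha>) \<le> (\<Sum>\<beta>\<in>{\<alpha>. F \<alpha> \<noteq> 0}. norm (F \<beta>)) * 1 ^ mdeg \<alpha>" for \<alpha>
    using member_le_sum[of \<alpha> "{\<alpha>. F \<alpha> \<noteq> 0}" "\<lambda>\<beta>. norm (F \<beta>)"] assms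
    by (cases "F \<alpha> = 0") (auto intro!: sum_nonneg)
  then show ?thesis unfolding convergent_ps_def
    by (intro exI[of _ "\<Sum>\<beta>\<in>{\<alpha>. F \<alpha> \<noteq> 0}. norm (F \<beta>)"]) (auto intro!: sum_nonneg)
qed

lemma convergent_ps_sum:
  assumes "\<And>i. i \<in> I \<Longrightarrow> convergent_ps (F i)"
  shows "convergent_ps (\<lambda>\<alpha>. \<Sum>i\<in>I. F i \<alpha>)"
  using assms
  by (induction I rule: infinite_finite_induct) (auto intro: convergent_ps_add convergent_ps_finite)

text \<open>The factor \<open>\<alpha> j + 1\<close> is at most 2 to the power
  \<open>mdeg \<alpha>\<close> and is absorbed by doubling \<open>R\<close>.\<close>

lemma convergent_ps_pd:
  assumes "convergent_ps F"
  shows "convergent_ps (pd j F)"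
proof -
  obtain C R where *: "C \<ge> 0" "R \<ge> 1" "\<And>\<alpha>. norm (F \<alpha>) \<le> C * R ^ mdeg \<alpha>"
    using assms by (auto simp: convergent_ps_def)
  have "norm (pd j F \<alpha>) \<le> (C * R) * (2 * R) ^ mdeg \<alpha>" for \<alpha>
  proof -
    have "\<alpha> j \<le> mdeg \<alpha>" by (rule member_le_sum) auto
    then have "Suc (\<alpha> j) \<le> 2 ^ mdeg \<alpha>"
      using less_exp[of "mdeg \<alpha>"] by linarith
    then have "real (Suc (\<alpha> j)) \<le> 2 ^ mdeg \<alpha>" by (metis of_nat_le_iff of_nat_numeral of_nat_power)
    then have "real (Suc (\<alpha> j)) * norm (F (inc_exp j \<alpha>)) \<le> 2 ^ mdeg \<alpha> * (C * R ^ mdeg (inc_exp j \<alpha>))"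
      by (intro mult_mono *) auto
    then show ?thesis
      by (simp only: pd_def norm_mult norm_of_nat mdeg_inc_exp) (simp add: power_mult_distrib mult_ac)
  qed
  then show ?thesis unfolding convergent_ps_def using *
    by (intro exI[of _ "C * R"] conjI exI[of _ "2 * R"]) auto
qed

text \<open>Bounds the number of terms in a coefficient of a Cauchy product, so that multiplying
  convergent series costs only a doubling of \<open>R\<close>.\<close>

lemma card_exp_le: "card {\<beta>::'v::finite \<Rightarrow> nat. \<beta> \<le> \<alpha>} \<le> 2 ^ mdeg \<alpha>"
proof -
  have "{\<beta>. \<beta> \<le> \<alpha>} = Pi\<^sub>E UNIV (\<lambda>i. {..\<alpha> i})" by (auto simp: le_fun_def PiE_iff)
  then have "card {\<beta>. \<beta> \<le> \<alpha>} = (\<Prod>i\<in>UNIV. Suc (\<alpha> i))" by (simp add: card_PiE)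
  also have "\<dots> \<le> (\<Prod>i\<in>UNIV. 2 ^ \<alpha> i)" by (intro prod_mono) (auto simp: Suc_le_eq)
  also have "\<dots> = 2 ^ mdeg \<alpha>" by (simp add: power_sum)
  finally show ?thesis .
qed

lemma convergent_ps_pmul:
  assumes "convergent_ps F" "convergent_ps G"
  shows "convergent_ps (pmul F G)"
proof -
  obtain C R where *: "C \<ge> 0" "R \<ge> 1" "\<And>\<alpha>. norm (F \<alpha>) \<le> C * R ^ mdeg \<alpha>" "\<And>\<alpha>. norm (G \<alpha>) \<le> C * R ^ mdeg \<alpha>"
    by (rule convergent_psE[OF assms]) (rule that)
  have "norm (pmul F G \<alpha>) \<le> (C * C) * (2 * R) ^ mdeg \<alpha>" for \<alpha>
  proof -
    have "norm (pmul F G \<alpha>) \<le> (\<Sum>\<beta>\<in>{\<beta>. \<beta> \<le> \<alpha>}. C * C * R ^ mdeg \<alpha>)"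
      unfolding pmul_def
    proof (rule sum_norm_le)
      fix \<beta> assume "\<beta> \<in> {\<beta>. \<beta> \<le> \<alpha>}"
      then have "mdeg \<beta> + mdeg (\<lambda>i. \<alpha> i - \<beta> i) = mdeg \<alpha>"
        by (auto simp: le_fun_def simp flip: sum.distrib)
      moreover have "norm (F \<beta> * G (\<lambda>i. \<alpha> i - \<beta> i)) \<le> (C * R ^ mdeg \<beta>) * (C * R ^ mdeg (\<lambda>i. \<alpha> i - \<beta> i))"
        unfolding norm_mult using * by (intro mult_mono) auto
      moreover have "(C * R ^ a) * (C * R ^ b) = C * C * R ^ (a + b)" for a b
        by (simp add: power_add)
      ultimately show "norm (F \<beta> * G (\<lambda>i. \<alpha> i - \<beta> i)) \<le> C * C * R ^ mdeg \<alpha>"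
        by metis
    qed
    also have "\<dots> = real (card {\<beta>. \<beta> \<le> \<alpha>}) * (C * C * R ^ mdeg \<alpha>)" by simp
    also have "\<dots> \<le> 2 ^ mdeg \<alpha> * (C * C * R ^ mdeg \<alpha>)"
    proof (rule mult_right_mono)
      show "real (card {\<beta>. \<beta> \<le> \<alpha>}) \<le> 2 ^ mdeg \<alpha>"
        using card_exp_le[of \<alpha>] by (metis of_nat_le_iff of_nat_numeral of_nat_power)
    qed (use * in auto)
    finally show ?thesis by (simp add: power_mult_distrib mult_ac)
  qed
  then show ?thesis unfolding convergent_ps_def using *
    by (intro exI[of _ "C * C"] conjI exI[of _ "2 * R"]) auto
qed

section \<open>Order of vanishing at the origin, and formal substitution into a power series\<close>

definition vanish :: "nat \<Rightarrow> fps2 \<Rightarrow> bool" where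
  "vanish N w \<longleftrightarrow> (\<forall>n m. n + m < N \<longrightarrow> coeff2 w n m = 0)"

definition cst :: "complex \<Rightarrow> fps2" where
  "cst c = fps_const (fps_const c)"

lemma coeff2_simps [simp]: "coeff2 (v + w) n m = coeff2 v n m + coeff2 w n m"
  "coeff2 (v - w) n m = coeff2 v n m - coeff2 w n m" "coeff2 0 n m = 0" 
  "coeff2 (cst c * v) n m = c * coeff2 v n m"
  by (simp_all add: coeff2_def cst_def)

lemma coeff2_sum: "coeff2 (sum f A) n m = (\<Sum>x\<in>A. coeff2 (f x) n m)"
  by (induction A rule: infinite_finite_induct) auto

lemma coeff2_mult: "coeff2 (v * w) n m = (\<Sum>i=0..n. \<Sum>j=0..m. coeff2 v i j * coeff2 w (n - i) (m - j))"
  by (simp add: coeff2_def fps_mult_nth fps_sum_nth)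

lemma cst_simps [simp]: "cst 0 = 0" "cst 1 = 1" "cst (a + b) = cst a + cst b" "cst (a * b) = cst a * cst b"
  by (simp_all add: cst_def)

lemma vanish_add: "vanish N v \<Longrightarrow> vanish N w \<Longrightarrow> vanish N (v + w)"
  and vanish_diff: "vanish N v \<Longrightarrow> vanish N w \<Longrightarrow> vanish N (v - w)"
  and vanish_zero [simp]: "vanish N 0"
  by (simp_all add: vanish_def)

lemma vanish_sum: "(\<And>x. x \<in> A \<Longrightarrow> vanish N (f x)) \<Longrightarrow> vanish N (sum f A)"
  by (induction A rule: infinite_finite_induct) (auto intro: vanish_add)

lemma vanish_mono: "vanish N w \<Longrightarrow> M \<le> N \<Longrightarrow> vanish M w"
  by (auto simp: vanish_def)

lemma vanish_mult: "vanish N v \<Longrightarrow> vanish M w \<Longrightarrow> vanish (N + M) (v * w)"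
  unfolding vanish_def coeff2_mult
proof (intro allI impI sum.neutral ballI)
  fix n m i j assume *: "\<forall>n m. n + m < N \<longrightarrow> coeff2 v n m = 0" "\<forall>n m. n + m < M \<longrightarrow> coeff2 w n m = 0"
    "n + m < N + M" "i \<in> {0..n}" "j \<in> {0..m}"
  then have "i + j < N \<or> (n - i) + (m - j) < M" by auto
  then show "coeff2 v i j * coeff2 w (n - i) (m - j) = 0" using * by auto
qed

lemma vanish_0 [simp]: "vanish 0 w"
  by (simp add: vanish_def)

lemma vanish_mult_left: "vanish N w \<Longrightarrow> vanish N (v * w)"
  using vanish_mult[of 0 v N w] by simp

lemma vanish_mult_right: "vanish N v \<Longrightarrow> vanish N (v * w)"
  using vanish_mult[of N v 0 w] by simp

text \<open>Identities between substituted series are proved modulo every power of the ideal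
  generated by x_1 and x_2, where they become identities of finite sums.\<close>

lemma vanish_all: "(\<And>N. vanish N w) \<Longrightarrow> w = 0"
  by (rule coeff2_eqI) (auto simp: vanish_def)

lemma vanish_power: "vanish 1 w \<Longrightarrow> vanish n (w ^ n)"
  by (induction n) (auto simp: vanish_mult[of 1 _ _, simplified])

lemma vanish_prod: "(\<And>x. x \<in> A \<Longrightarrow> vanish (k x) (f x)) \<Longrightarrow> vanish (sum k A) (prod f A)"
  by (induction A rule: infinite_finite_induct) (auto simp: vanish_mult)

lemma vanish_mon: "(\<And>j. vanish 1 (u j)) \<Longrightarrow> vanish (mdeg \<alpha>) (mon u \<alpha>)"
  unfolding mon_def by (intro vanish_prod vanish_power) auto

definition psum :: "nat \<Rightarrow> (('v::finite \<Rightarrow> nat) \<Rightarrow> complex) \<Rightarrow> ('v \<Rightarrow> fps2) \<Rightarrow> fps2" where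
  "psum N F u = (\<Sum>\<alpha>\<in>{\<alpha>. mdeg \<alpha> \<le> N}. cst (F \<alpha>) * mon u \<alpha>)"

text \<open>If all \<open>u j\<close> have zero constant term, exponents of degree above n + m
  cannot contribute to the coefficient at (n, m), so the partial sum of degree n + m already gives
  it.\<close>

definition psubst :: "(('v::finite \<Rightarrow> nat) \<Rightarrow> complex) \<Rightarrow> ('v \<Rightarrow> fps2) \<Rightarrow> fps2" where
  "psubst F u = Abs_fps (\<lambda>n. Abs_fps (\<lambda>m. coeff2 (psum (n + m) F u) n m))"

lemma psum_mono_vanish:
  assumes u: "\<And>j. vanish 1 (u j)" and "M \<le> N"
  shows "vanish (M + 1) (psum N F u - psum M F u)"
proof -
  have "psum N F u - psum M F u = (\<Sum>\<alpha>\<in>{\<alpha>. mdeg \<alpha> \<le> N} - {\<alpha>. mdeg \<alpha> \<le> M}. cst (F \<alpha>) * mon u \<alpha>)"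
    unfolding psum_def using \<open>M \<le> N\<close> by (subst sum_diff) auto
  also have "vanish (M + 1) \<dots>"
    by (intro vanish_sum vanish_mult_left vanish_mono[OF vanish_mon[OF u]]) auto
  finally show ?thesis .
qed

lemma psubst_approx:
  assumes u: "\<And>j. vanish 1 (u j)"
  shows "vanish (N + 1) (psubst F u - psum N F u)"
  unfolding vanish_def
proof (intro allI impI)
  fix n m assume nm: "n + m < N + 1"
  then have "vanish (n + m + 1) (psum N F u - psum (n + m) F u)"
    by (intro psum_mono_vanish u) auto
  then have "coeff2 (psum N F u) n m = coeff2 (psum (n + m) F u) n m"
    by (auto simp: vanish_def)
  then show "coeff2 (psubst F u - psum N F u) n m = 0"
    by (simp add: psubst_def coeff2_def)
qed

text \<open>Characterizes substitution by its partial sums; the algebraic rules below follow by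
  checking them on truncations.\<close>

lemma psubst_unique:
  assumes u: "\<And>j. vanish 1 (u j)" and w: "\<And>N. vanish N (w - psum N F u)"
  shows "w = psubst F u"
proof -
  have "vanish N (w - psubst F u)" for N
  proof -
    have "vanish (N + 1) (psubst F u - psum N F u)" by (rule psubst_approx) (fact u)
    then have "vanish N (psubst F u - psum N F u)" by (rule vanish_mono) simp
    from vanish_diff[OF w[of N] this] show ?thesis by simp
  qed
  then have "w - psubst F u = 0" by (rule vanish_all)
  then show ?thesis by simp
qed

context
  fixes u :: "'v::finite \<Rightarrow> fps2"
  assumes u: "\<And>j. vanish 1 (u j)"
begin

lemma psubst_add: "psubst (\<lambda>\<alpha>. F \<alpha> + G \<alpha>) u = psubst F u + psubst G u"
proof (rule psubst_unique[OF u, symmetric])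
  fix N
  have "psubst F u + psubst G u - psum N (\<lambda>\<alpha>. F \<alpha> + G \<alpha>) u
      = (psubst F u - psum N F u) + (psubst G u - psum N G u)"
    by (simp add: psum_def sum.distrib algebra_simps)
  also have "vanish N \<dots>" by (intro vanish_add vanish_mono[OF psubst_approx[OF u]]) auto
  finally show "vanish N (psubst F u + psubst G u - psum N (\<lambda>\<alpha>. F \<alpha> + G \<alpha>) u)" .
qed

lemma psubst_cmult: "psubst (\<lambda>\<alpha>. c * F \<alpha>) u = cst c * psubst F u"
proof (rule psubst_unique[OF u, symmetric])
  fix N
  have "cst c * psubst F u - psum N (\<lambda>\<alpha>. c * F \<alpha>) u = cst c * (psubst F u - psum N F u)"
    by (simp add: psum_def sum_distrib_left algebra_simps)
  also have "vanish N \<dots>" by (intro vanish_mult_left vanish_mono[OF psubst_approx[OF u]]) auto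
  finally show "vanish N (cst c * psubst F u - psum N (\<lambda>\<alpha>. c * F \<alpha>) u)" .
qed

lemma psubst_diff: "psubst (\<lambda>\<alpha>. F \<alpha> - G \<alpha>) u = psubst F u - psubst G u"
  using psubst_add[of F "\<lambda>\<alpha>. (-1) * G \<alpha>"] psubst_cmult[of "-1" G]
  by (simp add: cst_def flip: fps_const_neg)

lemma psubst_zero: "psubst (\<lambda>_. 0) u = 0"
  using psubst_cmult[of 0 "\<lambda>_. 0"] by simp

lemma psubst_sum: "psubst (\<lambda>\<alpha>. \<Sum>i\<in>I. F i \<alpha>) u = (\<Sum>i\<in>I. psubst (F i) u)"
  by (induction I rule: infinite_finite_induct) (auto simp: psubst_zero psubst_add)

lemma psubst_pmono: "psubst (pmono \<mu>) u = mon u \<mu>"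
proof (rule psubst_unique[OF u, symmetric])
  fix N
  have "psum N (pmono \<mu>) u = (\<Sum>\<alpha>\<in>{\<alpha>. mdeg \<alpha> \<le> N}. if \<alpha> = \<mu> then mon u \<mu> else 0)"
    unfolding psum_def pmono_def by (intro sum.cong) auto
  also have "\<dots> = (if mdeg \<mu> \<le> N then mon u \<mu> else 0)" by simp
  finally show "vanish N (mon u \<mu> - psum N (pmono \<mu>) u)"
    using vanish_mono[OF vanish_mon[OF u, of \<mu>], of N] by auto
qed

text \<open>The product of two truncations and the truncation of the product differ only by
  monomials of total degree above N, which vanish to order N.\<close>

lemma psubst_pmul: "psubst (pmul F G) u = psubst F u * psubst G u"
proof (rule psubst_unique[OF u, symmetric])
  fix N
  let ?A = "{\<alpha>::'v \<Rightarrow> nat. mdeg \<alpha> \<le> N}"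
  let ?P = "{(\<beta>::'v \<Rightarrow> nat, \<gamma>::'v \<Rightarrow> nat). mdeg (add_exp \<beta> \<gamma>) \<le> N}"
  have sub: "?P \<subseteq> ?A \<times> ?A" by (auto simp: sum.distrib)
  let ?t = "\<lambda>(\<beta>, \<gamma>). cst (F \<beta> * G \<gamma>) * mon u (add_exp \<beta> \<gamma>)"
  have "psum N F u * psum N G u = sum ?t (?A \<times> ?A)"
    unfolding psum_def sum_product sum.cartesian_product by (simp add: mon_add_exp ac_simps case_prod_unfold)
  moreover have "psum N (pmul F G) u = sum ?t ?P"
  proof -
    have "psum N (pmul F G) u = (\<Sum>\<alpha>\<in>?A. \<Sum>(\<beta>, \<gamma>)\<in>{(\<beta>, \<gamma>). add_exp \<beta> \<gamma> = \<alpha>}. cst (F \<beta> * G \<gamma>) * mon u \<alpha>)"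
      unfolding psum_def
    proof (intro sum.cong refl)
      fix \<alpha> :: "'v \<Rightarrow> nat"
      have "cst (sum f I) = (\<Sum>i\<in>I. cst (f i))" for f :: "('v \<Rightarrow> nat) \<times> ('v \<Rightarrow> nat) \<Rightarrow> complex" and I
        by (induction I rule: infinite_finite_induct) auto
      then show "cst (pmul F G \<alpha>) * mon u \<alpha> = (\<Sum>(\<beta>, \<gamma>)\<in>{(\<beta>, \<gamma>). add_exp \<beta> \<gamma> = \<alpha>}. cst (F \<beta> * G \<gamma>) * mon u \<alpha>)"
        by (simp add: pmul_alt sum_distrib_right case_prod_unfold)
    qed
    also have "\<dots> = (\<Sum>(\<alpha>, \<beta>, \<gamma>)\<in>Sigma ?A (\<lambda>\<alpha>. {(\<beta>, \<gamma>). add_exp \<beta> \<gamma> = \<alpha>}). cst (F \<beta> * G \<gamma>) * mon u \<alpha>)"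
      using finite_add_exp by (subst sum.Sigma) (auto simp: case_prod_unfold)
    also have "\<dots> = sum ?t ?P"
      by (rule sum.reindex_bij_witness[of _ "\<lambda>(\<beta>, \<gamma>). (add_exp \<beta> \<gamma>, \<beta>, \<gamma>)" "\<lambda>(\<alpha>, \<beta>, \<gamma>). (\<beta>, \<gamma>)"]) auto
    finally show ?thesis .
  qed
  moreover have "sum ?t (?A \<times> ?A) - sum ?t ?P = sum ?t (?A \<times> ?A - ?P)"
    by (rule sum_diff[symmetric]) (use sub in auto)
  moreover have "vanish N (sum ?t (?A \<times> ?A - ?P))"
    by (rule vanish_sum) (auto intro!: vanish_mult_left vanish_mono[OF vanish_mon[OF u]])
  ultimately have 1: "vanish N (psum N F u * psum N G u - psum N (pmul F G) u)" by simp
  have "psubst F u * psubst G u - psum N (pmul F G) u =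
     (psubst F u - psum N F u) * psubst G u + psum N F u * (psubst G u - psum N G u)
       + (psum N F u * psum N G u - psum N (pmul F G) u)"
    by (simp add: algebra_simps)
  also have "vanish N \<dots>"
    by (intro vanish_add 1 vanish_mult_left vanish_mult_right vanish_mono[OF psubst_approx[OF u]]) auto
  finally show "vanish N (psubst F u * psubst G u - psum N (pmul F G) u)" .
qed

text \<open>For polynomials this is the Leibniz rule. The assumption that \<open>E\<close> lowers
  the order by at most one is continuity, which carries the formula over from truncations to
  series.\<close>

lemma psubst_chain_rule:
  fixes E :: "fps2 \<Rightarrow> fps2"
  assumes E: "\<And>v w. E (v + w) = E v + E w" "\<And>v w. E (v * w) = E v * w + v * E w" "\<And>c. E (cst c) = 0"
    and van: "\<And>N w. vanish (Suc N) w \<Longrightarrow> vanish N (E w)"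
  shows "E (psubst F u) = (\<Sum>j\<in>UNIV. psubst (pd j F) u * E (u j))"
proof -
  have E0: "E 0 = 0" using E(3)[of 0] by simp
  have E1: "E 1 = 0" using E(3)[of 1] by simp
  have Esum: "E (sum f A) = (\<Sum>x\<in>A. E (f x))" for f :: "('v \<Rightarrow> nat) \<Rightarrow> fps2" and A
    by (induction A rule: infinite_finite_induct) (auto simp: E E0)
  have Ediff: "E (v - w) = E v - E w" for v w
    using E(1)[of "v - w" w] by simp
  have Epow: "E (w ^ n) = of_nat n * w ^ (n - 1) * E w" for w n
  proof (induction n)
    case (Suc n)
    then show ?case by (cases n) (auto simp: E algebra_simps)
  qed (simp add: E1)
  have Eprod: "E (prod f A) = (\<Sum>j\<in>A. E (f j) * prod f (A - {j}))" if "finite A" for f :: "'v \<Rightarrow> fps2" and A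
    using that
  proof (induction A rule: finite_induct)
    case (insert a A)
    have "prod f (insert a A - {j}) = f a * prod f (A - {j})" if "j \<in> A" for j
      using insert that by (subst insert_Diff_if) auto
    then show ?case using insert
      by (simp add: E sum_distrib_left ac_simps)
  qed (simp add: E1)
  have Emon: "E (mon u \<alpha>) = (\<Sum>j\<in>UNIV. of_nat (\<alpha> j) * mon u (\<alpha>(j := \<alpha> j - 1)) * E (u j))" for \<alpha>
    unfolding mon_def
  proof (subst Eprod, simp, intro sum.cong refl)
    fix j
    have "(\<Prod>i\<in>UNIV. u i ^ (\<alpha>(j := \<alpha> j - 1)) i) = u j ^ (\<alpha> j - 1) * (\<Prod>i\<in>UNIV - {j}. u i ^ \<alpha> i)"
      by (subst prod.remove[of _ j]) (auto intro!: prod.cong)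
    then show "E (u j ^ \<alpha> j) * (\<Prod>i\<in>UNIV - {j}. u i ^ \<alpha> i) =
        of_nat (\<alpha> j) * (\<Prod>i\<in>UNIV. u i ^ (\<alpha>(j := \<alpha> j - 1)) i) * E (u j)"
      by (simp add: Epow ac_simps)
  qed
  have Epsum: "E (psum (Suc N) F u) = (\<Sum>j\<in>UNIV. psum N (pd j F) u * E (u j))" for N
  proof -
    have "E (psum (Suc N) F u) = (\<Sum>\<alpha>\<in>{\<alpha>. mdeg \<alpha> \<le> Suc N}. \<Sum>j\<in>UNIV. cst (F \<alpha>) * (of_nat (\<alpha> j) * mon u (\<alpha>(j := \<alpha> j - 1)) * E (u j)))"
      unfolding psum_def by (simp add: Esum E(2,3) Emon sum_distrib_left)
    also have "\<dots> = (\<Sum>j\<in>UNIV. \<Sum>\<alpha>\<in>{\<alpha>. mdeg \<alpha> \<le> Suc N}. cst (F \<alpha>) * (of_nat (\<alpha> j) * mon u (\<alpha>(j := \<alpha> j - 1)) * E (u j)))"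
      by (rule sum.swap)
    also have "\<dots> = (\<Sum>j\<in>UNIV. psum N (pd j F) u * E (u j))"
    proof (intro sum.cong refl)
      fix j
      have cn: "cst (of_nat n) = of_nat n" for n by (induction n) auto
      have "(\<Sum>\<alpha>\<in>{\<alpha>. mdeg \<alpha> \<le> Suc N}. cst (F \<alpha>) * (of_nat (\<alpha> j) * mon u (\<alpha>(j := \<alpha> j - 1)) * E (u j)))
        = (\<Sum>\<alpha>\<in>{\<alpha>. mdeg \<alpha> \<le> Suc N \<and> \<alpha> j \<noteq> 0}. cst (F \<alpha>) * (of_nat (\<alpha> j) * mon u (\<alpha>(j := \<alpha> j - 1)) * E (u j)))"
        by (rule sum.mono_neutral_right) auto
      also have "\<dots> = (\<Sum>\<alpha>\<in>{\<alpha>. mdeg \<alpha> \<le> N}. cst (pd j F \<alpha>) * mon u \<alpha> * E (u j))"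
      proof (rule sum.reindex_bij_witness[of _ "inc_exp j" "\<lambda>\<alpha>. \<alpha>(j := \<alpha> j - 1)"])
        fix \<alpha> assume \<alpha>: "\<alpha> \<in> {\<alpha>. mdeg \<alpha> \<le> Suc N \<and> \<alpha> j \<noteq> 0}"
        then have i: "inc_exp j (\<alpha>(j := \<alpha> j - 1)) = \<alpha>" by auto
        show "inc_exp j (\<alpha>(j := \<alpha> j - 1)) = \<alpha>" by (rule i)
        have "Suc (mdeg (\<alpha>(j := \<alpha> j - 1))) = mdeg \<alpha>"
          using mdeg_inc_exp[where j = j and \<alpha> = "\<alpha>(j := \<alpha> j - 1)"] unfolding i by simp
        then show "\<alpha>(j := \<alpha> j - 1) \<in> {\<alpha>. mdeg \<alpha> \<le> N}" using \<alpha> by auto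
        have "pd j F (\<alpha>(j := \<alpha> j - 1)) = of_nat (\<alpha> j) * F \<alpha>"
          unfolding pd_def i using \<alpha> by auto
        then show "cst (pd j F (\<alpha>(j := \<alpha> j - 1))) * mon u (\<alpha>(j := \<alpha> j - 1)) * E (u j) =
            cst (F \<alpha>) * (of_nat (\<alpha> j) * mon u (\<alpha>(j := \<alpha> j - 1)) * E (u j))"
          by (simp add: cn ac_simps)
      next
        fix \<alpha> :: "'v \<Rightarrow> nat" assume "\<alpha> \<in> {\<alpha>. mdeg \<alpha> \<le> N}"
        then show "inc_exp j \<alpha> \<in> {\<alpha>. mdeg \<alpha> \<le> Suc N \<and> \<alpha> j \<noteq> 0}"
          using mdeg_inc_exp[where j = j and \<alpha> = \<alpha>] by (simp del: mdeg_inc_exp)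
      qed auto
      finally show "(\<Sum>\<alpha>\<in>{\<alpha>. mdeg \<alpha> \<le> Suc N}. cst (F \<alpha>) * (of_nat (\<alpha> j) * mon u (\<alpha>(j := \<alpha> j - 1)) * E (u j)))
        = psum N (pd j F) u * E (u j)"
        by (simp add: psum_def sum_distrib_right)
    qed
    finally show ?thesis .
  qed
  have "vanish N (E (psubst F u) - (\<Sum>j\<in>UNIV. psubst (pd j F) u * E (u j)))" for N
  proof -
    have "vanish N (E (psubst F u - psum (Suc N) F u))"
      by (rule van[OF vanish_mono[OF psubst_approx[OF u]]]) auto
    moreover have "vanish N (\<Sum>j\<in>UNIV. (psubst (pd j F) u - psum N (pd j F) u) * E (u j))"
      by (intro vanish_sum vanish_mult_right vanish_mono[OF psubst_approx[OF u]]) auto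
    ultimately have "vanish N (E (psubst F u - psum (Suc N) F u) - (\<Sum>j\<in>UNIV. (psubst (pd j F) u - psum N (pd j F) u) * E (u j)))"
      by (rule vanish_diff)
    then show ?thesis by (simp add: Ediff Epsum left_diff_distrib sum_subtractf)
  qed
  then have "E (psubst F u) - (\<Sum>j\<in>UNIV. psubst (pd j F) u * E (u j)) = 0" by (rule vanish_all)
  then show ?thesis by simp
qed

lemma psubst_const_coeff: "coeff2 (psubst F u) 0 0 = F (\<lambda>_. 0)"
proof -
  have "vanish 1 (psubst F u - psum 0 F u)" using psubst_approx[OF u, where N = 0] by simp
  moreover have "{\<alpha>::'v \<Rightarrow> nat. mdeg \<alpha> \<le> 0} = {\<lambda>_. 0}" by (auto simp: fun_eq_iff)
  ultimately show ?thesis by (auto simp: vanish_def psum_def) (simp add: coeff2_def cst_def)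
qed

end

section \<open>Relations satisfied by a formal solution\<close>

text \<open>In \<open>'l option option\<close> the variables \<open>None\<close>, \<open>Some None\<close> and \<open>Some (Some j)\<close> stand for
  $x_1$, $x_2$ and $y_j$.\<close>

abbreviation yvar :: "'l \<Rightarrow> 'l option option" where
  "yvar j \<equiv> Some (Some j)"

lemma sum_vars:
  fixes f :: "'l::finite option option \<Rightarrow> 'a::comm_monoid_add"
  shows "(\<Sum>i\<in>UNIV. f i) = f None + f (Some None) + (\<Sum>j\<in>UNIV. f (yvar j))"
proof -
  have "(\<Sum>i\<in>UNIV. h i) = h None + (\<Sum>i\<in>UNIV. h (Some i))" for h :: "'b::finite option \<Rightarrow> 'a"
    by (simp add: UNIV_option_conv sum.reindex)
  note this[of f] this[of "\<lambda>i. f (Some i)"]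
  then show ?thesis by (simp only: add.assoc)
qed

lemma prod_vars:
  fixes f :: "'l::finite option option \<Rightarrow> 'a::comm_monoid_mult"
  shows "(\<Prod>i\<in>UNIV. f i) = f None * f (Some None) * (\<Prod>j\<in>UNIV. f (yvar j))"
proof -
  have "(\<Prod>i\<in>UNIV. h i) = h None * (\<Prod>i\<in>UNIV. h (Some i))" for h :: "'b::finite option \<Rightarrow> 'a"
    by (simp add: UNIV_option_conv prod.reindex)
  note this[of f] this[of "\<lambda>i. f (Some i)"]
  then show ?thesis by (simp only: mult.assoc)
qed

lemma vars_cases:
  obtains "i = None" | "i = Some None" | j where "i = yvar j"
  by (cases i; cases "the i") auto

definition with_x :: "fps2^'l \<Rightarrow> 'l option option \<Rightarrow> fps2" where
  "with_x u i = (case i of None \<Rightarrow> X1 | Some None \<Rightarrow> X2 | Some (Some j) \<Rightarrow> u $ j)"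

lemma with_x_simps [simp]: "with_x u None = X1" "with_x u (Some None) = X2" "with_x u (yvar j) = u $ j"
  by (simp_all add: with_x_def)

definition x_exp :: "nat \<Rightarrow> nat \<Rightarrow> 'l option option \<Rightarrow> nat" where
  "x_exp a b i = (case i of None \<Rightarrow> a | Some None \<Rightarrow> b | Some (Some j) \<Rightarrow> 0)"

lemma mon_x_exp: "mon (with_x u) (x_exp a b) = X1 ^ a * X2 ^ b"
  by (simp add: mon_def prod_vars x_exp_def)

text \<open>The vector field with components \<open>c\<close>, acting as a derivation on series. For
  \<open>c\<close> made of the right-hand sides of the system it is \<open>D_1\<close> or
  \<open>D_2\<close> of the overview.\<close>

definition lie :: "('v::finite \<Rightarrow> ('v \<Rightarrow> nat) \<Rightarrow> complex) \<Rightarrow> (('v \<Rightarrow> nat) \<Rightarrow> complex) \<Rightarrow> ('v \<Rightarrow> nat) \<Rightarrow> complex" where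
  "lie c F = (\<lambda>\<alpha>. \<Sum>i\<in>UNIV. pmul (c i) (pd i F) \<alpha>)"

lemma convergent_ps_lie: "(\<And>i. convergent_ps (c i)) \<Longrightarrow> convergent_ps F \<Longrightarrow> convergent_ps (lie c F)"
  unfolding lie_def by (intro convergent_ps_sum convergent_ps_pmul convergent_ps_pd)

definition relations :: "('v::finite \<Rightarrow> fps2) \<Rightarrow> (('v \<Rightarrow> nat) \<Rightarrow> complex) set" where
  "relations u = {g. convergent_ps g \<and> psubst g u = 0}"

text \<open>The space T of the overview: vectors in the y-directions over the Laurent field that are
  annihilated by the differential along u of every convergent relation.\<close>

definition tangent :: "('l::finite option option \<Rightarrow> fps2) \<Rightarrow> (complex fls fls^'l) set" where
  "tangent u = {v. \<forall>g\<in>relations u. (\<Sum>j\<in>UNIV. to_lex (psubst (pd (yvar j) g) u) * v $ j) = 0}"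

lemma subspace_tangent: "vec.subspace (tangent u)"
  by (rule vec.subspaceI)
    (auto simp: tangent_def distrib_left sum.distrib mult.left_commute simp flip: sum_distrib_left)

context
  fixes u :: "'l::finite option option \<Rightarrow> fps2" and c :: "'l option option \<Rightarrow> ('l option option \<Rightarrow> nat) \<Rightarrow> complex"
    and \<delta> :: "fps2 \<Rightarrow> fps2"
  assumes u: "\<And>j. vanish 1 (u j)"
    and delta: "\<And>v w. \<delta> (v + w) = \<delta> v + \<delta> w" "\<And>v w. \<delta> (v * w) = \<delta> v * w + v * \<delta> w" "\<And>a. \<delta> (cst a) = 0"
    and delta_vanish: "\<And>N w. vanish (Suc N) w \<Longrightarrow> vanish N (\<delta> w)"
    and delta_u: "\<And>i. \<delta> (u i) = psubst (c i) u"
begin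

text \<open>Chain rule along the solution: \<open>delta_u\<close> says that u follows the vector
  field, so substituting u turns the vector field into \<open>\<delta>\<close>. In particular the
  vector field maps relations to relations.\<close>

lemma psubst_lie: "psubst (lie c F) u = \<delta> (psubst F u)"
  unfolding lie_def psubst_sum[OF u] psubst_pmul[OF u]
  by (subst psubst_chain_rule[OF u delta delta_vanish]) (simp_all add: delta_u mult.commute)

text \<open>The partial derivative also hits the components of the vector field; that extra sum is
  the connection matrix.\<close>

lemma psubst_pd_lie:
  "psubst (pd j (lie c F)) u = \<delta> (psubst (pd j F) u) + (\<Sum>i\<in>UNIV. psubst (pd j (c i)) u * psubst (pd i F) u)"
proof -
  have "pd j (lie c F) = (\<lambda>\<alpha>. lie c (pd j F) \<alpha> + (\<Sum>i\<in>UNIV. pmul (pd j (c i)) (pd i F) \<alpha>))"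
    unfolding lie_def pd_sum pd_pmul by (simp add: sum.distrib pd_commute[of j] add.commute)
  then show ?thesis by (simp add: psubst_add[OF u] psubst_sum[OF u] psubst_pmul[OF u] psubst_lie)
qed

text \<open>For a relation g, differentiate the equation stating that dg annihilates v, and subtract
  the equation belonging to the relation \<open>lie c g\<close>. What is left says that dg
  annihilates the covariant derivative of v. As \<open>c None\<close> and
  \<open>c (Some None)\<close> do not involve y, only the block of y-derivatives of the y-components
  enters.\<close>

lemma tangent_invariant:
  fixes \<theta> :: "complex fls fls \<Rightarrow> complex fls fls" and \<pi> :: "complex fls fls"
  assumes theta: "derivation \<theta>" and delta_lex: "\<And>w. to_lex (\<delta> w) = \<pi> * \<theta> (to_lex w)"
    and c: "\<And>i. convergent_ps (c i)" "\<And>j. pd (yvar j) (c None) = (\<lambda>_. 0)" "\<And>j. pd (yvar j) (c (Some None)) = (\<lambda>_. 0)"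
    and v: "v \<in> tangent u"
  shows "(\<chi> i. \<pi> * \<theta> (v $ i)) - (\<chi> i j. to_lex (psubst (pd (yvar j) (c (yvar i))) u)) *v v \<in> tangent u"
proof -
  interpret derivation \<theta> by fact
  show ?thesis
    unfolding tangent_def
  proof (intro CollectI ballI)
    fix g assume g: "g \<in> relations u"
    let ?A = "\<lambda>i j. to_lex (psubst (pd (yvar j) (c (yvar i))) u)"
    let ?s = "\<lambda>g j. to_lex (psubst (pd (yvar j) g) u)"
    have gs: "(\<Sum>j\<in>UNIV. ?s g j * v $ j) = 0" using v g by (auto simp: tangent_def)
    have "psubst (lie c g) u = 0"
      using g delta(3)[of 0] by (simp add: psubst_lie relations_def)
    then have "lie c g \<in> relations u"
      using g c by (auto simp: relations_def intro: convergent_ps_lie)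
    then have ls: "(\<Sum>j\<in>UNIV. ?s (lie c g) j * v $ j) = 0" using v by (auto simp: tangent_def)
    have s_lie: "?s (lie c g) j = \<pi> * \<theta> (?s g j) + (\<Sum>k\<in>UNIV. ?A k j * ?s g k)" for j
      by (simp add: psubst_pd_lie sum_vars c(2,3) psubst_zero[OF u] to_lex_add to_lex_sum to_lex_mult delta_lex)
    have "\<pi> * \<theta> (\<Sum>j\<in>UNIV. ?s g j * v $ j)
        = (\<Sum>j\<in>UNIV. \<pi> * \<theta> (?s g j) * v $ j + ?s g j * (\<pi> * \<theta> (v $ j)))"
      unfolding sum mult sum_distrib_left by (intro sum.cong refl) (simp only: distrib_left ac_simps)
    then have 1: "(\<Sum>j\<in>UNIV. \<pi> * \<theta> (?s g j) * v $ j) + (\<Sum>j\<in>UNIV. ?s g j * (\<pi> * \<theta> (v $ j))) = 0"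
      unfolding gs sum.distrib by (simp only: zero mult_zero_right)
    have 2: "(\<Sum>j\<in>UNIV. \<pi> * \<theta> (?s g j) * v $ j) + (\<Sum>j\<in>UNIV. (\<Sum>k\<in>UNIV. ?A k j * ?s g k) * v $ j) = 0"
      using ls by (simp only: s_lie distrib_right sum.distrib)
    have "(\<Sum>j\<in>UNIV. ?s g j * (\<pi> * \<theta> (v $ j))) = (\<Sum>j\<in>UNIV. (\<Sum>k\<in>UNIV. ?A k j * ?s g k) * v $ j)"
      by (rule add_left_imp_eq[OF trans[OF 1 2[symmetric]]])
    also have "\<dots> = (\<Sum>j\<in>UNIV. \<Sum>k\<in>UNIV. ?s g k * (?A k j * v $ j))"
      unfolding sum_distrib_right by (intro sum.cong refl) (simp only: ac_simps)
    also have "\<dots> = (\<Sum>k\<in>UNIV. ?s g k * (\<Sum>j\<in>UNIV. ?A k j * v $ j))"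
      by (subst sum.swap) (simp add: sum_distrib_left)
    finally show "(\<Sum>j\<in>UNIV. ?s g j * ((\<chi> i. \<pi> * \<theta> (v $ i)) - (\<chi> i j. ?A i j) *v v) $ j) = 0"
      by (simp add: matrix_vector_mult_def right_diff_distrib sum_subtractf)
  qed
qed

end

text \<open>The differentials of relations are rows over a field, and their common kernel is 0, so
  finitely many of them, at most one per index, already have trivial kernel. Injectivity of
  \<open>to_lex\<close> brings the nonzero determinant back to power series.\<close>

lemma tangent_trivial_imp_det:
  fixes u :: "'l::finite option option \<Rightarrow> fps2"
  assumes u: "\<And>j. vanish 1 (u j)" and T: "tangent u = {0}"
  obtains g :: "'l \<Rightarrow> ('l option option \<Rightarrow> nat) \<Rightarrow> complex"
    where "\<And>i. g i \<in> relations u" "det (\<chi> i j. psubst (pd (yvar j) (g i)) u) \<noteq> 0"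
proof -
  define row where "row g = (\<chi> j. to_lex (psubst (pd (yvar j) g) u))" for g :: "('l option option \<Rightarrow> nat) \<Rightarrow> complex"
  obtain B where B: "B \<subseteq> row ` relations u" "vec.independent B" "row ` relations u \<subseteq> vec.span B"
    using vec.maximal_independent_subset[of "row ` relations u"] by blast
  have finB: "finite B" and cardB: "card B \<le> CARD('l)"
    using vec.independent_bound_general[OF B(2)] vec.dim_subset_UNIV[of B] vec.finiteI_independent[OF B(2)]
    by (auto simp: vec.dimension_def card_cart_basis)
  have zero: "(\<lambda>_. 0) \<in> relations u"
    by (auto simp: relations_def psubst_zero[OF u] intro: convergent_ps_finite)
  \<comment> \<open>Lists a basis of the row space along the index type, with repetitions, or with
    the zero row if the basis is empty; the kernel argument below does not require the list to be
    injective.\<close>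
  obtain f :: "'l \<Rightarrow> _" where f: "B \<subseteq> range f" "range f \<subseteq> row ` relations u"
  proof (cases "B = {}")
    case True
    then show ?thesis using that[of "\<lambda>_. row (\<lambda>_. 0)"] zero by auto
  next
    case False
    obtain h where h: "h ` B \<subseteq> (UNIV::'l set)" "inj_on h B"
      using card_le_inj[OF finB, of "UNIV::'l set"] cardB by auto
    define f where "f i = (if i \<in> h ` B then the_inv_into B h i else (SOME b. b \<in> B))" for i
    have "f i \<in> B" for i
      using False h the_inv_into_into[OF h(2), of i B] some_in_eq[of B] by (auto simp: f_def)
    moreover have "f (h b) = b" if "b \<in> B" for b
      using that h by (simp add: f_def the_inv_into_f_f)
    ultimately show ?thesis using that[of f] B(1) by (metis image_subset_iff rangeI subset_iff)
  qed
  have "\<forall>i. \<exists>g. g \<in> relations u \<and> f i = row g" using f(2) by blast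
  then obtain g where g: "\<And>i. g i \<in> relations u" "\<And>i. f i = row (g i)" by metis
  define W where "W = (\<chi> i. f i)"
  have "v = 0" if v: "W *v v = 0" for v
  proof -
    have "(\<Sum>j\<in>UNIV. f i $ j * v $ j) = 0" for i
      using v by (simp add: W_def matrix_vector_mult_def vec_eq_iff)
    then have "(\<Sum>j\<in>UNIV. b $ j * v $ j) = 0" if "b \<in> B" for b
      using f(1) that by force
    moreover have "vec.subspace {b. (\<Sum>j\<in>UNIV. b $ j * v $ j) = 0}"
      by (rule vec.subspaceI)
        (auto simp: distrib_right sum.distrib mult.assoc simp flip: sum_distrib_left)
    ultimately have "vec.span B \<subseteq> {b. (\<Sum>j\<in>UNIV. b $ j * v $ j) = 0}"
      by (intro vec.span_minimal) auto
    then have "v \<in> tangent u" using B(3) by (fastforce simp: tangent_def row_def)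
    then show ?thesis using T by simp
  qed
  then have "det W \<noteq> 0"
    by (metis invertible_det_nz invertible_left_inverse matrix_left_invertible_ker)
  moreover have "W = mmap to_lex (\<chi> i j. psubst (pd (yvar j) (g i)) u)"
    by (simp add: W_def g(2) row_def vec_eq_iff)
  ultimately have "det (\<chi> i j. psubst (pd (yvar j) (g i)) u) \<noteq> 0"
    by (auto simp flip: to_lex_det)
  then show ?thesis using that[of g] g by blast
qed


lemma fdx1_props:
  "fdx1 (v + w) = fdx1 v + fdx1 w" "fdx1 (v * w) = fdx1 v * w + v * fdx1 w" "fdx1 (cst a) = 0"
  "fdx1 X1 = 1" "fdx1 X2 = 0"
  by (simp_all add: fdx1_def cst_def X1_def X2_def mult.commute add.commute)

lemma fdx2_props:
  "fdx2 (v + w) = fdx2 v + fdx2 w" "fdx2 (v * w) = fdx2 v * w + v * fdx2 w" "fdx2 (cst a) = 0"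
  "fdx2 X1 = 0" "fdx2 X2 = 1"
proof -
  show "fdx2 (v + w) = fdx2 v + fdx2 w" by (simp add: fdx2_def fps_eq_iff)
  have "fps_deriv (sum f A) = (\<Sum>x\<in>A. fps_deriv (f x))" for f :: "nat \<Rightarrow> complex fps" and A
    by (induction A rule: infinite_finite_induct) auto
  then show "fdx2 (v * w) = fdx2 v * w + v * fdx2 w"
    by (intro fps_ext) (simp add: fdx2_def fps_mult_nth sum.distrib add.commute)
qed (auto simp: fdx2_def cst_def X1_def X2_def fps_eq_iff fps_X_nth fps_one_nth)

lemma coeff2_fdx1: "coeff2 (fdx1 w) n m = of_nat (Suc n) * coeff2 w (Suc n) m"
  by (simp add: coeff2_def fdx1_def) (metis fps_mult_left_const_nth fps_of_nat of_nat_Suc)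

lemma coeff2_fdx2: "coeff2 (fdx2 w) n m = of_nat (Suc m) * coeff2 w n (Suc m)"
  by (simp add: coeff2_def fdx2_def)

lemma vanish_X1: "vanish 1 X1" and vanish_X2: "vanish 1 X2"
  by (simp_all add: vanish_def coeff2_def X1_def X2_def)

lemma vanish_with_x: "vcoeff u 0 0 = 0 \<Longrightarrow> vanish 1 (with_x u i)"
  by (cases i rule: vars_cases) (auto simp: vanish_def coeff2_def X1_def X2_def vcoeff_def vec_eq_iff)

text \<open>The only relations written down are the entries of the obstruction. That there are
  enough of them together with all other convergent relations is shown indirectly, through
  triviality of the common kernel.\<close>

lemma exists_nondegenerate_relations:
  fixes u :: "fps2^'l" and F1 F2 :: "'l \<Rightarrow> ('l option option \<Rightarrow> nat) \<Rightarrow> complex"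
  assumes u0: "vcoeff u 0 0 = 0"
    and eq1: "\<And>i. X2 ^ q * X1 ^ (p + 1) * fdx1 (u $ i) = psubst (F1 i) (with_x u)"
    and eq2: "\<And>i. X1 ^ p' * X2 ^ (q' + 1) * fdx2 (u $ i) = psubst (F2 i) (with_x u)"
    and conv: "\<And>i. convergent_ps (F1 i)" "\<And>i. convergent_ps (F2 i)"
    and J1: "det (\<chi> i j. F1 i (unit_exp (yvar j))) \<noteq> 0" and J2: "det (\<chi> i j. F2 i (unit_exp (yvar j))) \<noteq> 0"
    and pos: "p > 0" "q > 0" "p' > 0" "q' > 0" and ne: "(p, q) \<noteq> (p', q')"
  obtains g :: "'l \<Rightarrow> ('l option option \<Rightarrow> nat) \<Rightarrow> complex"
    where "\<And>i. convergent_ps (g i)" "\<And>i. psubst (g i) (with_x u) = 0"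
      "det (\<chi> i j. psubst (pd (yvar j) (g i)) (with_x u)) \<noteq> 0"
proof -
  let ?u = "with_x u"
  have u: "vanish 1 (?u j)" for j by (rule vanish_with_x[OF u0])
  define \<delta>1 where "\<delta>1 w = X2 ^ q * X1 ^ (p + 1) * fdx1 w" for w
  define \<delta>2 where "\<delta>2 w = X1 ^ p' * X2 ^ (q' + 1) * fdx2 w" for w
  \<comment> \<open>The vector field of the first equation: it moves x_1 with speed
    \<open>x_1^(p+1) x_2^q\<close>, fixes x_2, and moves y with speed \<open>F1\<close>. Next comes
    the same for the second equation.\<close>
  define c1 where "c1 i = (case i of None \<Rightarrow> pmono (x_exp (p + 1) q) | Some None \<Rightarrow> (\<lambda>_. 0) | Some (Some j) \<Rightarrow> F1 j)"
    for i :: "'l option option"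
  define c2 where "c2 i = (case i of None \<Rightarrow> (\<lambda>_. 0) | Some None \<Rightarrow> pmono (x_exp p' (q' + 1)) | Some (Some j) \<Rightarrow> F2 j)"
    for i :: "'l option option"
  have d1: "\<delta>1 (v + w) = \<delta>1 v + \<delta>1 w" "\<delta>1 (v * w) = \<delta>1 v * w + v * \<delta>1 w" "\<delta>1 (cst a) = 0" for v w a
    by (simp_all add: \<delta>1_def fdx1_props algebra_simps)
  have d2: "\<delta>2 (v + w) = \<delta>2 v + \<delta>2 w" "\<delta>2 (v * w) = \<delta>2 v * w + v * \<delta>2 w" "\<delta>2 (cst a) = 0" for v w a
    by (simp_all add: \<delta>2_def fdx2_props algebra_simps)
  have van1: "vanish N (\<delta>1 w)" if "vanish (Suc N) w" for N w
    unfolding \<delta>1_def by (rule vanish_mult_left) (use that in \<open>auto simp: vanish_def coeff2_fdx1\<close>)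
  have van2: "vanish N (\<delta>2 w)" if "vanish (Suc N) w" for N w
    unfolding \<delta>2_def by (rule vanish_mult_left) (use that in \<open>auto simp: vanish_def coeff2_fdx2\<close>)
  have cu1: "\<delta>1 (?u i) = psubst (c1 i) ?u" for i
    using eq1 by (cases i rule: vars_cases)
      (auto simp: c1_def \<delta>1_def fdx1_props psubst_zero[OF u] psubst_pmono[OF u] mon_x_exp ac_simps)
  have cu2: "\<delta>2 (?u i) = psubst (c2 i) ?u" for i
    using eq2 by (cases i rule: vars_cases)
      (auto simp: c2_def \<delta>2_def fdx2_props psubst_zero[OF u] psubst_pmono[OF u] mon_x_exp ac_simps)
  define \<pi> where "\<pi> = to_lex (X1 ^ p * X2 ^ q)"
  define \<pi>' where "\<pi>' = to_lex (X1 ^ p' * X2 ^ q')"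
  have lex1: "to_lex (\<delta>1 w) = \<pi> * theta1 (to_lex w)" for w
    by (simp add: \<delta>1_def \<pi>_def theta1_to_lex ac_simps flip: to_lex_mult)
  have lex2: "to_lex (\<delta>2 w) = \<pi>' * theta2 (to_lex w)" for w
    by (simp add: \<delta>2_def \<pi>'_def theta2_to_lex ac_simps flip: to_lex_mult)
  have conv_mono: "convergent_ps (pmono \<mu>)" for \<mu> :: "'l option option \<Rightarrow> nat"
    by (rule convergent_ps_finite) (auto simp: pmono_def)
  have conv0: "convergent_ps (\<lambda>_. 0 :: complex)" by (rule convergent_ps_finite) auto
  have cc1: "convergent_ps (c1 i)" and cc2: "convergent_ps (c2 i)" for i
    using conv conv_mono conv0 by (auto simp: c1_def c2_def split: option.splits)
  have pd0: "pd (yvar j) (\<lambda>_. 0) = (\<lambda>_. 0)" for j :: 'l by (simp add: pd_def fun_eq_iff)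
  have pdx: "pd (yvar j) (pmono (x_exp a b)) = (\<lambda>_. 0)" for j :: 'l and a b
    by (rule pd_pmono) (simp add: x_exp_def)
  define A where "A = (\<chi> i j. to_lex (psubst (pd (yvar j) (F1 i)) ?u))"
  define B where "B = (\<chi> i j. to_lex (psubst (pd (yvar j) (F2 i)) ?u))"
  interpret t1: derivation theta1 by (rule derivation_theta)
  interpret t2: derivation theta2 by (rule derivation_theta)
  have T1: "(\<chi> i. \<pi> * theta1 (v $ i)) - A *v v \<in> tangent ?u" if "v \<in> tangent ?u" for v
    using tangent_invariant[where \<delta> = \<delta>1 and c = c1 and \<theta> = theta1 and \<pi> = \<pi>, OF u d1 van1 cu1 derivation_theta(1) lex1 cc1 _ _ that]
    by (simp add: c1_def pd0 pdx A_def)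
  have T2: "(\<chi> i. \<pi>' * theta2 (v $ i)) - B *v v \<in> tangent ?u" if "v \<in> tangent ?u" for v
    using tangent_invariant[where \<delta> = \<delta>2 and c = c2 and \<theta> = theta2 and \<pi> = \<pi>', OF u d2 van2 cu2 derivation_theta(2) lex2 cc2 _ _ that]
    by (simp add: c2_def pd0 pdx B_def)
  \<comment> \<open>Difference of the two sides of the integrability condition. Along u the first
    two terms are \<open>\<delta>2 (\<delta>1 (u $ i)) - \<delta>1 (\<delta>2 (u $ i))\<close>, and
    the other two cancel exactly what the commutation relation gives.\<close>
  define h where "h i = (\<lambda>\<alpha>. (lie c2 (F1 i) \<alpha> - lie c1 (F2 i) \<alpha>) - of_nat q * pmul (pmono (x_exp p' q')) (F1 i) \<alpha>
     + of_nat p' * pmul (pmono (x_exp p q)) (F2 i) \<alpha>)" for i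
  have l1: "psubst (lie c1 F) ?u = \<delta>1 (psubst F ?u)" for F by (rule psubst_lie[OF u d1 van1 cu1])
  have l2: "psubst (lie c2 F) ?u = \<delta>2 (psubst F ?u)" for F by (rule psubst_lie[OF u d2 van2 cu2])
  have lcst: "to_lex (cst (of_nat n)) = of_nat n" for n
  proof -
    have "cst (of_nat n) = of_nat n" by (induction n) auto
    then show ?thesis by (simp add: to_lex_of_nat)
  qed
  have h_rel: "h i \<in> relations ?u" for i
  proof -
    have 1: "psubst (F1 i) ?u = \<delta>1 (u $ i)" "psubst (F2 i) ?u = \<delta>2 (u $ i)"
      using eq1 eq2 by (simp_all add: \<delta>1_def \<delta>2_def)
    have "to_lex (psubst (h i) ?u) = 0"
      unfolding h_def
      by (simp add: psubst_add[OF u] psubst_diff[OF u] psubst_cmult[OF u] psubst_pmul[OF u] psubst_pmono[OF u]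
          l1 l2 1 to_lex_add to_lex_diff to_lex_mult lex1 lex2 lcst mon_x_exp t1.mult t2.mult flip: \<pi>_def \<pi>'_def)
        (simp add: \<pi>_def \<pi>'_def theta_monomial theta_commute algebra_simps flip: to_lex_mult)
    then have "psubst (h i) ?u = 0" using to_lex_eq_iff[of _ 0] by simp
    moreover have "convergent_ps (h i)"
      unfolding h_def
      by (intro convergent_ps_add convergent_ps_diff convergent_ps_lie convergent_ps_cmult convergent_ps_pmul
          conv_mono cc1 cc2 conv)
    ultimately show ?thesis by (simp add: relations_def)
  qed
  have pl1: "psubst (pd j (lie c1 F)) ?u = \<delta>1 (psubst (pd j F) ?u) + (\<Sum>i\<in>UNIV. psubst (pd j (c1 i)) ?u * psubst (pd i F) ?u)" for j F
    by (rule psubst_pd_lie[OF u d1 van1 cu1])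
  have pl2: "psubst (pd j (lie c2 F)) ?u = \<delta>2 (psubst (pd j F) ?u) + (\<Sum>i\<in>UNIV. psubst (pd j (c2 i)) ?u * psubst (pd i F) ?u)" for j F
    by (rule psubst_pd_lie[OF u d2 van2 cu2])
  let ?M = "mmap (\<lambda>x. \<pi>' * theta2 x) A - mmap (\<lambda>x. \<pi> * theta1 x) B + A ** B - B ** A
      - mmap (\<lambda>x. of_nat q * \<pi>' * x) A + mmap (\<lambda>x. of_nat p' * \<pi> * x) B"
  \<comment> \<open>The curvature matrix is the y-Jacobian of the obstruction along u. As the
    obstruction consists of relations, its differential annihilates T, which is flatness.\<close>
  have M_nth: "?M $ i $ j = to_lex (psubst (pd (yvar j) (h i)) ?u)" for i j
    unfolding h_def pd_add pd_diff pd_cmult pd_pmul pdx pmul_zero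
    by (simp add: psubst_add[OF u] psubst_diff[OF u] psubst_cmult[OF u] psubst_pmul[OF u] psubst_pmono[OF u]
        pl1 pl2 to_lex_add to_lex_diff to_lex_mult lex1 lex2 lcst mon_x_exp sum_vars to_lex_sum
        A_def B_def matrix_matrix_mult_def c1_def c2_def pd0 pdx psubst_zero[OF u] \<pi>_def \<pi>'_def ac_simps)
  have flat: "?M *v v = 0" if "v \<in> tangent ?u" for v
  proof -
    have "(?M *v v) $ i = (\<Sum>j\<in>UNIV. to_lex (psubst (pd (yvar j) (h i)) ?u) * v $ j)" for i
      unfolding matrix_vector_mult_def by (simp only: M_nth vec_lambda_beta)
    then show ?thesis using that h_rel by (simp add: tangent_def vec_eq_iff)
  qed
  have AB: "lex.integral_matrix A" "lex.integral_matrix B"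
    by (auto simp: lex.integral_matrix_def A_def B_def to_lex_in)
  \<comment> \<open>The constant coefficient of a substituted series is that of the outer series, so
    the residues of \<open>A\<close> and \<open>B\<close> are the Jacobians at the origin.\<close>
  have resA: "det (mmap lex_residue A) \<noteq> 0" "det (mmap lex_residue B) \<noteq> 0"
    using J1 J2 by (simp_all add: mmap_def A_def B_def lex_residue_to_lex psubst_const_coeff[OF u] pd_def)
  have pi_in: "\<pi> \<in> lex_ring" "\<pi>' \<in> lex_ring" "\<pi> \<noteq> 0" "\<pi>' \<noteq> 0"
    by (simp_all add: \<pi>_def \<pi>'_def to_lex_in to_lex_monomial_nonzero)
  have "tangent ?u = {0}"
  \<comment> \<open>The lexicographically larger monomial has to be the numerator; in the second
    case the two equations, and with them \<open>q\<close> and \<open>p'\<close>, exchange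
    roles.\<close>
  proof (cases "p' < p \<or> p' = p \<and> q' < q")
    case True
    then have "\<pi> / \<pi>' \<in> lex_ring" "lex_residue (\<pi> / \<pi>') = 0"
      unfolding \<pi>_def \<pi>'_def by (rule lex_monomial_ratio)+
    then show ?thesis
      by (intro lex.flat_subspace_trivial[where A = A and B = B and ?E1.0 = theta1 and ?E2.0 = theta2
            and \<pi> = \<pi> and \<pi>' = \<pi>' and q = q and p' = p'])
        (use derivation_theta theta_lex theta_commute pi_in pos AB resA subspace_tangent T1 T2 flat
         in \<open>auto simp: \<pi>_def \<pi>'_def theta_monomial\<close>)
  next
    case False
    then have "p < p' \<or> p = p' \<and> q < q'" using ne by auto
    then have rat: "\<pi>' / \<pi> \<in> lex_ring" "lex_residue (\<pi>' / \<pi>) = 0"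
      unfolding \<pi>_def \<pi>'_def by (rule lex_monomial_ratio)+
    let ?M' = "mmap (\<lambda>x. \<pi> * theta1 x) B - mmap (\<lambda>x. \<pi>' * theta2 x) A + B ** A - A ** B
      - mmap (\<lambda>x. of_nat p' * \<pi> * x) B + mmap (\<lambda>x. of_nat q * \<pi>' * x) A"
    have M': "?M' = - ?M" by (simp add: algebra_simps)
    have "?M' *v v = 0" if "v \<in> tangent ?u" for v
    proof -
      have "(- N) *v v = - (N *v v)" for N :: "complex fls fls^'l^'l"
        by (simp add: matrix_vector_mult_def vec_eq_iff sum_negf)
      then show ?thesis unfolding M' by (simp only: flat[OF that] neg_equal_0_iff_equal)
    qed
    then show ?thesis
      by (intro lex.flat_subspace_trivial[where A = B and B = A and ?E1.0 = theta2 and ?E2.0 = theta1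
            and \<pi> = \<pi>' and \<pi>' = \<pi> and q = p' and p' = q])
        (use derivation_theta theta_lex theta_commute pi_in pos AB resA subspace_tangent T1 T2 rat
         in \<open>auto simp: \<pi>_def \<pi>'_def theta_monomial\<close>)
  qed
  then have T: "tangent ?u = {0}" .
  obtain g :: "'l \<Rightarrow> ('l option option \<Rightarrow> nat) \<Rightarrow> complex" where g: "\<And>i. g i \<in> relations ?u"
      "det (\<chi> i j. psubst (pd (yvar j) (g i)) ?u) \<noteq> 0"
    by (rule tangent_trivial_imp_det[where u = ?u, OF _ T]) (rule u, rule that)
  then show ?thesis using that[of g] by (auto simp: relations_def)
qed

section \<open>Taylor expansions of holomorphic maps\<close>

text \<open>Exponents that involve only variables in \<open>S\<close>. Growing \<open>S\<close>
  gives induction on the number of variables within one fixed index type.\<close>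

definition supported :: "'v set \<Rightarrow> ('v \<Rightarrow> nat) set" where
  "supported S = {\<alpha>. \<forall>j. j \<notin> S \<longrightarrow> \<alpha> j = 0}"

lemma supported_empty: "supported {} = {\<lambda>_. 0}"
  by (auto simp: supported_def fun_eq_iff)

lemma bij_supported_insert:
  assumes "j \<notin> S"
  shows "bij_betw (\<lambda>(k, \<beta>). \<beta>(j := k)) (UNIV \<times> supported S) (supported (insert j S))"
  by (rule bij_betw_byWitness[where f' = "\<lambda>\<alpha>. (\<alpha> j, \<alpha>(j := 0))"])
    (use assms in \<open>auto simp: supported_def fun_eq_iff\<close>)

lemma mon_fun_upd:
  fixes z :: "'v::finite \<Rightarrow> 'a::comm_monoid_mult"
  assumes "\<beta> j = 0"
  shows "mon z (\<beta>(j := k)) = z j ^ k * mon z \<beta>"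
proof -
  have "mon z (\<beta>(j := k)) = z j ^ k * (\<Prod>i\<in>UNIV - {j}. z i ^ \<beta> i)"
    unfolding mon_def by (subst prod.remove[of _ j]) (auto intro!: prod.cong)
  moreover have "mon z \<beta> = (\<Prod>i\<in>UNIV - {j}. z i ^ \<beta> i)"
    unfolding mon_def by (subst prod.remove[of _ j]) (auto simp: assms)
  ultimately show ?thesis by simp
qed

lemma mon_cong_supported: "\<alpha> \<in> supported S \<Longrightarrow> (\<And>j. j \<in> S \<Longrightarrow> z j = w j) \<Longrightarrow> mon z \<alpha> = mon w \<alpha>"
  unfolding mon_def supported_def by (intro prod.cong refl) (metis (mono_tags, lifting) mem_Collect_eq power_0)

lemma mdeg_fun_upd:
  fixes \<beta> :: "'v::finite \<Rightarrow> nat"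
  assumes "\<beta> j = 0"
  shows "mdeg (\<beta>(j := k)) = k + mdeg \<beta>"
proof -
  have "mdeg (\<beta>(j := k)) = k + sum \<beta> (UNIV - {j})"
    by (subst sum.remove[of _ j]) (auto intro!: sum.cong)
  moreover have "mdeg \<beta> = sum \<beta> (UNIV - {j})"
    by (subst sum.remove[of _ j]) (auto simp: assms)
  ultimately show ?thesis by simp
qed

lemma norm_mon_le:
  fixes z :: "'v::finite \<Rightarrow> complex"
  assumes "\<And>j. norm (z j) \<le> x"
  shows "norm (mon z \<alpha>) \<le> x ^ mdeg \<alpha>"
proof -
  have "norm (mon z \<alpha>) = (\<Prod>j\<in>UNIV. norm (z j) ^ \<alpha> j)" by (simp add: mon_def prod_norm[symmetric] norm_power)
  also have "\<dots> \<le> (\<Prod>j\<in>UNIV. x ^ \<alpha> j)" by (intro prod_mono conjI power_mono assms) auto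
  also have "\<dots> = x ^ mdeg \<alpha>" by (simp add: power_sum)
  finally show ?thesis .
qed

text \<open>Every finite set of exponents lies in a box, over which the sum factors into one
  geometric sum per variable.\<close>

lemma summable_on_mdeg_geometric:
  fixes x :: real
  assumes "0 \<le> x" "x < 1"
  shows "(\<lambda>\<alpha>::'v::finite \<Rightarrow> nat. x ^ mdeg \<alpha>) summable_on A"
proof -
  have "(\<lambda>\<alpha>::'v \<Rightarrow> nat. x ^ mdeg \<alpha>) summable_on UNIV"
  proof (rule nonneg_bdd_above_summable_on)
    show "bdd_above (sum (\<lambda>\<alpha>::'v \<Rightarrow> nat. x ^ mdeg \<alpha>) ` {P. P \<subseteq> UNIV \<and> finite P})"
    proof (rule bdd_aboveI2)
      fix P :: "('v \<Rightarrow> nat) set" assume "P \<in> {P. P \<subseteq> UNIV \<and> finite P}"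
      then have P: "finite P" by simp
      define N where "N = Max (insert 0 (mdeg ` P))"
      have "P \<subseteq> Pi\<^sub>E UNIV (\<lambda>_. {..N})"
      proof
        fix \<alpha> assume "\<alpha> \<in> P"
        then have "mdeg \<alpha> \<le> N" using P by (auto simp: N_def)
        then have "\<alpha> j \<le> N" for j using member_le_sum[of j UNIV \<alpha>] by auto
        then show "\<alpha> \<in> Pi\<^sub>E UNIV (\<lambda>_. {..N})" by auto
      qed
      note sub = this
      have "(\<Sum>\<alpha>\<in>P. x ^ mdeg \<alpha>) \<le> (\<Sum>\<alpha>\<in>Pi\<^sub>E (UNIV :: 'v set) (\<lambda>_. {..N}). \<Prod>j\<in>UNIV. x ^ \<alpha> j)"
        unfolding power_sum by (rule sum_mono2[OF _ sub]) (use assms in \<open>auto intro!: finite_PiE prod_nonneg\<close>)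
      also have "\<dots> = (\<Prod>j\<in>(UNIV::'v set). \<Sum>k\<le>N. x ^ k)"
        by (subst prod_sum_PiE) auto
      also have "\<dots> \<le> (\<Prod>j\<in>(UNIV::'v set). 1 / (1 - x))"
      proof (intro prod_mono conjI)
        have "(\<Sum>k\<le>N. x ^ k) \<le> (\<Sum>k. x ^ k)"
          by (rule sum_le_suminf) (use assms in \<open>auto intro: summable_geometric\<close>)
        also have "(\<Sum>k. x ^ k) = 1 / (1 - x)" by (rule suminf_geometric) (use assms in auto)
        finally show "(\<Sum>k\<le>N. x ^ k) \<le> 1 / (1 - x)" .
      qed (use assms in \<open>auto intro: sum_nonneg\<close>)
      finally show "(\<Sum>\<alpha>\<in>P. x ^ mdeg \<alpha>) \<le> (\<Prod>j\<in>(UNIV::'v set). 1 / (1 - x))" .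
    qed
  qed (use assms in auto)
  then show ?thesis by (rule summable_on_subset) simp
qed

lemma power_series_zero_imp_coeff_zero:
  fixes a :: "nat \<Rightarrow> complex"
  assumes "e > 0" "\<And>t. norm t < e \<Longrightarrow> (\<lambda>k. a k * t ^ k) sums 0"
  shows "a k = 0"
proof (rule ccontr)
  assume nz: "a k \<noteq> 0"
  have "a 0 = 0" using assms sums_unique2[OF powser_sums_zero[of a] assms(2)[of 0]] by simp
  then have "k > 0" using nz by (auto intro: gr0I)
  show False
  proof (rule powser_0_nonzero[of e 0 a "\<lambda>_. 0" k])
    fix s :: real assume s: "0 < s" "\<And>z::complex. z \<in> cball 0 s - {0} \<Longrightarrow> (0::complex) \<noteq> 0"
    have "of_real s \<in> cball (0::complex) s - {0}" using s(1) by auto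
    from s(2)[OF this] show False by simp
  qed (use assms nz \<open>k > 0\<close> in auto)
qed

text \<open>Peel off one variable \<open>j\<close>: with the others fixed, the sum is a power series
  in \<open>z j\<close> that vanishes near 0. Its coefficients are therefore 0, and each of them is
  a series to which the induction hypothesis applies.\<close>

lemma power_series_identity_theorem:
  fixes F :: "('v::finite \<Rightarrow> nat) \<Rightarrow> complex"
  assumes e: "e > 0"
    and F: "\<And>z. (\<And>j. norm (z j) < e) \<Longrightarrow> ((\<lambda>\<alpha>. F \<alpha> * mon z \<alpha>) has_sum 0) (supported S)"
    and \<alpha>: "\<alpha> \<in> supported S"
  shows "F \<alpha> = 0"
proof -
  have "finite S" by simp
  then show ?thesis using F \<alpha>
  proof (induction S arbitrary: F \<alpha> rule: finite_induct)
    case empty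
    have "((\<lambda>\<alpha>. F \<alpha> * mon (\<lambda>_. 0) \<alpha>) has_sum 0) (supported {})" by (rule empty) (use e in auto)
    moreover have "((\<lambda>\<alpha>. F \<alpha> * mon (\<lambda>_. 0) \<alpha>) has_sum F (\<lambda>_. 0)) (supported {})"
      using has_sum_finite[of "{\<lambda>_. 0}" "\<lambda>\<alpha>. F \<alpha> * mon (\<lambda>_. 0) \<alpha>"] by (simp add: supported_empty)
    ultimately have "F (\<lambda>_. 0) = 0" by (rule has_sum_unique[symmetric])
    then show ?case using empty(2) by (simp add: supported_empty)
  next
    case (insert j S)
    have z0: "\<beta> j = 0" if "\<beta> \<in> supported S" for \<beta> using that insert(2) by (auto simp: supported_def)
    have ins: "((\<lambda>(k, \<beta>). F (\<beta>(j := k)) * (z j ^ k * mon z \<beta>)) has_sum 0) (UNIV \<times> supported S)"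
      if z: "\<And>j. norm (z j) < e" for z
    proof -
      have "((\<lambda>p. F (case p of (k, \<beta>) \<Rightarrow> \<beta>(j := k)) * mon z (case p of (k, \<beta>) \<Rightarrow> \<beta>(j := k))) has_sum 0) (UNIV \<times> supported S)"
        using has_sum_reindex_bij_betw[OF bij_supported_insert[OF insert(2)], of "\<lambda>\<alpha>. F \<alpha> * mon z \<alpha>" 0] insert(4)[OF z] by simp
      then show ?thesis
        by (rule has_sum_cong[THEN iffD1, rotated]) (auto simp: mon_fun_upd z0)
    qed
    have H0: "((\<lambda>\<beta>. F (\<beta>(j := k)) * mon z \<beta>) has_sum 0) (supported S)" if z: "\<And>j. norm (z j) < e" for z k
    proof -
      let ?H = "\<lambda>k. \<Sum>\<^sub>\<infinity>\<beta>\<in>supported S. F (\<beta>(j := k)) * mon z \<beta>"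
      have mz: "mon (z(j := t)) \<beta> = mon z \<beta>" if "\<beta> \<in> supported S" for t \<beta>
        by (rule mon_cong_supported[OF that]) (use insert(2) in auto)
      have ins': "((\<lambda>(k, \<beta>). F (\<beta>(j := k)) * (t ^ k * mon z \<beta>)) has_sum 0) (UNIV \<times> supported S)"
        if "norm t < e" for t
      proof -
        have "((\<lambda>(k, \<beta>). F (\<beta>(j := k)) * ((z(j := t)) j ^ k * mon (z(j := t)) \<beta>)) has_sum 0) (UNIV \<times> supported S)"
          by (rule ins) (use z that in auto)
        then show ?thesis by (rule has_sum_cong[THEN iffD1, rotated]) (auto simp: mz)
      qed
      have sumH: "(\<lambda>\<beta>. F (\<beta>(j := k)) * mon z \<beta>) summable_on supported S" for k
      proof -
        \<comment> \<open>Any nonzero value inside the disc would do: one slice of the summable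
          family contains the factor \<open>t ^ k\<close>, which is then divided away.\<close>
        define t :: complex where "t = of_real (e / 2)"
        have t: "norm t < e" "t \<noteq> 0" using e by (auto simp: t_def)
        have "(\<lambda>(k, \<beta>). F (\<beta>(j := k)) * (t ^ k * mon z \<beta>)) summable_on (UNIV \<times> supported S)"
          using ins'[OF t(1)] by (rule has_sum_imp_summable)
        then have "(\<lambda>\<beta>. F (\<beta>(j := k)) * (t ^ k * mon z \<beta>)) summable_on supported S"
          using summable_on_SigmaD1[of "\<lambda>k \<beta>. F (\<beta>(j := k)) * (t ^ k * mon z \<beta>)" UNIV "\<lambda>_. supported S" k] by simp
        then have "(\<lambda>\<beta>. (1 / t ^ k) * (F (\<beta>(j := k)) * (t ^ k * mon z \<beta>))) summable_on supported S"
          by (rule summable_on_cmult_right)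
        then show ?thesis using t(2) by (simp add: field_simps)
      qed
      have "(\<lambda>k. ?H k * t ^ k) sums 0" if t: "norm t < e" for t
      proof -
        have "((\<lambda>k. t ^ k * ?H k) has_sum 0) UNIV"
        proof (rule has_sum_SigmaD[OF ins'[OF t]])
          fix k
          have "((\<lambda>\<beta>. t ^ k * (F (\<beta>(j := k)) * mon z \<beta>)) has_sum t ^ k * ?H k) (supported S)"
            by (intro has_sum_cmult_right has_sum_infsum sumH)
          then show "((\<lambda>y. case (k, y) of (k, \<beta>) \<Rightarrow> F (\<beta>(j := k)) * (t ^ k * mon z \<beta>)) has_sum t ^ k * ?H k) (supported S)"
            by (simp add: mult.left_commute)
        qed
        then show ?thesis using has_sum_imp_sums by (simp add: mult.commute)
      qed
      then have "?H k = 0" by (rule power_series_zero_imp_coeff_zero[OF e])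
      then show ?thesis using has_sum_infsum[OF sumH[of k]] by simp
    qed
    have "F ((\<alpha>(j := 0))(j := \<alpha> j)) = 0"
      by (rule insert(3)[where F = "\<lambda>\<beta>. F (\<beta>(j := \<alpha> j))", OF H0])
        (use insert(5) in \<open>auto simp: supported_def\<close>)
    then show ?case by simp
  qed
qed

section \<open>Power series of bounded, separately holomorphic functions\<close>

definition separately_holomorphic :: "real \<Rightarrow> (('v \<Rightarrow> complex) \<Rightarrow> complex) \<Rightarrow> bool" where
  "separately_holomorphic r g \<longleftrightarrow>
     (\<forall>z. (\<forall>j. norm (z j) < r) \<longrightarrow> (\<forall>j. (\<lambda>t. g (z(j := t))) holomorphic_on ball 0 r))"

text \<open>Taylor coefficient in the variable \<open>j\<close> as a function of the other
  variables; the entry \<open>z j\<close> is overwritten and has no influence.\<close>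

definition tcoeff :: "'v \<Rightarrow> nat \<Rightarrow> (('v \<Rightarrow> complex) \<Rightarrow> complex) \<Rightarrow> ('v \<Rightarrow> complex) \<Rightarrow> complex" where
  "tcoeff j k g z = (deriv ^^ k) (\<lambda>t. g (z(j := t))) 0 / fact k"

context
  fixes g :: "('v::finite \<Rightarrow> complex) \<Rightarrow> complex" and r \<rho> M :: real
  assumes g: "separately_holomorphic r g" and M: "\<And>z. (\<And>j. norm (z j) < r) \<Longrightarrow> norm (g z) \<le> M"
    and \<rho>: "0 < \<rho>" "\<rho> < r"
begin

lemma tcoeff_bound:
  assumes z: "\<And>j. norm (z j) < r"
  shows "norm (tcoeff j k g z) \<le> M / \<rho> ^ k"
proof -
  have hol: "(\<lambda>t. g (z(j := t))) holomorphic_on ball 0 r"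
    using g z by (auto simp: separately_holomorphic_def)
  have "norm ((deriv ^^ k) (\<lambda>t. g (z(j := t))) 0) \<le> fact k * M / \<rho> ^ k"
  proof (rule Cauchy_inequality)
    show "(\<lambda>t. g (z(j := t))) holomorphic_on ball 0 \<rho>"
      by (rule holomorphic_on_subset[OF hol]) (use \<rho> in auto)
    show "continuous_on (cball 0 \<rho>) (\<lambda>t. g (z(j := t)))"
      by (rule continuous_on_subset[OF holomorphic_on_imp_continuous_on[OF hol]]) (use \<rho> in auto)
    show "norm (g (z(j := x))) \<le> M" if "norm (0 - x) = \<rho>" for x
      by (rule M) (use z that \<rho> in auto)
  qed (use \<rho> in auto)
  then show ?thesis by (simp add: tcoeff_def norm_divide field_simps)
qed

lemma tcoeff_sums:
  assumes z: "\<And>j. norm (z j) < r" and t: "norm t < r"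
  shows "(\<lambda>k. tcoeff j k g z * t ^ k) sums g (z(j := t))"
  using holomorphic_power_series[of "\<lambda>t. g (z(j := t))" 0 r t] g z t
  by (auto simp: separately_holomorphic_def tcoeff_def)

text \<open>Represents the k-th coefficient as a limit of difference quotients that use only lower
  coefficients, with an error linear in \<open>t\<close> and uniform in \<open>z\<close>. The factor
  2 bounds \<open>1 / (1 - t / \<rho>)\<close> for \<open>t \<le> \<rho> / 2\<close>.\<close>

lemma tcoeff_tail:
  assumes z: "\<And>j. norm (z j) < r" and t: "0 < t" "t \<le> \<rho> / 2"
  shows "norm ((g (z(j := of_real t)) - (\<Sum>m<k. tcoeff j m g z * of_real t ^ m)) / of_real t ^ k - tcoeff j k g z)
    \<le> 2 * M / \<rho> ^ Suc k * t"
proof -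
  have M0: "M \<ge> 0" using order.trans[OF norm_ge_zero M[OF z]] .
  let ?t = "of_real t :: complex"
  have "(\<lambda>m. tcoeff j (m + Suc k) g z * ?t ^ (m + Suc k)) sums (g (z(j := ?t)) - (\<Sum>m<Suc k. tcoeff j m g z * ?t ^ m))"
    using tcoeff_sums[OF z, of ?t j] t \<rho> by (subst sums_iff_shift') auto
  then have "(\<lambda>m. (tcoeff j (m + Suc k) g z * ?t ^ (m + Suc k)) / ?t ^ k) sums
      ((g (z(j := ?t)) - (\<Sum>m<Suc k. tcoeff j m g z * ?t ^ m)) / ?t ^ k)"
    by (rule sums_divide)
  also have "(g (z(j := ?t)) - (\<Sum>m<Suc k. tcoeff j m g z * ?t ^ m)) / ?t ^ k
      = (g (z(j := ?t)) - (\<Sum>m<k. tcoeff j m g z * ?t ^ m)) / ?t ^ k - tcoeff j k g z" (is "_ = ?d")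
    using t by (simp add: diff_divide_distrib add_divide_distrib algebra_simps)
  also have "(\<lambda>m. (tcoeff j (m + Suc k) g z * ?t ^ (m + Suc k)) / ?t ^ k) =
      (\<lambda>m. tcoeff j (m + Suc k) g z * ?t ^ Suc m)"
    using t by (simp add: power_add fun_eq_iff)
  finally have s: "(\<lambda>m. tcoeff j (m + Suc k) g z * ?t ^ Suc m) sums ?d" .
  let ?b = "\<lambda>m. M / \<rho> ^ Suc k * t * (t / \<rho>) ^ m"
  have le: "norm (tcoeff j (m + Suc k) g z * ?t ^ Suc m) \<le> ?b m" for m
  proof -
    have "norm (tcoeff j (m + Suc k) g z * ?t ^ Suc m) = norm (tcoeff j (m + Suc k) g z) * t ^ Suc m"
      using t by (simp add: norm_mult norm_power del: power_Suc)
    also have "\<dots> \<le> M / \<rho> ^ (m + Suc k) * t ^ Suc m"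
      by (rule mult_right_mono[OF tcoeff_bound[OF z]]) (use t in auto)
    also have "\<dots> = ?b m" using \<rho> by (simp add: power_add power_divide field_simps)
    finally show ?thesis .
  qed
  have "t / \<rho> \<le> 1 / 2" "t / \<rho> < 1" "0 < t / \<rho>" using t \<rho> by (auto simp: field_simps)
  then have b: "?b sums (M / \<rho> ^ Suc k * t * (1 / (1 - t / \<rho>)))"
    by (intro sums_mult geometric_sums) (simp add: abs_of_pos del: abs_divide)
  have "norm ?d \<le> M / \<rho> ^ Suc k * t * (1 / (1 - t / \<rho>))"
    using norm_suminf_le[OF le sums_summable[OF b]] by (simp only: sums_unique[OF s, symmetric] sums_unique[OF b, symmetric])
  also have "\<dots> \<le> M / \<rho> ^ Suc k * t * 2"
    using \<open>t / \<rho> \<le> 1 / 2\<close> \<open>t / \<rho> < 1\<close> M0 t \<rho> by (intro mult_left_mono) (auto simp: field_simps)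
  finally show ?thesis by (simp add: mult_ac)
qed

text \<open>Strong induction on \<open>k\<close>: the quotients of \<open>tcoeff_tail\<close> are
  holomorphic in the other variables by the cases below \<open>k\<close>, and they converge
  uniformly. This needs no integral formula with parameters.\<close>

lemma separately_holomorphic_tcoeff: "separately_holomorphic r (tcoeff j k g)"
proof (induction k rule: less_induct)
  case (less k)
  show ?case
    unfolding separately_holomorphic_def
  proof (intro allI impI)
    fix z :: "'v \<Rightarrow> complex" and i assume z: "\<forall>j. norm (z j) < r"
    show "(\<lambda>t. tcoeff j k g (z(i := t))) holomorphic_on ball 0 r"
    proof (cases "i = j")
      case True
      then show ?thesis by (simp add: tcoeff_def)
    next
      case False
      \<comment> \<open>Any null sequence in the range allowed by \<open>tcoeff_tail\<close> serves
        here.\<close>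
      define s where "s n = \<rho> / 2 * inverse (real (Suc n))" for n
      have s: "0 < s n" "s n \<le> \<rho> / 2" for n using \<rho> by (auto simp: s_def field_simps)
      define q where "q n t = (g ((z(i := t))(j := of_real (s n))) - (\<Sum>m<k. tcoeff j m g (z(i := t)) * of_real (s n) ^ m)) / of_real (s n) ^ k"
        for n t
      have in_D: "\<forall>j'. norm ((z(i := t)) j') < r" if "t \<in> ball 0 r" for t using z that by auto
      show ?thesis
      proof (rule holomorphic_uniform_sequence)
        fix n
        have "\<forall>j'. norm ((z(j := of_real (s n))) j') < r" using z s(1)[of n] s(2)[of n] \<rho> by auto
        then have "(\<lambda>t. g ((z(j := of_real (s n)))(i := t))) holomorphic_on ball 0 r"
          using g unfolding separately_holomorphic_def by blast
        then have 1: "(\<lambda>t. g ((z(i := t))(j := of_real (s n)))) holomorphic_on ball 0 r"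
          by (simp only: fun_upd_twist[OF False])
        have 2: "(\<lambda>t. tcoeff j m g (z(i := t))) holomorphic_on ball 0 r" if "m < k" for m
          using less[OF that] z by (auto simp: separately_holomorphic_def)
        have 3: "(\<lambda>t. \<Sum>m<k. tcoeff j m g (z(i := t)) * of_real (s n) ^ m) holomorphic_on ball 0 r"
          by (intro holomorphic_on_sum holomorphic_on_mult holomorphic_on_const 2) auto
        show "q n holomorphic_on ball 0 r"
          unfolding q_def[abs_def]
          by (rule holomorphic_on_divide[OF holomorphic_on_diff[OF 1 3] holomorphic_on_const]) (use s(1)[of n] in auto)
      next
        fix x :: complex assume x: "x \<in> ball 0 r"
        then obtain d where d: "d > 0" "cball x d \<subseteq> ball 0 r" using open_contains_cball[of "ball (0::complex) r"] by blast
        have "uniform_limit (cball x d) q (\<lambda>t. tcoeff j k g (z(i := t))) sequentially"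
          unfolding uniform_limit_iff
        proof (intro allI impI)
          fix e :: real assume "e > 0"
          have "(\<lambda>n. 2 * M / \<rho> ^ Suc k * s n) \<longlonglongrightarrow> 2 * M / \<rho> ^ Suc k * 0"
            unfolding s_def by (intro tendsto_mult_left tendsto_mult_right_zero LIMSEQ_inverse_real_of_nat)
          then have "\<forall>\<^sub>F n in sequentially. 2 * M / \<rho> ^ Suc k * s n < e"
            using \<open>e > 0\<close> by (intro order_tendstoD(2)[where y = "2 * M / \<rho> ^ Suc k * 0"]) auto
          then show "\<forall>\<^sub>F n in sequentially. \<forall>t\<in>cball x d. dist (q n t) (tcoeff j k g (z(i := t))) < e"
          proof eventually_elim
            case (elim n)
            show ?case
            proof
              fix t assume "t \<in> cball x d"
              then have "\<And>j'. norm ((z(i := t)) j') < r" using d in_D by blast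
              then have "norm (q n t - tcoeff j k g (z(i := t))) \<le> 2 * M / \<rho> ^ Suc k * s n"
                unfolding q_def by (rule tcoeff_tail[where z = "z(i := t)" and t = "s n", OF _ s])
              then show "dist (q n t) (tcoeff j k g (z(i := t))) < e" using elim unfolding dist_norm by (rule le_less_trans)
            qed
          qed
        qed
        then show "\<exists>d>0. cball x d \<subseteq> ball 0 r \<and> uniform_limit (cball x d) q (\<lambda>t. tcoeff j k g (z(i := t))) sequentially"
          using d by (intro exI[of _ d] conjI)
      qed (rule open_ball)
    qed
  qed
qed

end

text \<open>Expand in one variable and apply the induction hypothesis to each coefficient, whose
  Cauchy bound is \<open>M / \<rho> ^ k\<close>. These bounds make the whole family absolutely
  summable, so the iterated sum may be regrouped.\<close>

lemma power_series_expansion_supported: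
  fixes g :: "('v::finite \<Rightarrow> complex) \<Rightarrow> complex"
  assumes "separately_holomorphic r g" "\<And>z. (\<And>j. norm (z j) < r) \<Longrightarrow> norm (g z) \<le> M"
    and \<rho>: "0 < \<rho>" "\<rho> < r"
  shows "\<exists>F. (\<forall>\<alpha>\<in>supported S. norm (F \<alpha>) \<le> M / \<rho> ^ mdeg \<alpha>) \<and>
    (\<forall>z. (\<forall>j. norm (z j) < \<rho>) \<longrightarrow> (\<forall>j. j \<notin> S \<longrightarrow> z j = 0) \<longrightarrow>
      ((\<lambda>\<alpha>. F \<alpha> * mon z \<alpha>) has_sum g z) (supported S))"
proof -
  have "finite S" by simp
  then show ?thesis using assms(1,2)
  proof (induction S arbitrary: g M rule: finite_induct)
    case empty
    have "((\<lambda>\<alpha>. g (\<lambda>_. 0) * mon z \<alpha>) has_sum g z) (supported {})" if "\<forall>j. j \<notin> {} \<longrightarrow> z j = 0" for z :: "'v \<Rightarrow> complex"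
    proof -
      have "z = (\<lambda>_. 0)" using that by auto
      then show ?thesis unfolding supported_empty by (intro has_sum_finiteI) auto
    qed
    moreover have "norm (g (\<lambda>_. 0)) \<le> M" using empty(2)[of "\<lambda>_. 0"] \<rho> by simp
    ultimately show ?case by (intro exI[of _ "\<lambda>_. g (\<lambda>_. 0)"]) (auto simp: supported_empty)
  next
    case (insert j S)
    have "\<exists>F. (\<forall>\<alpha>\<in>supported S. norm (F \<alpha>) \<le> (M / \<rho> ^ k) / \<rho> ^ mdeg \<alpha>) \<and>
      (\<forall>z. (\<forall>j. norm (z j) < \<rho>) \<longrightarrow> (\<forall>j. j \<notin> S \<longrightarrow> z j = 0) \<longrightarrow>
        ((\<lambda>\<alpha>. F \<alpha> * mon z \<alpha>) has_sum tcoeff j k g z) (supported S))" for k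
      by (rule insert(3)[OF separately_holomorphic_tcoeff[OF insert(4,5) \<rho>] tcoeff_bound[OF insert(4,5) \<rho>]])
    then obtain F where F: "\<And>k \<alpha>. \<alpha> \<in> supported S \<Longrightarrow> norm (F k \<alpha>) \<le> (M / \<rho> ^ k) / \<rho> ^ mdeg \<alpha>"
      "\<And>k z. (\<And>j. norm (z j) < \<rho>) \<Longrightarrow> (\<And>j. j \<notin> S \<Longrightarrow> z j = 0) \<Longrightarrow>
        ((\<lambda>\<alpha>. F k \<alpha> * mon z \<alpha>) has_sum tcoeff j k g z) (supported S)"
      by metis
    define G where "G \<alpha> = F (\<alpha> j) (\<alpha>(j := 0))" for \<alpha>
    have z0: "\<beta> j = 0" if "\<beta> \<in> supported S" for \<beta> using that insert(2) by (auto simp: supported_def)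
    have G_upd: "G (\<beta>(j := k)) = F k \<beta>" if "\<beta> \<in> supported S" for \<beta> k
    proof -
      have "\<beta>(j := 0) = \<beta>" using z0[OF that] by auto
      then show ?thesis by (simp add: G_def)
    qed
    have M0: "M \<ge> 0" using order.trans[OF norm_ge_zero insert(5)[of "\<lambda>_. 0"]] \<rho> by simp
    have bound: "norm (G \<alpha>) \<le> M / \<rho> ^ mdeg \<alpha>" if \<alpha>: "\<alpha> \<in> supported (insert j S)" for \<alpha>
    proof -
      have "\<alpha>(j := 0) \<in> supported S" using \<alpha> by (auto simp: supported_def)
      then have "norm (G \<alpha>) \<le> M / \<rho> ^ \<alpha> j / \<rho> ^ mdeg (\<alpha>(j := 0))" unfolding G_def by (rule F(1))
      also have "\<dots> = M / \<rho> ^ mdeg \<alpha>"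
        using mdeg_fun_upd[of "\<alpha>(j := 0)" j "\<alpha> j"] by (simp add: power_add field_simps)
      finally show ?thesis .
    qed
    moreover have "((\<lambda>\<alpha>. G \<alpha> * mon z \<alpha>) has_sum g z) (supported (insert j S))"
      if z: "\<forall>j. norm (z j) < \<rho>" and zS: "\<forall>i. i \<notin> insert j S \<longrightarrow> z i = 0" for z
    proof -
      \<comment> \<open>Ratio of the dominating geometric series: the largest coordinate relative to
        \<open>\<rho>\<close>.\<close>
      define x where "x = Max (range (\<lambda>j. norm (z j))) / \<rho>"
      have xz: "norm (z j) \<le> x * \<rho>" for j using \<rho> by (simp add: x_def)
      have x: "0 \<le> x" "x < 1"
      proof -
        show "x < 1" using z \<rho> by (simp add: x_def)
        have "0 \<le> x * \<rho>" using xz[of j] norm_ge_zero[of "z j"] by linarith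
        then show "0 \<le> x" using \<rho> by (simp add: zero_le_mult_iff)
      qed
      have summ: "(\<lambda>\<alpha>. G \<alpha> * mon z \<alpha>) summable_on supported (insert j S)"
      proof (rule abs_summable_summable, rule summable_on_comparison_test)
        show "(\<lambda>\<alpha>. M * x ^ mdeg \<alpha>) summable_on supported (insert j S)"
          by (intro summable_on_cmult_right summable_on_mdeg_geometric x)
        fix \<alpha> assume \<alpha>: "\<alpha> \<in> supported (insert j S)"
        have "norm (G \<alpha> * mon z \<alpha>) \<le> M / \<rho> ^ mdeg \<alpha> * (x * \<rho>) ^ mdeg \<alpha>"
          unfolding norm_mult by (intro mult_mono bound[OF \<alpha>] norm_mon_le xz) (use M0 \<rho> in auto)
        also have "\<dots> = M * x ^ mdeg \<alpha>" using \<rho> by (simp add: power_mult_distrib)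
        finally show "norm (G \<alpha> * mon z \<alpha>) \<le> M * x ^ mdeg \<alpha>" .
      qed auto
      have conv: "G (\<beta>(j := k)) * mon z (\<beta>(j := k)) = z j ^ k * (F k \<beta> * mon z \<beta>)" if "\<beta> \<in> supported S" for \<beta> k
        using that by (simp add: G_upd mon_fun_upd z0)
      have bij: "((\<lambda>p. G (case p of (k, \<beta>) \<Rightarrow> \<beta>(j := k)) * mon z (case p of (k, \<beta>) \<Rightarrow> \<beta>(j := k))) has_sum s) (UNIV \<times> supported S)
          \<longleftrightarrow> ((\<lambda>\<alpha>. G \<alpha> * mon z \<alpha>) has_sum s) (supported (insert j S))" for s
        using has_sum_reindex_bij_betw[OF bij_supported_insert[OF insert(2)], of "\<lambda>\<alpha>. G \<alpha> * mon z \<alpha>" s] by simp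
      let ?t = "\<lambda>(k, \<beta>). z j ^ k * (F k \<beta> * mon z \<beta>)"
      have bij': "(?t has_sum s) (UNIV \<times> supported S) \<longleftrightarrow> ((\<lambda>\<alpha>. G \<alpha> * mon z \<alpha>) has_sum s) (supported (insert j S))" for s
        unfolding bij[symmetric] by (rule has_sum_cong) (auto simp: conv)
      have zr: "norm ((z(j := 0)) i) < r" for i using z \<rho> by (auto intro: less_trans)
      have inner: "((\<lambda>\<beta>. ?t (k, \<beta>)) has_sum z j ^ k * tcoeff j k g z) (supported S)" for k
      proof -
        have m: "mon (z(j := 0)) \<beta> = mon z \<beta>" if "\<beta> \<in> supported S" for \<beta>
          by (rule mon_cong_supported[OF that]) (use insert(2) in auto)
        have "((\<lambda>\<beta>. F k \<beta> * mon (z(j := 0)) \<beta>) has_sum tcoeff j k g (z(j := 0))) (supported S)"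
          by (rule F(2)) (use z zS \<rho> in auto)
        moreover have "tcoeff j k g (z(j := 0)) = tcoeff j k g z" by (simp add: tcoeff_def)
        moreover have "((\<lambda>\<beta>. F k \<beta> * mon (z(j := 0)) \<beta>) has_sum s) (supported S)
            \<longleftrightarrow> ((\<lambda>\<beta>. F k \<beta> * mon z \<beta>) has_sum s) (supported S)" for s
          by (rule has_sum_cong) (simp add: m)
        ultimately have "((\<lambda>\<beta>. F k \<beta> * mon z \<beta>) has_sum tcoeff j k g z) (supported S)"
          by (simp only:)
        then show ?thesis by (simp add: has_sum_cmult_right)
      qed
      have outer: "((\<lambda>k. z j ^ k * tcoeff j k g z) has_sum g z) UNIV"
      proof -
        have "(\<lambda>k. tcoeff j k g (z(j := 0)) * z j ^ k) sums g ((z(j := 0))(j := z j))"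
          by (rule tcoeff_sums[OF insert(4,5) \<rho>]) (use zr z \<rho> in \<open>auto intro: less_trans\<close>)
        then have s: "(\<lambda>k. z j ^ k * tcoeff j k g z) sums g z" by (simp add: tcoeff_def mult.commute)
        have "summable (\<lambda>k. norm (z j ^ k * tcoeff j k g z))"
        proof (rule summable_comparison_test)
          show "summable (\<lambda>k. M * x ^ k)" using x by (intro summable_mult summable_geometric) auto
          have "norm (z j ^ k * tcoeff j k g z) \<le> (x * \<rho>) ^ k * (M / \<rho> ^ k)" for k
            unfolding norm_mult norm_power
            by (intro mult_mono power_mono xz tcoeff_bound[OF insert(4,5) \<rho>])
              (use z \<rho> x M0 in \<open>auto intro: less_trans\<close>)
          moreover have "(x * \<rho>) ^ k * (M / \<rho> ^ k) = M * x ^ k" for k using \<rho> by (simp add: power_mult_distrib)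
          ultimately show "\<exists>N. \<forall>n\<ge>N. norm (norm (z j ^ n * tcoeff j n g z)) \<le> M * x ^ n" by simp
        qed
        then show ?thesis using s by (rule norm_summable_imp_has_sum)
      qed
      have "?t summable_on (UNIV \<times> supported S)"
        using summ bij' by (auto simp: summable_on_def)
      then have "(?t has_sum g z) (UNIV \<times> supported S)"
        by (rule has_sum_SigmaI[OF inner outer])
      then show ?thesis by (simp only: bij')
    qed
    ultimately show ?case by blast
  qed
qed

definition cvec :: "('l option option \<Rightarrow> complex) \<Rightarrow> complex \<times> complex \<times> (complex^'l)" where
  "cvec z = (z None, z (Some None), \<chi> j. z (yvar j))"

text \<open>Continuity at the origin bounds \<open>f\<close> on a small polydisc, and a
  complex-linear derivative restricts to an ordinary complex derivative along each coordinate line;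
  so the expansion for separately holomorphic functions applies.\<close>

lemma holomorphic3_power_series:
  fixes f :: "complex \<times> complex \<times> (complex^'l) \<Rightarrow> complex^'m"
  assumes f: "holomorphic3_on f U" and U: "(0, 0, 0) \<in> U"
  shows "\<exists>(F :: 'm \<Rightarrow> ('l option option \<Rightarrow> nat) \<Rightarrow> complex) \<rho>. \<rho> > 0 \<and> (\<forall>i. convergent_ps (F i)) \<and>
    (\<forall>z i. (\<forall>j. norm (z j) < \<rho>) \<longrightarrow> cvec z \<in> U \<and> ((\<lambda>\<alpha>. F i \<alpha> * mon z \<alpha>) has_sum f (cvec z) $ i) UNIV)"
proof -
  obtain D0 where "(f has_derivative D0) (at (0, 0, 0))"
    using f U unfolding holomorphic3_on_def by blast
  then have cont0: "isCont f (0, 0, 0)" by (rule has_derivative_continuous)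
  have "open U" using f by (simp add: holomorphic3_on_def)
  obtain d1 where d1: "d1 > 0" "\<And>w. dist w (0, 0, 0) < d1 \<Longrightarrow> dist (f w) (f (0, 0, 0)) < 1"
    using cont0 unfolding continuous_at_eps_delta using zero_less_one by blast
  obtain d2 where d2: "d2 > 0" "\<And>w. dist w (0, 0, 0) < d2 \<Longrightarrow> w \<in> U"
    using \<open>open U\<close> U unfolding open_dist by blast
  define d where "d = min d1 d2"
  \<comment> \<open>The norm of a point is at most the sum of the absolute values of its
    \<open>CARD('l) + 2\<close> coordinates; \<open>c * r = d / 2\<close> keeps the polydisc inside
    the ball of radius \<open>d\<close>.\<close>
  define c where "c = real CARD('l) + 2"
  define r where "r = d / 2 / c"
  have "d > 0" "c > 0" using d1 d2 by (simp_all add: d_def c_def)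
  then have r: "r > 0" "c * r < d" by (simp_all add: r_def)
  have small: "dist (cvec z) (0, 0, 0) < d" if z: "\<And>j. norm (z j) < r" for z :: "'l option option \<Rightarrow> complex"
  proof -
    have "dist (cvec z) (0, 0, 0) = norm (z None, z (Some None), \<chi> j. z (yvar j))"
      by (simp add: cvec_def dist_norm)
    also have "\<dots> \<le> norm (z None) + (norm (z (Some None)) + norm (\<chi> j. z (yvar j)))"
      using norm_Pair_le[of "z None" "(z (Some None), \<chi> j. z (yvar j))"]
        norm_Pair_le[of "z (Some None)" "\<chi> j. z (yvar j)"] by linarith
    also have "norm (\<chi> j. z (yvar j)) \<le> (\<Sum>j\<in>UNIV. norm (z (yvar j)))"
      using L2_set_le_sum[of UNIV "\<lambda>j. norm (z (yvar j))"] by (simp add: norm_vec_def)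
    also have "\<dots> \<le> (\<Sum>j\<in>(UNIV::'l set). r)" by (intro sum_mono less_imp_le z)
    also have "\<dots> = real CARD('l) * r" by simp
    finally have "dist (cvec z) (0, 0, 0) \<le> norm (z None) + (norm (z (Some None)) + real CARD('l) * r)" by simp
    then show ?thesis using z[of None] z[of "Some None"] r(2) by (simp add: c_def algebra_simps)
  qed
  have inU: "cvec z \<in> U" if "\<And>j. norm (z j) < r" for z :: "'l option option \<Rightarrow> complex"
    using small[of z] that d2 by (auto simp: d_def)
  define M where "M = norm (f (0, 0, 0)) + 1"
  have M: "norm (f (cvec z) $ i) \<le> M" if "\<And>j. norm (z j) < r" for z :: "'l option option \<Rightarrow> complex" and i
  proof -
    have "dist (f (cvec z)) (f (0, 0, 0)) < 1" using small[of z] that d1 by (auto simp: d_def)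
    then have "norm (f (cvec z)) \<le> M"
      using norm_triangle_ineq2[of "f (cvec z)" "f (0,0,0)"] by (simp add: M_def dist_norm)
    then show ?thesis by (rule order_trans[OF Finite_Cartesian_Product.norm_nth_le])
  qed
  have sep: "separately_holomorphic r (\<lambda>z. f (cvec z) $ i)" for i
    unfolding separately_holomorphic_def
  proof (intro allI impI)
    fix z :: "'l option option \<Rightarrow> complex" and j :: "'l option option" assume z: "\<forall>j. norm (z j) < r"
    \<comment> \<open>The unit vector in direction \<open>j\<close>. The slice is an affine complex
      line, and complex linearity of \<open>D\<close> makes the derivative along it multiplication
      by one number.\<close>
    define e :: "'l option option \<Rightarrow> complex" where "e = (\<lambda>_. 0)(j := 1)"
    define a b v where "a = e None" "b = e (Some None)" "v = (\<chi> i. e (yvar i))"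
    define w0 where "w0 = cvec (z(j := 0))"
    define L where "L t = (t * a, t * b, t *s v)" for t
    have line: "cvec (z(j := t)) = w0 + L t" for t
      by (auto simp: w0_def L_def e_def a_b_v_def cvec_def vec_eq_iff)
    have bl: "bounded_linear L"
    proof -
      have "bounded_linear (\<lambda>t. t *s v)"
      proof -
        have "linear (\<lambda>t::complex. t *s v)"
          by (rule linearI) (auto simp: vec_eq_iff algebra_simps)
        then show ?thesis by (rule linear_conv_bounded_linear[THEN iffD1])
      qed
      then show ?thesis unfolding L_def[abs_def]
        by (intro bounded_linear_Pair bounded_linear_mult_left)
    qed
    show "(\<lambda>t. f (cvec (z(j := t))) $ i) holomorphic_on ball 0 r"
      unfolding holomorphic_on_def
    proof
      fix t :: complex assume t: "t \<in> ball 0 r"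
      have "cvec (z(j := t)) \<in> U" by (rule inU) (use z t in auto)
      then obtain D where D: "(f has_derivative D) (at (w0 + L t))"
        "\<And>c a b v. D (c * a, c * b, c *s v) = c *s D (a, b, v)"
        using f unfolding holomorphic3_on_def line by blast
      have "((\<lambda>t. w0 + L t) has_derivative L) (at t)"
        using has_derivative_add[OF has_derivative_const bounded_linear_imp_has_derivative[OF bl]] by simp
      then have "((\<lambda>t. f (w0 + L t)) has_derivative (\<lambda>h. D (L h))) (at t)"
        by (rule has_derivative_compose[where f = "\<lambda>t. w0 + L t" and g = f, OF _ D(1)])
      then have "((\<lambda>t. f (w0 + L t) $ i) has_derivative (\<lambda>h. D (L h) $ i)) (at t)"
        by (rule bounded_linear.has_derivative[OF bounded_linear_vec_nth])
      moreover have "(\<lambda>h. D (L h) $ i) = (*) (D (a, b, v) $ i)"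
        by (simp add: L_def D(2) fun_eq_iff)
      ultimately have "((\<lambda>t. f (w0 + L t) $ i) has_field_derivative (D (a, b, v) $ i)) (at t)"
        by (simp add: has_field_derivative_def)
      then show "(\<lambda>t. f (cvec (z(j := t))) $ i) field_differentiable at t within ball 0 r"
        unfolding line by (auto simp: field_differentiable_def intro: has_field_derivative_at_within)
    qed
  qed
  define \<rho> where "\<rho> = r / 2"
  have \<rho>: "0 < \<rho>" "\<rho> < r" using r by (auto simp: \<rho>_def)
  have supp: "supported UNIV = (UNIV :: ('l option option \<Rightarrow> nat) set)" by (simp add: supported_def)
  have "\<exists>F. (\<forall>\<alpha>. norm (F \<alpha>) \<le> M / \<rho> ^ mdeg \<alpha>) \<and>
    (\<forall>z. (\<forall>j. norm (z j) < \<rho>) \<longrightarrow> ((\<lambda>\<alpha>. F \<alpha> * mon z \<alpha>) has_sum f (cvec z) $ i) UNIV)" for i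
    using power_series_expansion_supported[OF sep[of i] M \<rho>, of UNIV] by (simp add: supp)
  then obtain F where F: "\<And>i \<alpha>. norm (F i \<alpha>) \<le> M / \<rho> ^ mdeg \<alpha>"
    "\<And>i z. (\<And>j. norm (z j) < \<rho>) \<Longrightarrow> ((\<lambda>\<alpha>. F i \<alpha> * mon z \<alpha>) has_sum f (cvec z) $ i) UNIV"
    by metis
  have "convergent_ps (F i)" for i
    unfolding convergent_ps_def
  proof (intro exI conjI allI)
    show "M \<ge> 0" by (simp add: M_def)
    show "max 1 (1 / \<rho>) \<ge> 1" by simp
    fix \<alpha> :: "'l option option \<Rightarrow> nat"
    have "M / \<rho> ^ mdeg \<alpha> = M * (1 / \<rho>) ^ mdeg \<alpha>" by (simp add: power_divide)
    also have "\<dots> \<le> M * max 1 (1 / \<rho>) ^ mdeg \<alpha>"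
      using \<rho> by (intro mult_left_mono power_mono) (auto simp: M_def)
    finally show "norm (F i \<alpha>) \<le> M * max 1 (1 / \<rho>) ^ mdeg \<alpha>" using F(1) order_trans by blast
  qed
  moreover have "cvec z \<in> U" if "\<forall>j. norm (z j) < \<rho>" for z :: "'l option option \<Rightarrow> complex"
    by (rule inU) (use that \<rho>(2) less_trans in blast)
  ultimately show ?thesis using \<rho>(1) F(2) by (intro exI[of _ F] exI[of _ \<rho>]) simp
qed

section \<open>Comparison with the Taylor coefficients, substitution and Jacobian of the
  problem\<close>

definition join_exp :: "nat \<times> nat \<times> ('l \<Rightarrow> nat) \<Rightarrow> 'l option option \<Rightarrow> nat" where
  "join_exp = (\<lambda>(a, b, \<alpha>) i. case i of None \<Rightarrow> a | Some None \<Rightarrow> b | Some (Some j) \<Rightarrow> \<alpha> j)"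

definition split_exp :: "('l option option \<Rightarrow> nat) \<Rightarrow> nat \<times> nat \<times> ('l \<Rightarrow> nat)" where
  "split_exp \<alpha> = (\<alpha> None, \<alpha> (Some None), \<lambda>j. \<alpha> (yvar j))"

lemma join_split_exp [simp]: "join_exp (split_exp \<alpha>) = \<alpha>" "split_exp (join_exp x) = x"
  by (auto simp: join_exp_def split_exp_def fun_eq_iff split: option.splits prod.splits)

lemma case_split_exp: "(case split_exp \<alpha> of (a, b, \<beta>) \<Rightarrow> P (join_exp (a, b, \<beta>))) = P \<alpha>"
  using join_split_exp(1)[of \<alpha>] by (cases "split_exp \<alpha>") simp

lemma bij_join_exp: "bij join_exp"
  by (rule bij_betw_byWitness[where f' = split_exp]) auto

lemma mon_join_exp: "mon z (join_exp (a, b, \<alpha>)) = z None ^ a * z (Some None) ^ b * (\<Prod>j\<in>UNIV. z (yvar j) ^ \<alpha> j)"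
  for z :: "'l::finite option option \<Rightarrow> 'a::comm_monoid_mult"
  by (simp add: mon_def prod_vars join_exp_def)

lemma mdeg_join_exp: "mdeg (join_exp (a, b, \<alpha>)) = a + b + (\<Sum>j\<in>UNIV. \<alpha> j)"
  by (simp add: sum_vars join_exp_def)

lemma has_sum_vec_iff:
  fixes f :: "'a \<Rightarrow> complex^'m"
  shows "(f has_sum s) A \<longleftrightarrow> (\<forall>i. ((\<lambda>x. f x $ i) has_sum (s $ i)) A)"
proof
  assume "(f has_sum s) A"
  then show "\<forall>i. ((\<lambda>x. f x $ i) has_sum (s $ i)) A"
    unfolding has_sum_def
  proof (intro allI)
    fix i assume "(sum f \<longlongrightarrow> s) (finite_subsets_at_top A)"
    then have "((\<lambda>X. sum f X $ i) \<longlongrightarrow> s $ i) (finite_subsets_at_top A)" by (rule tendsto_vec_nth)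
    then show "(sum (\<lambda>x. f x $ i) \<longlongrightarrow> s $ i) (finite_subsets_at_top A)" by (simp add: sum_component)
  qed
next
  assume "\<forall>i. ((\<lambda>x. f x $ i) has_sum (s $ i)) A"
  then show "(f has_sum s) A"
    unfolding has_sum_def by (intro vec_tendstoI) (simp add: sum_component)
qed

lemma has_taylor_iff:
  fixes f :: "complex \<times> complex \<times> (complex^'l) \<Rightarrow> complex^'m"
  shows "has_taylor f F \<longleftrightarrow> (\<exists>e>0. \<forall>x1 x2 y. norm x1 < e \<longrightarrow> norm x2 < e \<longrightarrow> norm y < e \<longrightarrow>
     (\<forall>i. ((\<lambda>\<alpha>. (case split_exp \<alpha> of (a, b, \<beta>) \<Rightarrow> F a b \<beta> $ i) *
        mon (\<lambda>v. case v of None \<Rightarrow> x1 | Some None \<Rightarrow> x2 | Some (Some j) \<Rightarrow> y $ j) \<alpha>) has_sum f (x1, x2, y) $ i) UNIV))"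
proof -
  have "((\<lambda>(a, b, \<alpha>). (x1 ^ a * x2 ^ b * (\<Prod>j\<in>UNIV. y $ j ^ \<alpha> j)) *s F a b \<alpha>) has_sum s) UNIV \<longleftrightarrow>
    (\<forall>i. ((\<lambda>\<alpha>. (case split_exp \<alpha> of (a, b, \<beta>) \<Rightarrow> F a b \<beta> $ i) *
        mon (\<lambda>v. case v of None \<Rightarrow> x1 | Some None \<Rightarrow> x2 | Some (Some j) \<Rightarrow> y $ j) \<alpha>) has_sum s $ i) UNIV)"
    for x1 x2 s and y :: "complex^'l"
    unfolding has_sum_vec_iff
  proof (intro all_cong1)
    fix i
    show "((\<lambda>x. (case x of (a, b, \<alpha>) \<Rightarrow> (x1 ^ a * x2 ^ b * (\<Prod>j\<in>UNIV. y $ j ^ \<alpha> j)) *s F a b \<alpha>) $ i) has_sum s $ i) UNIV \<longleftrightarrow>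
      ((\<lambda>\<alpha>. (case split_exp \<alpha> of (a, b, \<beta>) \<Rightarrow> F a b \<beta> $ i) *
        mon (\<lambda>v. case v of None \<Rightarrow> x1 | Some None \<Rightarrow> x2 | Some (Some j) \<Rightarrow> y $ j) \<alpha>) has_sum s $ i) UNIV"
      by (subst has_sum_reindex_bij_betw[OF bij_join_exp, symmetric])
        (auto intro!: has_sum_cong simp: mon_join_exp mult.commute)
  qed
  then show ?thesis unfolding has_taylor_def by presburger
qed

lemma split_cvec:
  "(\<lambda>v. case v of None \<Rightarrow> z None | Some None \<Rightarrow> z (Some None) | Some (Some j) \<Rightarrow> (\<chi> j. z (yvar j)) $ j) = z"
proof
  fix v
  show "(case v of None \<Rightarrow> z None | Some None \<Rightarrow> z (Some None) | Some (Some j) \<Rightarrow> (\<chi> j. z (yvar j)) $ j) = z v"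
    by (cases v rule: vars_cases) auto
qed

text \<open>\<open>taylor\<close> is a definite description, so a unique family has to be exhibited:
  existence by regrouping exponents, uniqueness by the identity theorem.\<close>

lemma taylor_coeffs:
  fixes f :: "complex \<times> complex \<times> (complex^'l) \<Rightarrow> complex^'m"
    and F :: "'m \<Rightarrow> ('l option option \<Rightarrow> nat) \<Rightarrow> complex"
  assumes \<rho>: "\<rho> > 0"
    and F: "\<And>i z. (\<And>j. norm (z j) < \<rho>) \<Longrightarrow> ((\<lambda>\<alpha>. F i \<alpha> * mon z \<alpha>) has_sum f (cvec z) $ i) UNIV"
  shows "taylor f a b \<beta> $ i = F i (join_exp (a, b, \<beta>))"
proof -
  define G where "G a b \<beta> = (\<chi> i. F i (join_exp (a, b, \<beta>)))" for a b \<beta>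
  have G: "has_taylor f G"
    unfolding has_taylor_iff
  proof (intro exI conjI allI impI)
    fix x1 x2 :: complex and y :: "complex^'l" and i
    assume *: "norm x1 < \<rho>" "norm x2 < \<rho>" "norm y < \<rho>"
    define z where "z v = (case v of None \<Rightarrow> x1 | Some None \<Rightarrow> x2 | Some (Some j) \<Rightarrow> y $ j)" for v
    have "norm (y $ j) < \<rho>" for j using le_less_trans[OF Finite_Cartesian_Product.norm_nth_le *(3)] .
    then have "norm (z j) < \<rho>" for j using * by (cases j rule: vars_cases) (auto simp: z_def)
    then have "((\<lambda>\<alpha>. F i \<alpha> * mon z \<alpha>) has_sum f (cvec z) $ i) UNIV" by (rule F)
    moreover have "cvec z = (x1, x2, y)" by (simp add: cvec_def z_def)
    moreover have "(case split_exp \<alpha> of (a, b, \<beta>) \<Rightarrow> G a b \<beta> $ i) = F i \<alpha>" for \<alpha>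
      using case_split_exp[where P = "F i" and \<alpha> = \<alpha>] by (simp add: G_def)
    ultimately show "((\<lambda>\<alpha>. (case split_exp \<alpha> of (a, b, \<beta>) \<Rightarrow> G a b \<beta> $ i) *
        mon (\<lambda>v. case v of None \<Rightarrow> x1 | Some None \<Rightarrow> x2 | Some (Some j) \<Rightarrow> y $ j) \<alpha>) has_sum f (x1, x2, y) $ i) UNIV"
      by (simp add: z_def[abs_def])
  qed (rule \<rho>)
  have uniq: "H = G" if "has_taylor f H" for H
  proof -
    from that obtain e where e: "e > 0" and H: "\<forall>x1 x2 y. norm x1 < e \<longrightarrow> norm x2 < e \<longrightarrow> norm y < e \<longrightarrow> (\<forall>i.
       ((\<lambda>\<alpha>. (case split_exp \<alpha> of (a, b, \<beta>) \<Rightarrow> H a b \<beta> $ i) *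
        mon (\<lambda>v. case v of None \<Rightarrow> x1 | Some None \<Rightarrow> x2 | Some (Some j) \<Rightarrow> y $ j) \<alpha>) has_sum f (x1, x2, y) $ i) UNIV)"
      unfolding has_taylor_iff by (elim exE conjE)
    \<comment> \<open>If all coordinates are below \<open>d\<close>, the vector y has norm at most
      \<open>CARD('l) * d\<close>, which is below \<open>e\<close>.\<close>
    define d where "d = min \<rho> (e / (real CARD('l) + 1))"
    have d: "d > 0" "d \<le> \<rho>" "d \<le> e / (real CARD('l) + 1)" using e \<rho> by (auto simp: d_def)
    have "(real CARD('l) + 1) * d \<le> e" using d(3) by (simp add: field_simps)
    then have de: "real CARD('l) * d + d \<le> e" by (simp add: algebra_simps)
    have "(case split_exp \<alpha> of (a, b, \<beta>) \<Rightarrow> H a b \<beta> $ i) - F i \<alpha> = 0" for i \<alpha>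
    proof (rule power_series_identity_theorem[OF d(1), where S = UNIV])
      fix z :: "'l option option \<Rightarrow> complex" assume z: "\<And>j. norm (z j) < d"
      have "norm (\<chi> j. z (yvar j)) \<le> (\<Sum>j\<in>UNIV. norm (z (yvar j)))"
        using L2_set_le_sum[of UNIV "\<lambda>j. norm (z (yvar j))"] by (simp add: norm_vec_def)
      also have "\<dots> \<le> (\<Sum>j\<in>(UNIV::'l set). d)" by (intro sum_mono less_imp_le z)
      finally have ny: "norm (\<chi> j. z (yvar j)) < e" using de d(1) by simp
      have "0 \<le> real CARD('l) * d" using d(1) by simp
      then have "norm (z j) < e" for j using z[of j] de by linarith
      then have "((\<lambda>\<alpha>. (case split_exp \<alpha> of (a, b, \<beta>) \<Rightarrow> H a b \<beta> $ i) * mon z \<alpha>) has_sum f (cvec z) $ i) UNIV"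
        using H[rule_format, of "z None" "z (Some None)" "\<chi> j. z (yvar j)" i] \<open>\<And>j. norm (z j) < e\<close> ny unfolding split_cvec cvec_def by blast
      moreover have "((\<lambda>\<alpha>. F i \<alpha> * mon z \<alpha>) has_sum f (cvec z) $ i) UNIV"
        by (rule F) (use z d in \<open>auto intro: less_le_trans\<close>)
      then have "((\<lambda>\<alpha>. -1 * (F i \<alpha> * mon z \<alpha>)) has_sum -1 * (f (cvec z) $ i)) UNIV"
        by (rule has_sum_cmult_right)
      ultimately have "((\<lambda>\<alpha>. (case split_exp \<alpha> of (a, b, \<beta>) \<Rightarrow> H a b \<beta> $ i) * mon z \<alpha> + -1 * (F i \<alpha> * mon z \<alpha>))
          has_sum f (cvec z) $ i + -1 * (f (cvec z) $ i)) UNIV"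
        by (rule has_sum_add)
      then show "((\<lambda>\<alpha>. ((case split_exp \<alpha> of (a, b, \<beta>) \<Rightarrow> H a b \<beta> $ i) - F i \<alpha>) * mon z \<alpha>) has_sum 0) (supported UNIV)"
        by (simp add: supported_def left_diff_distrib)
    qed (simp add: supported_def)
    then have HF: "(case split_exp \<alpha> of (a, b, \<beta>) \<Rightarrow> H a b \<beta> $ i) = F i \<alpha>" for i \<alpha>
      using eq_iff_diff_eq_0 by simp
    have "H a b \<beta> $ i = F i (join_exp (a, b, \<beta>))" for i a b \<beta>
      using HF[where \<alpha> = "join_exp (a, b, \<beta>)"] by simp
    then show "H = G" by (simp add: G_def fun_eq_iff vec_eq_iff)
  qed
  have "taylor f = G" unfolding taylor_def using G uniq by (rule the_equality)
  then show ?thesis by (simp add: G_def)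
qed

lemma fsubst_eq_psubst:
  assumes "\<And>a b \<beta>. taylor f a b \<beta> $ i = F (join_exp (a, b, \<beta>))"
  shows "fsubst f u $ i = psubst F (with_x u)"
proof (rule coeff2_eqI)
  fix n m
  have "coeff2 (psubst F (with_x u)) n m = (\<Sum>\<alpha>\<in>{\<alpha>. mdeg \<alpha> \<le> n + m}. F \<alpha> * coeff2 (mon (with_x u) \<alpha>) n m)"
    by (simp add: psubst_def psum_def coeff2_sum coeff2_def[of "Abs_fps _"])
  also have "\<dots> = (\<Sum>(a, b, \<beta>)\<in>{(a, b, \<beta>). a + b + (\<Sum>j\<in>UNIV. \<beta> j) \<le> n + m}.
      F (join_exp (a, b, \<beta>)) * coeff2 (mon (with_x u) (join_exp (a, b, \<beta>))) n m)"
    by (rule sum.reindex_bij_witness[of _ join_exp split_exp])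
      (auto simp: mdeg_join_exp case_split_exp[where P = "\<lambda>\<alpha>. F \<alpha> * coeff2 (mon (with_x u) \<alpha>) n m"],
        auto simp: split_exp_def sum_vars)
  also have "\<dots> = coeff2 (fsubst f u $ i) n m"
    by (simp add: fsubst_def coeff2_def[of "Abs_fps _"] assms mon_join_exp)
  finally show "coeff2 (fsubst f u $ i) n m = coeff2 (psubst F (with_x u)) n m" by simp
qed

lemma power_series_deriv_at_0:
  fixes a :: "nat \<Rightarrow> complex"
  assumes "\<rho> > 0" "\<And>t. norm t < \<rho> \<Longrightarrow> (\<lambda>k. a k * t ^ k) sums h t"
  shows "deriv h 0 = a 1"
proof -
  define K where "K = (of_real (\<rho> / 2) :: complex)"
  have K: "norm K < \<rho>" "norm (0::complex) < norm K" using assms(1) by (auto simp: K_def)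
  have "((\<lambda>x. \<Sum>n. a n * x ^ n) has_field_derivative (\<Sum>n. diffs a n * 0 ^ n)) (at 0)"
    by (rule termdiffs_strong[OF sums_summable[OF assms(2)[OF K(1)]] K(2)])
  then have "((\<lambda>x. \<Sum>n. a n * x ^ n) has_field_derivative a 1) (at 0)"
    by (simp add: diffs_def)
  then have "(h has_field_derivative a 1) (at 0)"
  proof (rule has_field_derivative_transform_within_open[where S = "ball 0 \<rho>"])
    show "(\<Sum>n. a n * x ^ n) = h x" if "x \<in> ball 0 \<rho>" for x
      using assms(2)[of x] that by (simp add: sums_iff)
  qed (use assms(1) in auto)
  then show ?thesis by (rule DERIV_imp_deriv)
qed

text \<open>On the j-th y-axis only the exponents concentrated in that variable survive; the
  derivative at 0 is the linear coefficient of the resulting series.\<close>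

lemma jac_y_power_series:
  fixes f :: "complex \<times> complex \<times> (complex^'l) \<Rightarrow> complex^'m"
  assumes \<rho>: "\<rho> > 0"
    and F: "\<And>i z. (\<And>j. norm (z j) < \<rho>) \<Longrightarrow> ((\<lambda>\<alpha>. F i \<alpha> * mon z \<alpha>) has_sum f (cvec z) $ i) UNIV"
  shows "jac_y f 0 0 0 = (\<chi> i j. F i (unit_exp (yvar j)))"
proof -
  have "deriv (\<lambda>t. f (0, 0, axis j t) $ i) 0 = F i (unit_exp (yvar j))" for i and j :: 'l
  proof -
    have "(\<lambda>k. F i ((\<lambda>_. 0)(yvar j := k)) * t ^ k) sums f (0, 0, axis j t) $ i" if t: "norm t < \<rho>" for t
    proof -
      define z where "z = (\<lambda>_. 0 :: complex)(yvar j := t)"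
      have "cvec z = (0, 0, axis j t)" by (auto simp: cvec_def z_def vec_eq_iff axis_def)
      moreover have "((\<lambda>\<alpha>. F i \<alpha> * mon z \<alpha>) has_sum f (cvec z) $ i) UNIV"
        by (rule F) (use t \<rho> in \<open>auto simp: z_def\<close>)
      ultimately have *: "((\<lambda>\<alpha>. F i \<alpha> * mon z \<alpha>) has_sum f (0, 0, axis j t) $ i) UNIV" by simp
      let ?e = "\<lambda>k. (\<lambda>_. 0 :: nat)(yvar j := k)"
      have zero: "mon z \<alpha> = 0" if "\<alpha> \<notin> range ?e" for \<alpha>
      proof -
        have "\<alpha> \<noteq> ?e (\<alpha> (yvar j))" using that by blast
        then obtain v where "v \<noteq> yvar j" "\<alpha> v \<noteq> 0" by (auto simp: fun_eq_iff split: if_splits)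
        then show ?thesis unfolding mon_def by (intro prod_zero) (auto simp: z_def intro!: bexI[of _ v])
      qed
      have "((\<lambda>\<alpha>. F i \<alpha> * mon z \<alpha>) has_sum f (0, 0, axis j t) $ i) (range ?e)"
        using * by (rule has_sum_cong_neutral[THEN iffD1, rotated -1]) (auto simp: zero)
      moreover have "inj ?e" by (auto simp: inj_def fun_eq_iff split: if_splits)
      ultimately have "((\<lambda>k. F i (?e k) * mon z (?e k)) has_sum f (0, 0, axis j t) $ i) UNIV"
        by (simp add: has_sum_reindex o_def)
      moreover have "mon z (?e k) = t ^ k" for k
        using mon_fun_upd[of "\<lambda>_. 0" "yvar j" z k] by (simp add: z_def)
      ultimately show ?thesis using has_sum_imp_sums by fastforce
    qed
    from power_series_deriv_at_0[OF \<rho> this] show ?thesis by simp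
  qed
  then show ?thesis by (simp add: jac_y_def vec_eq_iff)
qed

section \<open>Convergence of formal solutions of analytic equations in one variable\<close>

definition fvanish :: "nat \<Rightarrow> 'a::comm_ring_1 fps \<Rightarrow> bool" where
  "fvanish N f \<longleftrightarrow> (\<forall>n<N. fps_nth f n = 0)"

lemma fvanish_0 [simp]: "fvanish N 0" by (simp add: fvanish_def)
lemma fvanish_add: "fvanish N f \<Longrightarrow> fvanish N g \<Longrightarrow> fvanish N (f + g)" by (simp add: fvanish_def)
lemma fvanish_diff: "fvanish N f \<Longrightarrow> fvanish N g \<Longrightarrow> fvanish N (f - g)" by (simp add: fvanish_def)
lemma fvanish_mono: "fvanish N f \<Longrightarrow> M \<le> N \<Longrightarrow> fvanish M f" by (simp add: fvanish_def)
lemma fvanish_sum: "(\<And>x. x \<in> A \<Longrightarrow> fvanish N (f x)) \<Longrightarrow> fvanish N (sum f A)"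
  by (induction A rule: infinite_finite_induct) (auto intro: fvanish_add)
lemma fvanish_mult: "fvanish N f \<Longrightarrow> fvanish M g \<Longrightarrow> fvanish (N + M) (f * g)"
  unfolding fvanish_def fps_mult_nth
proof (intro allI impI sum.neutral ballI)
  fix n i assume *: "\<forall>n<N. fps_nth f n = 0" "\<forall>n<M. fps_nth g n = 0" "n < N + M" "i \<in> {0..n}"
  then have "i < N \<or> n - i < M" by auto
  then show "fps_nth f i * fps_nth g (n - i) = 0" using * by auto
qed
lemma fvanish_zero [simp]: "fvanish 0 f" by (simp add: fvanish_def)
lemma fvanish_mult_left: "fvanish N g \<Longrightarrow> fvanish N (f * g)" using fvanish_mult[of 0 f N g] by simp
lemma fvanish_mult_right: "fvanish N f \<Longrightarrow> fvanish N (f * g)" using fvanish_mult[of N f 0 g] by simp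
lemma fvanish_X_power: "fvanish N (fps_X ^ N)" by (simp add: fvanish_def)
lemma fvanish_shift: "fvanish N f \<Longrightarrow> fps_X ^ N * fps_shift N f = f"
  by (auto simp: fvanish_def fps_eq_iff fps_X_power_mult_nth)

lemma fvanish_power: "fvanish 1 w \<Longrightarrow> fvanish n (w ^ n)"
  by (induction n) (auto simp: fvanish_mult[of 1 _ _, simplified])

lemma fvanish_prod: "(\<And>x. x \<in> A \<Longrightarrow> fvanish (k x) (f x)) \<Longrightarrow> fvanish (sum k A) (prod f A)"
  by (induction A rule: infinite_finite_induct) (auto simp: fvanish_mult)

lemma fvanish_mon: "(\<And>j. fvanish 1 (u j)) \<Longrightarrow> fvanish (mdeg \<alpha>) (mon u \<alpha>)"
  unfolding mon_def by (intro fvanish_prod fvanish_power) auto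

lemma exp_induct [case_names zero inc]:
  fixes \<alpha> :: "'v::finite \<Rightarrow> nat"
  assumes "P (\<lambda>_. 0)" "\<And>i \<beta>. P \<beta> \<Longrightarrow> P (inc_exp i \<beta>)"
  shows "P \<alpha>"
proof (induction "mdeg \<alpha>" arbitrary: \<alpha>)
  case 0
  then have "\<alpha> = (\<lambda>_. 0)" by (auto simp: fun_eq_iff)
  then show ?case using assms(1) by simp
next
  case (Suc n)
  have "\<exists>i. \<alpha> i \<noteq> 0" using Suc(2) by (metis nat.distinct(1) sum.neutral)
  then obtain i where i: "\<alpha> i \<noteq> 0" by blast
  define \<beta> where "\<beta> = \<alpha>(i := \<alpha> i - 1)"
  have eq: "inc_exp i \<beta> = \<alpha>" using i by (auto simp: \<beta>_def)
  have "Suc (mdeg \<beta>) = mdeg \<alpha>" using mdeg_inc_exp[where j = i and \<alpha> = \<beta>] unfolding eq by simp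
  then show ?case using Suc(1)[of \<beta>] Suc(2) assms(2)[of \<beta> i] eq by simp
qed

lemma fvanish_mon_diff:
  assumes "\<And>j. fvanish N (u j - v j)"
  shows "fvanish N (mon u \<alpha> - mon v \<alpha>)"
proof (induction \<alpha> rule: exp_induct)
  case (inc i \<beta>)
  have *: "mon u (inc_exp i \<beta>) - mon v (inc_exp i \<beta>) = u i * (mon u \<beta> - mon v \<beta>) + (u i - v i) * mon v \<beta>"
    by (simp only: mon_inc_exp) (simp add: algebra_simps)
  show ?case unfolding * by (intro fvanish_add fvanish_mult_left fvanish_mult_right inc assms)
qed simp

text \<open>The weighted l1 norm of the coefficients, cut off at degree N so that it makes sense
  before convergence is known. It is submultiplicative, and a bound uniform in N means convergence
  at radius \<open>\<rho>\<close>.\<close>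

definition wnorm :: "nat \<Rightarrow> real \<Rightarrow> complex fps \<Rightarrow> real" where
  "wnorm N \<rho> f = (\<Sum>n\<le>N. norm (fps_nth f n) * \<rho> ^ n)"

context
  fixes \<rho> :: real assumes \<rho>: "\<rho> \<ge> 0"
begin

lemma wnorm_nonneg [simp]: "0 \<le> wnorm N \<rho> f"
  using \<rho> by (auto simp: wnorm_def intro!: sum_nonneg)

lemma wnorm_add: "wnorm N \<rho> (f + g) \<le> wnorm N \<rho> f + wnorm N \<rho> g"
  unfolding wnorm_def sum.distrib[symmetric] distrib_right[symmetric] using \<rho>
  by (intro sum_mono mult_right_mono) (auto simp: norm_triangle_ineq)

lemma wnorm_sum: "wnorm N \<rho> (sum f A) \<le> (\<Sum>x\<in>A. wnorm N \<rho> (f x))"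
proof (induction A rule: infinite_finite_induct)
  case (insert x F)
  then show ?case using wnorm_add[of N "f x" "sum f F"] by simp
qed (auto simp: wnorm_def)

lemma wnorm_mult: "wnorm N \<rho> (f * g) \<le> wnorm N \<rho> f * wnorm N \<rho> g"
proof -
  let ?a = "\<lambda>n. norm (fps_nth f n) * \<rho> ^ n" and ?b = "\<lambda>n. norm (fps_nth g n) * \<rho> ^ n"
  have "wnorm N \<rho> (f * g) \<le> (\<Sum>n\<le>N. \<Sum>i\<le>n. ?a i * ?b (n - i))"
    unfolding wnorm_def
  proof (rule sum_mono)
    fix n assume "n \<in> {..N}"
    have "norm (fps_nth (f * g) n) * \<rho> ^ n \<le> (\<Sum>i=0..n. norm (fps_nth f i) * norm (fps_nth g (n - i))) * \<rho> ^ n"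
      unfolding fps_mult_nth using \<rho> by (intro mult_right_mono order.trans[OF norm_sum]) (auto simp: norm_mult)
    also have "\<dots> = (\<Sum>i\<le>n. ?a i * ?b (n - i))"
      unfolding sum_distrib_right atLeast0AtMost
    proof (rule sum.cong)
      fix i assume "i \<in> {..n}"
      then have "\<rho> ^ n = \<rho> ^ i * \<rho> ^ (n - i)" by (simp flip: power_add)
      then show "norm (fps_nth f i) * norm (fps_nth g (n - i)) * \<rho> ^ n = ?a i * ?b (n - i)" by simp
    qed simp
    finally show "norm (fps_nth (f * g) n) * \<rho> ^ n \<le> (\<Sum>i\<le>n. ?a i * ?b (n - i))" .
  qed
  also have "\<dots> = (\<Sum>(i, j)\<in>{(i, j). i + j \<le> N}. ?a i * ?b j)"
    by (rule sum.triangle_reindex_eq[symmetric])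
  also have "\<dots> \<le> (\<Sum>(i, j)\<in>{..N} \<times> {..N}. ?a i * ?b j)"
    using \<rho> by (intro sum_mono2) auto
  also have "\<dots> = wnorm N \<rho> f * wnorm N \<rho> g"
    by (simp add: wnorm_def sum_product sum.cartesian_product)
  finally show ?thesis .
qed

lemma wnorm_X_power_mult: "wnorm N \<rho> (fps_X ^ k * f) \<le> \<rho> ^ k * wnorm N \<rho> f"
proof -
  have "wnorm N \<rho> (fps_X ^ k :: complex fps) \<le> \<rho> ^ k"
  proof -
    have "wnorm N \<rho> (fps_X ^ k :: complex fps) = (\<Sum>n\<le>N. if n = k then \<rho> ^ k else 0)"
      unfolding wnorm_def by (intro sum.cong) auto
    then show ?thesis using \<rho> by simp
  qed
  from mult_right_mono[OF this wnorm_nonneg[of N f]] show ?thesis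
    by (rule order.trans[OF wnorm_mult])
qed

text \<open>Multiplication by the variable shifts the cutoff: level N + 1 on the left needs only
  level N on the right. This drives the induction in the fixed point argument.\<close>

lemma wnorm_Suc_X_mult: "wnorm (Suc N) \<rho> (fps_X * f) = \<rho> * wnorm N \<rho> f"
  unfolding wnorm_def sum.atMost_Suc_shift sum_distrib_left by (simp add: mult_ac)

lemma wnorm_const_mult: "wnorm N \<rho> (fps_const c * f) = norm c * wnorm N \<rho> f"
  by (simp add: wnorm_def sum_distrib_left norm_mult mult_ac)

lemma wnorm_mono_index: "N \<le> M \<Longrightarrow> wnorm N \<rho> f \<le> wnorm M \<rho> f"
  unfolding wnorm_def using \<rho> by (intro sum_mono2) auto

lemma wnorm_mono_radius: "\<rho> \<le> \<rho>' \<Longrightarrow> wnorm N \<rho> f \<le> wnorm N \<rho>' f"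
  unfolding wnorm_def using \<rho> by (intro sum_mono mult_left_mono power_mono) auto

text \<open>An analogue of the Schwarz lemma: a zero constant term gains the ratio of the
  radii.\<close>

lemma wnorm_zero_const:
  assumes "\<rho> \<le> \<rho>'" "\<rho>' > 0" "fps_nth f 0 = 0"
  shows "wnorm N \<rho> f \<le> \<rho> / \<rho>' * wnorm N \<rho>' f"
  unfolding wnorm_def sum_distrib_left
proof (rule sum_mono)
  fix n assume "n \<in> {..N}"
  show "norm (fps_nth f n) * \<rho> ^ n \<le> \<rho> / \<rho>' * (norm (fps_nth f n) * \<rho>' ^ n)"
  proof (cases n)
    case (Suc m)
    have "\<rho> ^ n \<le> \<rho> * \<rho>' ^ m" using assms \<rho> Suc by (simp add: mult_left_mono power_mono)
    also have "\<dots> = \<rho> / \<rho>' * \<rho>' ^ n" using assms Suc by simp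
    finally have "norm (fps_nth f n) * \<rho> ^ n \<le> norm (fps_nth f n) * (\<rho> / \<rho>' * \<rho>' ^ n)"
      by (rule mult_left_mono) simp
    then show ?thesis by (simp only: mult.left_commute)
  qed (simp add: assms)
qed

lemma wnorm_mon:
  assumes "\<And>j. wnorm N \<rho> (u j) \<le> \<eta>"
  shows "wnorm N \<rho> (mon u \<alpha>) \<le> \<eta> ^ mdeg \<alpha>"
proof (induction \<alpha> rule: exp_induct)
  case zero
  have "wnorm N \<rho> 1 = (\<Sum>n\<le>N. if n = 0 then 1 else 0)"
    unfolding wnorm_def by (intro sum.cong) auto
  then show ?case by simp
next
  case (inc i \<beta>)
  have "wnorm N \<rho> (u i * mon u \<beta>) \<le> \<eta> * \<eta> ^ mdeg \<beta>"
    by (rule order.trans[OF wnorm_mult]) (rule mult_mono[OF assms inc order.trans[OF wnorm_nonneg assms[of i]] wnorm_nonneg])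
  then show ?case by (simp only: mon_inc_exp mdeg_inc_exp power_Suc)
qed

end

definition bounded_wnorm :: "real \<Rightarrow> complex fps \<Rightarrow> bool" where
  "bounded_wnorm \<rho> f \<longleftrightarrow> (\<exists>K. \<forall>N. wnorm N \<rho> f \<le> K)"

lemma bounded_wnorm_add:
  assumes "\<rho> \<ge> 0" "bounded_wnorm \<rho> f" "bounded_wnorm \<rho> g"
  shows "bounded_wnorm \<rho> (f + g)"
proof -
  obtain K L where "\<And>N. wnorm N \<rho> f \<le> K" "\<And>N. wnorm N \<rho> g \<le> L" using assms by (auto simp: bounded_wnorm_def)
  then have "wnorm N \<rho> (f + g) \<le> K + L" for N
    by (intro order.trans[OF wnorm_add[OF assms(1)]] add_mono)
  then show ?thesis by (auto simp: bounded_wnorm_def)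
qed

lemma bounded_wnorm_mult:
  assumes "\<rho> \<ge> 0" "bounded_wnorm \<rho> f" "bounded_wnorm \<rho> g"
  shows "bounded_wnorm \<rho> (f * g)"
proof -
  obtain K L where *: "\<And>N. wnorm N \<rho> f \<le> K" "\<And>N. wnorm N \<rho> g \<le> L" using assms by (auto simp: bounded_wnorm_def)
  have "wnorm N \<rho> (f * g) \<le> K * L" for N
    by (rule order.trans[OF wnorm_mult[OF assms(1)]])
      (rule mult_mono[OF * order.trans[OF wnorm_nonneg[OF assms(1)] *(1)] wnorm_nonneg[OF assms(1)]])
  then show ?thesis by (auto simp: bounded_wnorm_def)
qed

lemma bounded_wnorm_poly:
  assumes "\<rho> \<ge> 0" "\<And>n. n > d \<Longrightarrow> fps_nth f n = 0"
  shows "bounded_wnorm \<rho> f"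
proof -
  have "wnorm N \<rho> f \<le> wnorm d \<rho> f" for N
  proof (cases "N \<le> d")
    case True then show ?thesis using wnorm_mono_index[OF assms(1)] by blast
  next
    case False
    then have "wnorm N \<rho> f = wnorm d \<rho> f"
      unfolding wnorm_def using assms by (intro sum.mono_neutral_right) auto
    then show ?thesis by simp
  qed
  then show ?thesis by (auto simp: bounded_wnorm_def)
qed

lemma bounded_wnorm_sum:
  assumes "\<rho> \<ge> 0" "\<And>x. x \<in> A \<Longrightarrow> bounded_wnorm \<rho> (f x)"
  shows "bounded_wnorm \<rho> (sum f A)"
  using assms(2)
proof (induction A rule: infinite_finite_induct)
  case (insert x F)
  then show ?case by (simp add: bounded_wnorm_add[OF assms(1)])
qed (use bounded_wnorm_poly[OF assms(1), of 0 0] in auto)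

lemma bounded_wnorm_shift:
  assumes "\<rho> > 0" "bounded_wnorm \<rho> f"
  shows "bounded_wnorm \<rho> (fps_shift k f)"
proof -
  obtain K where K: "\<And>N. wnorm N \<rho> f \<le> K" using assms by (auto simp: bounded_wnorm_def)
  have "wnorm N \<rho> (fps_shift k f) \<le> K / \<rho> ^ k" for N
  proof -
    have "wnorm N \<rho> (fps_shift k f) * \<rho> ^ k = (\<Sum>n\<le>N. norm (fps_nth f (n + k)) * \<rho> ^ (n + k))"
      by (simp add: wnorm_def sum_distrib_left sum_distrib_right power_add mult_ac)
    also have "\<dots> = (\<Sum>n\<in>(\<lambda>n. n + k) ` {..N}. norm (fps_nth f n) * \<rho> ^ n)"
      by (simp add: sum.reindex)
    also have "\<dots> \<le> wnorm (N + k) \<rho> f"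
      unfolding wnorm_def using assms(1) by (intro sum_mono2) auto
    finally show ?thesis using K[of "N + k"] assms(1) by (simp add: field_simps)
  qed
  then show ?thesis by (auto simp: bounded_wnorm_def)
qed

section \<open>Substitution of one-variable series and its second order expansion\<close>

definition fpsum :: "nat \<Rightarrow> (('v::finite \<Rightarrow> nat) \<Rightarrow> complex) \<Rightarrow> ('v \<Rightarrow> complex fps) \<Rightarrow> complex fps" where
  "fpsum N F u = (\<Sum>\<alpha>\<in>{\<alpha>. mdeg \<alpha> \<le> N}. fps_const (F \<alpha>) * mon u \<alpha>)"

definition fpsubst :: "(('v::finite \<Rightarrow> nat) \<Rightarrow> complex) \<Rightarrow> ('v \<Rightarrow> complex fps) \<Rightarrow> complex fps" where
  "fpsubst F u = Abs_fps (\<lambda>n. fps_nth (fpsum n F u) n)"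

lemma fpsubst_approx:
  assumes u: "\<And>j. fvanish 1 (u j)"
  shows "fvanish (Suc N) (fpsubst F u - fpsum N F u)"
  unfolding fvanish_def
proof (intro allI impI)
  fix n assume n: "n < Suc N"
  have "fpsum N F u - fpsum n F u = (\<Sum>\<alpha>\<in>{\<alpha>. mdeg \<alpha> \<le> N} - {\<alpha>. mdeg \<alpha> \<le> n}. fps_const (F \<alpha>) * mon u \<alpha>)"
    unfolding fpsum_def using n by (subst sum_diff) auto
  also have "fvanish (Suc n) \<dots>"
    by (intro fvanish_sum fvanish_mult_left fvanish_mono[OF fvanish_mon[OF u]]) auto
  finally show "fps_nth (fpsubst F u - fpsum N F u) n = 0" by (simp add: fvanish_def fpsubst_def)
qed

lemma fpsubst_cong_vanish:
  assumes u: "\<And>j. fvanish 1 (u j)" "\<And>j. fvanish 1 (v j)" and uv: "\<And>j. fvanish N (u j - v j)"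
  shows "fvanish N (fpsubst F u - fpsubst F v)"
proof -
  have a: "fvanish N (fpsum N F u - fpsum N F v)"
    unfolding fpsum_def sum_subtractf[symmetric] right_diff_distrib[symmetric]
    by (intro fvanish_sum fvanish_mult_left fvanish_mon_diff uv)
  have b: "fvanish N (fpsubst F u - fpsum N F u)" "fvanish N (fpsubst F v - fpsum N F v)"
    by (rule fvanish_mono[OF fpsubst_approx], rule u, simp)+
  from fvanish_add[OF fvanish_diff[OF b] a] show ?thesis by simp
qed

text \<open>The derivative of the monomial with exponent \<open>\<alpha>\<close> at \<open>v\<close>
  in the direction \<open>z\<close>.\<close>

definition mon_linear :: "('v::finite \<Rightarrow> 'a::comm_ring_1) \<Rightarrow> ('v \<Rightarrow> 'a) \<Rightarrow> ('v \<Rightarrow> nat) \<Rightarrow> 'a" where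
  "mon_linear v z \<alpha> = (\<Sum>j\<in>UNIV. of_nat (\<alpha> j) * mon v (\<alpha>(j := \<alpha> j - 1)) * z j)"

lemma mon_linear_inc: "mon_linear v z (inc_exp i \<beta>) = v i * mon_linear v z \<beta> + mon v \<beta> * z i"
proof -
  have "of_nat ((inc_exp i \<beta>) j) * mon v ((inc_exp i \<beta>)(j := (inc_exp i \<beta>) j - 1)) * z j =
      v i * (of_nat (\<beta> j) * mon v (\<beta>(j := \<beta> j - 1)) * z j) + (if j = i then mon v \<beta> * z i else 0)" for j
  proof (cases "j = i")
    case True
    have "of_nat (\<beta> i) * mon v \<beta> = v i * (of_nat (\<beta> i) * mon v (\<beta>(i := \<beta> i - 1)))"
    proof (cases "\<beta> i")
      case (Suc m)
      then have "inc_exp i (\<beta>(i := \<beta> i - 1)) = \<beta>" by auto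
      then show ?thesis using mon_inc_exp[of v "\<beta>(i := \<beta> i - 1)" i] by (simp add: mult.left_commute)
    qed simp
    then show ?thesis using True by (simp add: algebra_simps)
  next
    case False
    show ?thesis
    proof (cases "\<beta> j")
      case (Suc m)
      have "(inc_exp i \<beta>)(j := (inc_exp i \<beta>) j - 1) = inc_exp i (\<beta>(j := \<beta> j - 1))" using False by auto
      then have "mon v ((inc_exp i \<beta>)(j := (inc_exp i \<beta>) j - 1)) = v i * mon v (\<beta>(j := \<beta> j - 1))"
        by (simp only: mon_inc_exp)
      then show ?thesis using False by (simp add: mult_ac)
    qed (use False in simp)
  qed
  then show ?thesis by (simp add: mon_linear_def sum.distrib sum_distrib_left)
qed

text \<open>Taylor expansion of a monomial with an explicit quadratic remainder. The estimates stand
  inside the existential quantifier because one remainder must serve all cutoffs and radii. The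
  hypothesis on \<open>\<eta>\<close> bounds both \<open>v\<close> and
  \<open>v + X^s z\<close>.\<close>

lemma mon_taylor2:
  fixes v z :: "'v::finite \<Rightarrow> complex fps" and s :: nat
  shows "\<exists>r. mon (\<lambda>j. v j + fps_X ^ s * z j) \<alpha> = mon v \<alpha> + fps_X ^ s * mon_linear v z \<alpha> + fps_X ^ (2 * s) * r \<and>
    (\<forall>N \<rho> \<eta>. 0 \<le> \<rho> \<longrightarrow> 0 < \<eta> \<longrightarrow> (\<forall>j. wnorm N \<rho> (v j) + \<rho> ^ s \<le> \<eta>) \<longrightarrow> (\<forall>j. wnorm N \<rho> (z j) \<le> 1) \<longrightarrow>
      wnorm N \<rho> (mon_linear v z \<alpha>) \<le> real (mdeg \<alpha>) * \<eta> ^ mdeg \<alpha> / \<eta> \<and>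
      wnorm N \<rho> r \<le> real (mdeg \<alpha>) ^ 2 * \<eta> ^ mdeg \<alpha> / \<eta>\<^sup>2)"
proof (induction \<alpha> rule: exp_induct)
  case zero
  have "mon_linear v z (\<lambda>_. 0) = 0" by (simp add: mon_linear_def)
  then show ?case by (intro exI[of _ 0]) (simp add: wnorm_def)
next
  case (inc i \<beta>)
  then obtain r where r: "mon (\<lambda>j. v j + fps_X ^ s * z j) \<beta> = mon v \<beta> + fps_X ^ s * mon_linear v z \<beta> + fps_X ^ (2 * s) * r"
    and bd: "\<And>N \<rho> \<eta>. 0 \<le> \<rho> \<Longrightarrow> 0 < \<eta> \<Longrightarrow> (\<forall>j. wnorm N \<rho> (v j) + \<rho> ^ s \<le> \<eta>) \<Longrightarrow> (\<forall>j. wnorm N \<rho> (z j) \<le> 1) \<Longrightarrow>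
      wnorm N \<rho> (mon_linear v z \<beta>) \<le> real (mdeg \<beta>) * \<eta> ^ mdeg \<beta> / \<eta> \<and>
      wnorm N \<rho> r \<le> real (mdeg \<beta>) ^ 2 * \<eta> ^ mdeg \<beta> / \<eta>\<^sup>2" by blast
  define n where "n = mdeg \<beta>"
  define L where "L = mon_linear v z \<beta>"
  \<comment> \<open>The second order part of the expansion multiplied by one more factor
    \<open>v i + X^s z i\<close>. For the estimate, n + n^2 is at most (n + 1)^2.\<close>
  define r' where "r' = z i * L + (v i + fps_X ^ s * z i) * r"
  have "mon (\<lambda>j. v j + fps_X ^ s * z j) (inc_exp i \<beta>) =
      mon v (inc_exp i \<beta>) + fps_X ^ s * mon_linear v z (inc_exp i \<beta>) + fps_X ^ (2 * s) * r'"
  proof -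
    define a where "a = (fps_X ^ s :: complex fps)"
    have a2: "fps_X ^ (2 * s) = a * a" unfolding a_def mult_2 power_add ..
    show ?thesis
      unfolding mon_inc_exp mon_linear_inc r r'_def L_def
      unfolding a2 a_def[symmetric]
      by (simp add: algebra_simps)
  qed
  moreover have "wnorm N \<rho> (mon_linear v z (inc_exp i \<beta>)) \<le> real (mdeg (inc_exp i \<beta>)) * \<eta> ^ mdeg (inc_exp i \<beta>) / \<eta> \<and>
      wnorm N \<rho> r' \<le> real (mdeg (inc_exp i \<beta>)) ^ 2 * \<eta> ^ mdeg (inc_exp i \<beta>) / \<eta>\<^sup>2"
    if \<rho>: "0 \<le> \<rho>" and \<eta>: "0 < \<eta>" and v: "\<forall>j. wnorm N \<rho> (v j) + \<rho> ^ s \<le> \<eta>" and z: "\<forall>j. wnorm N \<rho> (z j) \<le> 1" for N \<rho> \<eta>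
  proof
    note w = wnorm_nonneg[OF \<rho>] wnorm_mult[OF \<rho>] wnorm_add[OF \<rho>]
    have L: "wnorm N \<rho> L \<le> real n * \<eta> ^ n / \<eta>" and rb: "wnorm N \<rho> r \<le> real n ^ 2 * \<eta> ^ n / \<eta>\<^sup>2"
      using bd[OF \<rho> \<eta> v z] by (simp_all add: n_def L_def)
    have vi: "wnorm N \<rho> (v j) \<le> \<eta>" for j using v \<rho> by (smt (verit) zero_le_power)
    have "wnorm N \<rho> (mon_linear v z (inc_exp i \<beta>)) \<le> wnorm N \<rho> (v i * L) + wnorm N \<rho> (mon v \<beta> * z i)"
      unfolding mon_linear_inc L_def by (rule w)
    also have "\<dots> \<le> wnorm N \<rho> (v i) * wnorm N \<rho> L + wnorm N \<rho> (mon v \<beta>) * wnorm N \<rho> (z i)"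
      by (intro add_mono w)
    also have "\<dots> \<le> \<eta> * (real n * \<eta> ^ n / \<eta>) + \<eta> ^ n * 1"
      using wnorm_mon[OF \<rho> vi, where \<alpha> = \<beta>] \<eta> L z vi by (intro add_mono mult_mono) (auto simp: w n_def)
    also have "\<dots> = real (Suc n) * \<eta> ^ Suc n / \<eta>" using \<eta> by (simp add: field_simps)
    finally show "wnorm N \<rho> (mon_linear v z (inc_exp i \<beta>)) \<le> real (mdeg (inc_exp i \<beta>)) * \<eta> ^ mdeg (inc_exp i \<beta>) / \<eta>"
      by (simp only: mdeg_inc_exp n_def)
    have "wnorm N \<rho> (fps_X ^ s * z i) \<le> \<rho> ^ s * 1"
      by (rule order.trans[OF wnorm_X_power_mult[OF \<rho>]]) (use z \<rho> in \<open>intro mult_left_mono, auto\<close>)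
    then have vz: "wnorm N \<rho> (v i + fps_X ^ s * z i) \<le> \<eta>"
      using w(3)[of N "v i" "fps_X ^ s * z i"] v by (smt (verit))
    have "wnorm N \<rho> r' \<le> wnorm N \<rho> (z i * L) + wnorm N \<rho> ((v i + fps_X ^ s * z i) * r)"
      unfolding r'_def by (rule w)
    also have "\<dots> \<le> wnorm N \<rho> (z i) * wnorm N \<rho> L + wnorm N \<rho> (v i + fps_X ^ s * z i) * wnorm N \<rho> r"
      by (intro add_mono w)
    also have "\<dots> \<le> 1 * (real n * \<eta> ^ n / \<eta>) + \<eta> * (real n ^ 2 * \<eta> ^ n / \<eta>\<^sup>2)"
      using \<eta> L z vz rb by (intro add_mono mult_mono) (auto simp: w)
    also have "\<dots> = (real n + real n ^ 2) * (\<eta> ^ Suc n / \<eta>\<^sup>2)" using \<eta> by (simp add: field_simps power2_eq_square)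
    also have "\<dots> \<le> real (Suc n) ^ 2 * (\<eta> ^ Suc n / \<eta>\<^sup>2)"
      using \<eta> by (intro mult_right_mono) (auto simp: power2_eq_square algebra_simps)
    finally show "wnorm N \<rho> r' \<le> real (mdeg (inc_exp i \<beta>)) ^ 2 * \<eta> ^ mdeg (inc_exp i \<beta>) / \<eta>\<^sup>2"
      by (simp only: mdeg_inc_exp n_def times_divide_eq_right)
  qed
  ultimately show ?case by blast
qed

lemma fpsum_linear:
  "(\<Sum>\<alpha>\<in>{\<alpha>. mdeg \<alpha> \<le> Suc M}. fps_const (F \<alpha>) * mon_linear v z \<alpha>) = (\<Sum>j\<in>UNIV. fpsum M (pd j F) v * z j)"
proof -
  have "(\<Sum>\<alpha>\<in>{\<alpha>. mdeg \<alpha> \<le> Suc M}. fps_const (F \<alpha>) * mon_linear v z \<alpha>) =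
     (\<Sum>j\<in>UNIV. \<Sum>\<alpha>\<in>{\<alpha>. mdeg \<alpha> \<le> Suc M}. fps_const (F \<alpha>) * (of_nat (\<alpha> j) * mon v (\<alpha>(j := \<alpha> j - 1)) * z j))"
    unfolding mon_linear_def sum_distrib_left by (rule sum.swap)
  also have "\<dots> = (\<Sum>j\<in>UNIV. fpsum M (pd j F) v * z j)"
  proof (intro sum.cong refl)
    fix j
    have "(\<Sum>\<alpha>\<in>{\<alpha>. mdeg \<alpha> \<le> Suc M}. fps_const (F \<alpha>) * (of_nat (\<alpha> j) * mon v (\<alpha>(j := \<alpha> j - 1)) * z j))
      = (\<Sum>\<alpha>\<in>{\<alpha>. mdeg \<alpha> \<le> Suc M \<and> \<alpha> j \<noteq> 0}. fps_const (F \<alpha>) * (of_nat (\<alpha> j) * mon v (\<alpha>(j := \<alpha> j - 1)) * z j))"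
      by (rule sum.mono_neutral_right) auto
    also have "\<dots> = (\<Sum>\<alpha>\<in>{\<alpha>. mdeg \<alpha> \<le> M}. fps_const (pd j F \<alpha>) * mon v \<alpha> * z j)"
    proof (rule sum.reindex_bij_witness[of _ "inc_exp j" "\<lambda>\<alpha>. \<alpha>(j := \<alpha> j - 1)"])
      fix \<alpha> assume \<alpha>: "\<alpha> \<in> {\<alpha>. mdeg \<alpha> \<le> Suc M \<and> \<alpha> j \<noteq> 0}"
      then have i: "inc_exp j (\<alpha>(j := \<alpha> j - 1)) = \<alpha>" by auto
      show "inc_exp j (\<alpha>(j := \<alpha> j - 1)) = \<alpha>" by (rule i)
      have "Suc (mdeg (\<alpha>(j := \<alpha> j - 1))) = mdeg \<alpha>"
        using mdeg_inc_exp[where j = j and \<alpha> = "\<alpha>(j := \<alpha> j - 1)"] unfolding i by simp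
      then show "\<alpha>(j := \<alpha> j - 1) \<in> {\<alpha>. mdeg \<alpha> \<le> M}" using \<alpha> by auto
      have "pd j F (\<alpha>(j := \<alpha> j - 1)) = of_nat (\<alpha> j) * F \<alpha>"
        unfolding pd_def i using \<alpha> by auto
      then show "fps_const (pd j F (\<alpha>(j := \<alpha> j - 1))) * mon v (\<alpha>(j := \<alpha> j - 1)) * z j =
          fps_const (F \<alpha>) * (of_nat (\<alpha> j) * mon v (\<alpha>(j := \<alpha> j - 1)) * z j)"
        by (simp add: fps_of_nat[symmetric] ac_simps flip: fps_const_mult)
    next
      fix \<alpha> :: "'a \<Rightarrow> nat" assume "\<alpha> \<in> {\<alpha>. mdeg \<alpha> \<le> M}"
      then show "inc_exp j \<alpha> \<in> {\<alpha>. mdeg \<alpha> \<le> Suc M \<and> \<alpha> j \<noteq> 0}"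
        using mdeg_inc_exp[where j = j and \<alpha> = \<alpha>] by (simp del: mdeg_inc_exp)
    qed auto
    finally show "(\<Sum>\<alpha>\<in>{\<alpha>. mdeg \<alpha> \<le> Suc M}. fps_const (F \<alpha>) * (of_nat (\<alpha> j) * mon v (\<alpha>(j := \<alpha> j - 1)) * z j))
      = fpsum M (pd j F) v * z j"
      by (simp add: fpsum_def sum_distrib_right)
  qed
  finally show ?thesis .
qed

text \<open>The weight 4 to the power \<open>mdeg \<alpha>\<close> is reserved for the factor
  \<open>(mdeg \<alpha>)^2\<close> in the quadratic remainder of \<open>mon_taylor2\<close>.\<close>

lemma sum_geometric_mdeg_bound:
  fixes F :: "('v::finite \<Rightarrow> nat) \<Rightarrow> complex"
  assumes "convergent_ps F"
  shows "\<exists>\<eta> K. \<eta> > 0 \<and> (\<forall>\<eta>' N. 0 \<le> \<eta>' \<longrightarrow> \<eta>' \<le> \<eta> \<longrightarrow>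
    (\<Sum>\<alpha>\<in>{\<alpha>. mdeg \<alpha> \<le> N}. norm (F \<alpha>) * (4 ^ mdeg \<alpha> * \<eta>' ^ mdeg \<alpha>)) \<le> K)"
proof -
  obtain C R where CR: "C \<ge> 0" "R \<ge> 1" "\<And>\<alpha>. norm (F \<alpha>) \<le> C * R ^ mdeg \<alpha>"
    using assms by (auto simp: convergent_ps_def)
  \<comment> \<open>Makes the common ratio \<open>4 * R * \<eta>\<close> equal to one half.\<close>
  define \<eta> where "\<eta> = 1 / (8 * R)"
  have \<eta>: "\<eta> > 0" "4 * R * \<eta> = 1 / 2" using CR by (auto simp: \<eta>_def)
  define K where "K = (\<Sum>\<^sub>\<infinity>\<alpha>::'v \<Rightarrow> nat. C * (1 / 2) ^ mdeg \<alpha> :: real)"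
  have summ: "(\<lambda>\<alpha>::'v \<Rightarrow> nat. C * (1 / 2 :: real) ^ mdeg \<alpha>) summable_on UNIV"
    by (intro summable_on_cmult_right summable_on_mdeg_geometric) auto
  have b: "(\<Sum>\<alpha>\<in>{\<alpha>. mdeg \<alpha> \<le> N}. norm (F \<alpha>) * (4 ^ mdeg \<alpha> * \<eta>' ^ mdeg \<alpha>)) \<le> K" if "0 \<le> \<eta>'" "\<eta>' \<le> \<eta>" for N \<eta>'
  proof -
    have "(\<Sum>\<alpha>\<in>{\<alpha>. mdeg \<alpha> \<le> N}. norm (F \<alpha>) * (4 ^ mdeg \<alpha> * \<eta>' ^ mdeg \<alpha>)) \<le> (\<Sum>\<alpha>\<in>{\<alpha>::'v \<Rightarrow> nat. mdeg \<alpha> \<le> N}. C * (1 / 2) ^ mdeg \<alpha>)"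
    proof (rule sum_mono)
      fix \<alpha>
      have "norm (F \<alpha>) * (4 ^ mdeg \<alpha> * \<eta>' ^ mdeg \<alpha>) \<le> C * R ^ mdeg \<alpha> * (4 ^ mdeg \<alpha> * \<eta> ^ mdeg \<alpha>)"
        using CR that \<eta> by (intro mult_mono power_mono) auto
      also have "\<dots> = C * (4 * R * \<eta>) ^ mdeg \<alpha>" by (simp add: power_mult_distrib mult_ac)
      finally show "norm (F \<alpha>) * (4 ^ mdeg \<alpha> * \<eta>' ^ mdeg \<alpha>) \<le> C * (1 / 2) ^ mdeg \<alpha>" using \<eta> by simp
    qed
    also have "\<dots> \<le> K"
      unfolding K_def by (rule finite_sum_le_infsum[OF summ]) (use CR in auto)
    finally show ?thesis .
  qed
  show ?thesis by (intro exI[of _ \<eta>] exI[of _ K] conjI allI impI) (use \<eta> b in auto)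
qed

lemma fps_to_fls_prod: "fps_to_fls (prod f A) = (\<Prod>x\<in>A. fps_to_fls (f x))"
  by (induction A rule: infinite_finite_induct) (auto simp: fls_times_fps_to_fls)

lemma fps_to_fls_det:
  fixes A :: "complex fps^'n^'n"
  shows "fps_to_fls (det A) = det (mmap fps_to_fls A)"
  by (simp add: det_def fps_to_fls_sum fls_times_fps_to_fls fps_to_fls_of_int fps_to_fls_prod)

text \<open>The matrix is invertible over Laurent series; a power of the variable that clears all
  poles of the inverse gives \<open>P\<close>.\<close>

lemma exists_inverse_up_to_X_power:
  fixes J :: "complex fps^'n^'n"
  assumes "det J \<noteq> 0"
  obtains k and P :: "complex fps^'n^'n" where "P ** J = (\<chi> i j. if i = j then fps_X ^ k else 0)"
proof -
  have "det (mmap fps_to_fls J) \<noteq> 0" using assms by (simp flip: fps_to_fls_det)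
  then obtain Y where Y: "Y ** mmap fps_to_fls J = mat 1"
    using invertible_det_nz[of "mmap fps_to_fls J"] by (auto simp: invertible_def)
  define k where "k = Max (range (\<lambda>(i, j). nat (- fls_subdegree (Y $ i $ j))))"
  have k: "nat (- fls_subdegree (Y $ i $ j)) \<le> k" for i j
    unfolding k_def by (rule Max_ge) (auto intro: image_eqI[of _ _ "(i, j)"])
  define P where "P = (\<chi> i j. fls_regpart (fls_X ^ k * Y $ i $ j))"
  have P: "fps_to_fls (P $ i $ j) = fls_X ^ k * Y $ i $ j" for i j
  proof (cases "Y $ i $ j = 0")
    case False
    have "fls_subdegree (fls_X ^ k * Y $ i $ j) \<ge> 0"
      using False k[of i j] by (simp add: fls_X_power_times_conv_shift)
    then show ?thesis by (simp add: P_def)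
  qed (simp add: P_def)
  have "(P ** J) $ i $ j = (if i = j then fps_X ^ k else 0)" for i j
  proof -
    have "fps_to_fls ((P ** J) $ i $ j) = (\<Sum>m\<in>UNIV. fls_X ^ k * Y $ i $ m * fps_to_fls (J $ m $ j))"
      by (simp add: matrix_matrix_mult_def fps_to_fls_sum fls_times_fps_to_fls P)
    also have "\<dots> = fls_X ^ k * (Y ** mmap fps_to_fls J) $ i $ j"
      by (simp add: matrix_matrix_mult_def sum_distrib_left mult.assoc)
    also have "\<dots> = fps_to_fls (if i = j then fps_X ^ k else 0)"
      by (simp add: Y mat_def fps_to_fls_power)
    finally show ?thesis by (simp only: fps_to_fls_eq_iff)
  qed
  then show ?thesis using that[of P k] by (simp add: vec_eq_iff)
qed

lemma uniform_bound:
  fixes f :: "'n::finite \<Rightarrow> nat \<Rightarrow> real"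
  assumes "\<And>m. \<exists>K. \<forall>N. f m N \<le> K"
  shows "\<exists>K\<ge>0. \<forall>m N. f m N \<le> K"
proof -
  obtain L where L: "\<And>m N. f m N \<le> L m" using assms by metis
  have "f m N \<le> (\<Sum>m\<in>UNIV. \<bar>L m\<bar>)" for m N
    using L[of m N] member_le_sum[of m UNIV "\<lambda>m. \<bar>L m\<bar>"] by fastforce
  then show ?thesis by (intro exI[of _ "\<Sum>m\<in>UNIV. \<bar>L m\<bar>"] conjI) (auto intro: sum_nonneg)
qed

lemma bounded_wnorm_fpsubst:
  assumes \<rho>: "\<rho> \<ge> 0" and v: "\<And>j. fvanish 1 (v j)" "\<And>N j. wnorm N \<rho> (v j) \<le> \<eta>"
    and K: "\<And>N. (\<Sum>\<alpha>\<in>{\<alpha>. mdeg \<alpha> \<le> N}. norm (F \<alpha>) * (4 ^ mdeg \<alpha> * \<eta> ^ mdeg \<alpha>)) \<le> K"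
  shows "bounded_wnorm \<rho> (fpsubst F v)"
proof -
  have \<eta>: "\<eta> \<ge> 0" using v(2) wnorm_nonneg[OF \<rho>] order_trans by blast
  have "wnorm N \<rho> (fpsubst F v) \<le> K" for N
  proof -
    have "fvanish (Suc N) (fpsubst F v - fpsum N F v)" by (rule fpsubst_approx) (rule v)
    then have "wnorm N \<rho> (fpsubst F v) = wnorm N \<rho> (fpsum N F v)"
      unfolding wnorm_def by (intro sum.cong refl) (auto simp: fvanish_def)
    also have "\<dots> \<le> (\<Sum>\<alpha>\<in>{\<alpha>. mdeg \<alpha> \<le> N}. wnorm N \<rho> (fps_const (F \<alpha>) * mon v \<alpha>))"
      unfolding fpsum_def by (rule wnorm_sum[OF \<rho>])
    also have "\<dots> \<le> (\<Sum>\<alpha>\<in>{\<alpha>. mdeg \<alpha> \<le> N}. norm (F \<alpha>) * (4 ^ mdeg \<alpha> * \<eta> ^ mdeg \<alpha>))"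
    proof (rule sum_mono)
      fix \<alpha>
      have "wnorm N \<rho> (mon v \<alpha>) \<le> 1 * \<eta> ^ mdeg \<alpha>" using wnorm_mon[OF \<rho> v(2)] by simp
      also have "\<dots> \<le> 4 ^ mdeg \<alpha> * \<eta> ^ mdeg \<alpha>" using \<eta> by (intro mult_right_mono) auto
      finally show "wnorm N \<rho> (fps_const (F \<alpha>) * mon v \<alpha>) \<le> norm (F \<alpha>) * (4 ^ mdeg \<alpha> * \<eta> ^ mdeg \<alpha>)"
        unfolding wnorm_const_mult[OF \<rho>] by (rule mult_left_mono) simp
    qed
    finally show ?thesis using K[of N] by linarith
  qed
  then show ?thesis by (auto simp: bounded_wnorm_def)
qed

text \<open>Writing \<open>U = v + t\<^sup>s z\<close> with a polynomial \<open>v\<close> of large degree turns the equations into a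
  fixed point equation \<open>z = - b - t W(z)\<close>; the factor \<open>t\<close> makes the partial sums of the
  norm of \<open>z\<close> stay below 1 once the radius is small.\<close>

theorem formal_implicit_function_convergent:
  fixes G :: "'l::finite \<Rightarrow> ('l option option \<Rightarrow> nat) \<Rightarrow> complex" and U :: "'l option option \<Rightarrow> complex fps"
  assumes U: "\<And>j. fvanish 1 (U j)"
    and poly: "\<And>n. n > 1 \<Longrightarrow> fps_nth (U None) n = 0" "\<And>n. n > 1 \<Longrightarrow> fps_nth (U (Some None)) n = 0"
    and conv: "\<And>i. convergent_ps (G i)" and zero: "\<And>i. fpsubst (G i) U = 0"
    and det: "det (\<chi> i j. fpsubst (pd (yvar j) (G i)) U) \<noteq> 0"
  shows "\<exists>\<rho>>0. \<forall>j. bounded_wnorm \<rho> (U j)"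
proof -
  obtain k and P :: "complex fps^'l^'l" where P: "P ** (\<chi> i j. fpsubst (pd (yvar j) (G i)) U) = (\<chi> i j. if i = j then fps_X ^ k else 0)"
    using exists_inverse_up_to_X_power[OF det] by blast
  have PJ: "(\<Sum>m\<in>UNIV. P $ i $ m * fpsubst (pd (yvar j) (G m)) U) = (if i = j then fps_X ^ k else 0)" for i j
    using arg_cong[OF P, of "\<lambda>A. A $ i $ j"] by (simp add: matrix_matrix_mult_def)
  \<comment> \<open>The inverse Jacobian costs \<open>X^k\<close>, and the quadratic term carries
    \<open>X^(2s) = X^(s+k) X\<close>; after division by \<open>X^(s+k)\<close> one factor
    \<open>X\<close> remains.\<close>
  define s where "s = k + 1"
  \<comment> \<open>The cutoff keeps degree \<open>s\<close> as well, so that \<open>z\<close> has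
    zero constant term.\<close>
  define v where "v j = fps_cutoff (Suc s) (U j)" for j
  define z where "z j = fps_shift s (U j - v j)" for j
  have van: "fvanish (Suc s) (U j - v j)" for j by (simp add: fvanish_def v_def)
  have Uv: "U j = v j + fps_X ^ s * z j" for j
    using fvanish_shift[OF fvanish_mono[OF van[of j], of s]] by (simp add: z_def)
  have z0: "fvanish 1 (z j)" for j using van[of j] by (simp add: fvanish_def z_def)
  have v1: "fvanish 1 (v j)" for j using U[of j] by (simp add: fvanish_def v_def)
  have vpoly: "fps_nth (v j) n = 0" if "n > s" for j n using that by (simp add: v_def)
  \<comment> \<open>The x-components have degree at most 1, which is at most \<open>s\<close>; they
    belong to \<open>v\<close> entirely and are not unknowns.\<close>
  have zx: "z None = 0" "z (Some None) = 0"
    using poly by (auto simp: fps_eq_iff z_def v_def s_def)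
  define Jv where "Jv i j = fpsubst (pd (yvar j) (G i)) v" for i j
  \<comment> \<open>A polynomial truncation of \<open>P\<close>, since nothing bounds the norms of
    \<open>P\<close> itself. It still inverts the Jacobian along \<open>v\<close> up to an error
    \<open>E\<close> of order \<open>k + 1\<close>.\<close>
  define P' where "P' i m = fps_cutoff (Suc k) (P $ i $ m)" for i m
  define E where "E i j = (\<Sum>m\<in>UNIV. P' i m * Jv m j) - (if i = j then fps_X ^ k else 0)" for i j
  have E: "fvanish (Suc k) (E i j)" for i j
  proof -
    have "E i j = (\<Sum>m\<in>UNIV. P' i m * (Jv m j - fpsubst (pd (yvar j) (G m)) U)
        + (P' i m - P $ i $ m) * fpsubst (pd (yvar j) (G m)) U)"
      unfolding E_def PJ[symmetric] by (simp add: algebra_simps sum.distrib sum_subtractf)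
    also have "fvanish (Suc k) \<dots>"
    proof (rule fvanish_sum)
      fix m
      have "fvanish (Suc s) (v j - U j)" for j using van[of j] by (simp add: fvanish_def)
      then have "fvanish (Suc s) (Jv m j - fpsubst (pd (yvar j) (G m)) U)"
        unfolding Jv_def by (intro fpsubst_cong_vanish v1 U)
      then have 1: "fvanish (Suc k) (Jv m j - fpsubst (pd (yvar j) (G m)) U)"
        by (rule fvanish_mono) (simp add: s_def)
      have 2: "fvanish (Suc k) (P' i m - P $ i $ m)" by (simp add: fvanish_def P'_def)
      show "fvanish (Suc k) (P' i m * (Jv m j - fpsubst (pd (yvar j) (G m)) U)
        + (P' i m - P $ i $ m) * fpsubst (pd (yvar j) (G m)) U)"
        by (rule fvanish_add[OF fvanish_mult_left[OF 1] fvanish_mult_right[OF 2]])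
    qed
    finally show ?thesis .
  qed
  define Y where "Y i j = fps_shift (Suc k) (E i j)" for i j
  have PJv: "(\<Sum>m\<in>UNIV. P' i m * Jv m j) = (if i = j then fps_X ^ k else 0) + fps_X ^ Suc k * Y i j" for i j
    using fvanish_shift[OF E[of i j]] by (simp add: Y_def E_def del: power_Suc)
  have "\<forall>\<alpha>. \<exists>r. mon (\<lambda>j. v j + fps_X ^ s * z j) \<alpha> = mon v \<alpha> + fps_X ^ s * mon_linear v z \<alpha> + fps_X ^ (2 * s) * r \<and>
    (\<forall>N \<rho> \<eta>. 0 \<le> \<rho> \<longrightarrow> 0 < \<eta> \<longrightarrow> (\<forall>j. wnorm N \<rho> (v j) + \<rho> ^ s \<le> \<eta>) \<longrightarrow> (\<forall>j. wnorm N \<rho> (z j) \<le> 1) \<longrightarrow>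
      wnorm N \<rho> (mon_linear v z \<alpha>) \<le> real (mdeg \<alpha>) * \<eta> ^ mdeg \<alpha> / \<eta> \<and>
      wnorm N \<rho> r \<le> real (mdeg \<alpha>) ^ 2 * \<eta> ^ mdeg \<alpha> / \<eta>\<^sup>2)"
    by (rule allI) (rule mon_taylor2)
  from choice[OF this] obtain r where r': "\<forall>\<alpha>. mon (\<lambda>j. v j + fps_X ^ s * z j) \<alpha> = mon v \<alpha> + fps_X ^ s * mon_linear v z \<alpha> + fps_X ^ (2 * s) * r \<alpha> \<and>
    (\<forall>N \<rho> \<eta>. 0 \<le> \<rho> \<longrightarrow> 0 < \<eta> \<longrightarrow> (\<forall>j. wnorm N \<rho> (v j) + \<rho> ^ s \<le> \<eta>) \<longrightarrow> (\<forall>j. wnorm N \<rho> (z j) \<le> 1) \<longrightarrow>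
      wnorm N \<rho> (mon_linear v z \<alpha>) \<le> real (mdeg \<alpha>) * \<eta> ^ mdeg \<alpha> / \<eta> \<and>
      wnorm N \<rho> (r \<alpha>) \<le> real (mdeg \<alpha>) ^ 2 * \<eta> ^ mdeg \<alpha> / \<eta>\<^sup>2)" ..
  have Ueq: "(\<lambda>j. v j + fps_X ^ s * z j) = U" by (rule ext) (rule Uv[symmetric])
  have r: "mon U \<alpha> = mon v \<alpha> + fps_X ^ s * mon_linear v z \<alpha> + fps_X ^ (2 * s) * r \<alpha>" for \<alpha>
    using r'[THEN spec, THEN conjunct1] unfolding Ueq .
  have r_bound: "wnorm N \<rho> (r \<alpha>) \<le> real (mdeg \<alpha>) ^ 2 * \<eta> ^ mdeg \<alpha> / \<eta>\<^sup>2"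
    if "0 \<le> \<rho>" "0 < \<eta>" "\<And>j. wnorm N \<rho> (v j) + \<rho> ^ s \<le> \<eta>" "\<And>j. wnorm N \<rho> (z j) \<le> 1" for \<alpha> N \<rho> \<eta>
    by (rule r'[THEN spec, THEN conjunct2, rule_format, THEN conjunct2]) (use that in auto)
  \<comment> \<open>The quadratic remainder, truncated in degree so that every sum is finite; the
    resulting equation holds modulo \<open>X^(M+1)\<close>.\<close>
  define Q where "Q M i = (\<Sum>\<alpha>\<in>{\<alpha>. mdeg \<alpha> \<le> M}. fps_const (G i \<alpha>) * r \<alpha>)" for M i
  have A: "fvanish (Suc M) (fpsubst (G i) v + fps_X ^ s * (\<Sum>j\<in>UNIV. Jv i j * z (yvar j)) + fps_X ^ (2 * s) * Q (Suc M) i)" for M i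
  proof -
    have "fpsum (Suc M) (G i) U = fpsum (Suc M) (G i) v
        + fps_X ^ s * (\<Sum>\<alpha>\<in>{\<alpha>. mdeg \<alpha> \<le> Suc M}. fps_const (G i \<alpha>) * mon_linear v z \<alpha>) + fps_X ^ (2 * s) * Q (Suc M) i"
      unfolding fpsum_def Q_def sum_distrib_left sum.distrib[symmetric]
      by (intro sum.cong refl) (simp only: r, simp only: distrib_left mult.left_commute)
    also have "(\<Sum>\<alpha>\<in>{\<alpha>. mdeg \<alpha> \<le> Suc M}. fps_const (G i \<alpha>) * mon_linear v z \<alpha>)
        = (\<Sum>j\<in>UNIV. fpsum M (pd (yvar j) (G i)) v * z (yvar j))"
      unfolding fpsum_linear by (simp add: sum_vars zx)
    finally have eq: "fpsubst (G i) v + fps_X ^ s * (\<Sum>j\<in>UNIV. Jv i j * z (yvar j)) + fps_X ^ (2 * s) * Q (Suc M) i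
      = (fpsubst (G i) v - fpsum (Suc M) (G i) v) - (fpsubst (G i) U - fpsum (Suc M) (G i) U)
        + fps_X ^ s * (\<Sum>j\<in>UNIV. (Jv i j - fpsum M (pd (yvar j) (G i)) v) * z (yvar j))"
      by (simp add: zero left_diff_distrib sum_subtractf right_diff_distrib)
    have a: "fvanish (Suc M) (fpsubst (G i) w - fpsum (Suc M) (G i) w)" if "\<And>j. fvanish 1 (w j)" for w
      by (rule fvanish_mono[OF fpsubst_approx]) (use that in auto)
    have b: "fvanish (Suc M) (Jv i j - fpsum M (pd (yvar j) (G i)) v)" for j
      unfolding Jv_def by (rule fpsubst_approx) (rule v1)
    show ?thesis
      unfolding eq
      by (rule fvanish_add[OF fvanish_diff[OF a a]], rule v1, rule U)
        (rule fvanish_mult_left, rule fvanish_sum, rule fvanish_mult_right, rule b)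
  qed
  define B where "B m = (\<Sum>i\<in>UNIV. P' m i * fpsubst (G i) v)" for m
  define W where "W M m = (\<Sum>j\<in>UNIV. Y m j * z (yvar j)) + (\<Sum>i\<in>UNIV. P' m i * Q (Suc M) i)" for M m
  \<comment> \<open>Multiplying by \<open>P'\<close> replaces the Jacobian by \<open>X^k\<close> up
    to terms with an extra factor \<open>X\<close>; these, together with the quadratic part, form
    \<open>W\<close>.\<close>
  have BW: "fvanish (Suc M) (B m + fps_X ^ (s + k) * (z (yvar m) + fps_X * W M m))" for M m
  proof -
    have x2: "fps_X ^ (2 * s) = (fps_X ^ s * (fps_X ^ k * fps_X) :: complex fps)"
      unfolding mult_2 power_add by (simp add: s_def mult_ac)
    have gen: "(\<Sum>i\<in>UNIV. p i * (a i + x * b i + y * c i)) = (\<Sum>i\<in>UNIV. p i * a i) + x * (\<Sum>i\<in>UNIV. p i * b i) + y * (\<Sum>i\<in>UNIV. p i * c i)"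
      for p a b c :: "'l \<Rightarrow> complex fps" and x y
      by (simp add: sum_distrib_left distrib_left sum.distrib mult.left_commute)
    have "fvanish (Suc M) (\<Sum>i\<in>UNIV. P' m i * (fpsubst (G i) v + fps_X ^ s * (\<Sum>j\<in>UNIV. Jv i j * z (yvar j)) + fps_X ^ (2 * s) * Q (Suc M) i))"
      by (intro fvanish_sum fvanish_mult_left A)
    also have "(\<Sum>i\<in>UNIV. P' m i * (fpsubst (G i) v + fps_X ^ s * (\<Sum>j\<in>UNIV. Jv i j * z (yvar j)) + fps_X ^ (2 * s) * Q (Suc M) i))
      = B m + fps_X ^ s * (\<Sum>i\<in>UNIV. P' m i * (\<Sum>j\<in>UNIV. Jv i j * z (yvar j))) + fps_X ^ (2 * s) * (\<Sum>i\<in>UNIV. P' m i * Q (Suc M) i)"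
      unfolding B_def by (rule gen)
    also have "(\<Sum>i\<in>UNIV. P' m i * (\<Sum>j\<in>UNIV. Jv i j * z (yvar j))) = (\<Sum>j\<in>UNIV. (\<Sum>i\<in>UNIV. P' m i * Jv i j) * z (yvar j))"
      unfolding sum_distrib_left sum_distrib_right by (subst sum.swap) (simp only: mult.assoc)
    also have "\<dots> = fps_X ^ k * z (yvar m) + fps_X ^ Suc k * (\<Sum>j\<in>UNIV. Y m j * z (yvar j))"
    proof -
      have "(\<Sum>j\<in>UNIV. (if m = j then fps_X ^ k else 0) * z (yvar j)) = (\<Sum>j\<in>UNIV. if j = m then fps_X ^ k * z (yvar j) else 0)"
        by (intro sum.cong) auto
      then show ?thesis
        unfolding PJv distrib_right sum.distrib sum_distrib_left by (simp add: mult.assoc)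
    qed
    finally show ?thesis
      unfolding x2 by (simp add: W_def s_def power_add algebra_simps)
  qed
  define b where "b m = fps_shift (s + k) (B m)" for m
  \<comment> \<open>No separate estimate is needed: modulo \<open>X^(s+k+1)\<close> the rest of the
    equation vanishes, because \<open>z\<close> has zero constant term, so \<open>B\<close> vanishes
    too and can be divided by \<open>X^(s+k)\<close>.\<close>
  have B_van: "fvanish (Suc (s + k)) (B m)" for m
  proof -
    have "fvanish (s + k + 1) (fps_X ^ (s + k) * (z (yvar m) + fps_X * W (s + k) m))"
    proof (intro fvanish_mult fvanish_X_power fvanish_add z0)
      show "fvanish 1 (fps_X * W (s + k) m)" by (simp add: fvanish_def)
    qed
    from fvanish_diff[OF BW[of "s + k" m] this[unfolded Suc_eq_plus1[symmetric]]] show ?thesis by simp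
  qed
  have Bb: "B m = fps_X ^ (s + k) * b m" for m
    using fvanish_shift[OF fvanish_mono[OF B_van[of m], of "s + k"]] by (simp add: b_def)
  have b0: "fps_nth (b m) 0 = 0" for m using B_van[of m] by (simp add: b_def fvanish_def)
  have fixpoint: "fvanish (Suc N) (z (yvar m) + (b m + fps_X * W (s + k + N) m))" for N m
  proof -
    have "fvanish (Suc (s + k + N)) (fps_X ^ (s + k) * (z (yvar m) + (b m + fps_X * W (s + k + N) m)))"
      using BW[of "s + k + N" m] unfolding Bb by (simp add: algebra_simps)
    then show ?thesis
      unfolding fvanish_def
    proof (intro allI impI)
      fix n assume *: "\<forall>n<Suc (s + k + N). fps_nth (fps_X ^ (s + k) * (z (yvar m) + (b m + fps_X * W (s + k + N) m))) n = 0" "n < Suc N"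
      then have "fps_nth (fps_X ^ (s + k) * (z (yvar m) + (b m + fps_X * W (s + k + N) m))) (n + (s + k)) = 0" by simp
      then show "fps_nth (z (yvar m) + (b m + fps_X * W (s + k + N) m)) n = 0"
        by (simp only: fps_X_power_mult_nth) simp
    qed
  qed
  define bnd where "bnd F e K \<longleftrightarrow> e > 0 \<and> (\<forall>\<eta>' N. 0 \<le> \<eta>' \<longrightarrow> \<eta>' \<le> e \<longrightarrow>
      (\<Sum>\<alpha>\<in>{\<alpha>. mdeg \<alpha> \<le> N}. norm (F \<alpha>) * (4 ^ mdeg \<alpha> * \<eta>' ^ mdeg \<alpha>)) \<le> K)"
    for F :: "('l option option \<Rightarrow> nat) \<Rightarrow> complex" and e K :: real
  have ex: "\<exists>e K. bnd F e K" if "convergent_ps F" for F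
    unfolding bnd_def by (rule sum_geometric_mdeg_bound[OF that])
  have "\<forall>i. \<exists>e K. bnd (G i) e K" using ex[OF conv] by blast
  then obtain \<eta>1 K1 where g1': "\<And>i. bnd (G i) (\<eta>1 i) (K1 i)" by metis
  have "\<forall>p. \<exists>e K. bnd (pd (yvar (snd p)) (G (fst p))) e K" using ex[OF convergent_ps_pd[OF conv]] by blast
  then obtain \<eta>2 K2 where g2': "\<And>p. bnd (pd (yvar (snd p)) (G (fst p))) (\<eta>2 p) (K2 p)" by metis
  have g1: "\<eta>1 i > 0" "0 \<le> \<eta>' \<Longrightarrow> \<eta>' \<le> \<eta>1 i \<Longrightarrow>
      (\<Sum>\<alpha>\<in>{\<alpha>. mdeg \<alpha> \<le> N}. norm (G i \<alpha>) * (4 ^ mdeg \<alpha> * \<eta>' ^ mdeg \<alpha>)) \<le> K1 i" for i \<eta>' N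
    using g1'[of i] by (auto simp: bnd_def)
  have g2: "\<eta>2 p > 0" "0 \<le> \<eta>' \<Longrightarrow> \<eta>' \<le> \<eta>2 p \<Longrightarrow>
      (\<Sum>\<alpha>\<in>{\<alpha>. mdeg \<alpha> \<le> N}. norm (pd (yvar (snd p)) (G (fst p)) \<alpha>) * (4 ^ mdeg \<alpha> * \<eta>' ^ mdeg \<alpha>)) \<le> K2 p" for p \<eta>' N
    using g2'[of p] by (auto simp: bnd_def)
  define \<eta> where "\<eta> = Min (range \<eta>1 \<union> range \<eta>2)"
  have \<eta>: "\<eta> > 0" "\<eta> \<le> \<eta>1 i" "\<eta> \<le> \<eta>2 p" for i p
    using g1(1) g2(1) by (auto simp: \<eta>_def)
  have "\<exists>K. \<forall>N. wnorm N 1 (v j) \<le> K" for j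
    using bounded_wnorm_poly[of 1 s "v j"] vpoly by (auto simp: bounded_wnorm_def)
  then have "\<exists>K\<ge>0. \<forall>j N. wnorm N 1 (v j) \<le> K" by (rule uniform_bound)
  then obtain V where V: "V \<ge> 0" "\<And>j N. wnorm N 1 (v j) \<le> V" by blast
  \<comment> \<open>As \<open>v\<close> has zero constant term, its norm at radius
    \<open>\<rho>\<close> is at most \<open>\<rho> * V\<close>, and
    \<open>\<rho> ^ s \<le> \<rho>\<close>; the sum stays below \<open>\<eta>\<close> once
    \<open>\<rho> * (V + 1) \<le> \<eta>\<close>.\<close>
  define \<rho>0 where "\<rho>0 = min 1 (\<eta> / (V + 1))"
  have \<rho>0: "0 < \<rho>0" "\<rho>0 \<le> 1" "\<rho>0 * (V + 1) \<le> \<eta>"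
  proof -
    show "0 < \<rho>0" "\<rho>0 \<le> 1" using \<eta>(1) V(1) by (simp_all add: \<rho>0_def)
    have "\<rho>0 \<le> \<eta> / (V + 1)" by (simp add: \<rho>0_def)
    then show "\<rho>0 * (V + 1) \<le> \<eta>" by (subst (asm) pos_le_divide_eq) (use V(1) in auto)
  qed
  have v_bound: "wnorm N \<rho> (v j) + \<rho> ^ s \<le> \<eta>" if "0 \<le> \<rho>" "\<rho> \<le> \<rho>0" for N \<rho> j
  proof -
    have "wnorm N \<rho> (v j) \<le> \<rho> / 1 * wnorm N 1 (v j)"
      by (rule wnorm_zero_const) (use that \<rho>0 v1 in \<open>auto simp: fvanish_def\<close>)
    also have "\<dots> \<le> \<rho> * V" using that V by (simp add: mult_left_mono)
    finally have 1: "wnorm N \<rho> (v j) \<le> \<rho> * V" .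
    have "\<rho> ^ s \<le> \<rho> ^ 1" using that \<rho>0 by (intro power_decreasing) (auto simp: s_def)
    then have "wnorm N \<rho> (v j) + \<rho> ^ s \<le> \<rho> * (V + 1)" using 1 by (simp add: algebra_simps)
    also have "\<dots> \<le> \<rho>0 * (V + 1)" using that V by (intro mult_right_mono) auto
    finally show ?thesis using \<rho>0(3) by linarith
  qed
  have v_le: "wnorm N \<rho>0 (v j) \<le> \<eta>" for N j
    using v_bound[of \<rho>0 N j] \<rho>0 zero_le_power[of \<rho>0 s] by linarith
  have \<rho>0': "\<rho>0 \<ge> 0" using \<rho>0 by simp
  have bG: "bounded_wnorm \<rho>0 (fpsubst (G i) v)" for i
    by (rule bounded_wnorm_fpsubst[OF \<rho>0' v1 v_le g1(2)]) (use \<eta> in \<open>auto intro: less_imp_le\<close>)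
  have bJ: "bounded_wnorm \<rho>0 (Jv i j)" for i j
    unfolding Jv_def using g2(2)[of \<eta> "(i, j)"] \<eta>
    by (intro bounded_wnorm_fpsubst[OF \<rho>0' v1 v_le]) (auto intro: less_imp_le)
  have bP: "bounded_wnorm \<rho>0 (P' i j)" for i j
    by (rule bounded_wnorm_poly[OF \<rho>0', of "Suc k"]) (simp add: P'_def)
  have bb: "bounded_wnorm \<rho>0 (b m)" for m
    unfolding b_def B_def by (intro bounded_wnorm_shift bounded_wnorm_sum bounded_wnorm_mult bP bG \<rho>0 \<rho>0')
  have bY: "bounded_wnorm \<rho>0 (Y i j)" for i j
  proof -
    have bX: "bounded_wnorm \<rho>0 (if i = j then - (fps_X ^ k) else 0)"
      by (rule bounded_wnorm_poly[OF \<rho>0', of k]) auto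
    have "E i j = (\<Sum>m\<in>UNIV. P' i m * Jv m j) + (if i = j then - (fps_X ^ k) else 0)" by (simp add: E_def)
    then have "bounded_wnorm \<rho>0 (E i j)"
      by (simp only:) (intro bounded_wnorm_add bounded_wnorm_sum bounded_wnorm_mult bP bJ \<rho>0' bX)
    then show ?thesis unfolding Y_def by (rule bounded_wnorm_shift[OF \<rho>0(1)])
  qed
  have "\<exists>K\<ge>0. \<forall>m N. wnorm N \<rho>0 (b m) \<le> K"
    by (rule uniform_bound) (rule bb[unfolded bounded_wnorm_def])
  then obtain Kb where Kb: "Kb \<ge> 0" "\<And>m N. wnorm N \<rho>0 (b m) \<le> Kb"
    by blast
  have "\<exists>K\<ge>0. \<forall>p N. wnorm N \<rho>0 (Y (fst p) (snd p)) \<le> K"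
    by (rule uniform_bound) (rule bY[unfolded bounded_wnorm_def])
  then obtain KY where KY: "KY \<ge> 0" "\<And>p N. wnorm N \<rho>0 (Y (fst p) (snd p)) \<le> KY"
    by blast
  have "\<exists>K\<ge>0. \<forall>p N. wnorm N \<rho>0 (P' (fst p) (snd p)) \<le> K"
    by (rule uniform_bound) (rule bP[unfolded bounded_wnorm_def])
  then obtain KP where KP: "KP \<ge> 0" "\<And>p N. wnorm N \<rho>0 (P' (fst p) (snd p)) \<le> KP"
    by blast
  \<comment> \<open>Bounds the quadratic remainder as long as \<open>z\<close> has norm at most 1;
    the factor \<open>(mdeg \<alpha>)^2\<close> is absorbed by the weight with base 4.\<close>
  define KQ where "KQ = (\<Sum>i\<in>UNIV. \<bar>K1 i\<bar>) / \<eta>\<^sup>2"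
  have KQ: "KQ \<ge> 0" by (simp add: KQ_def sum_nonneg)
  have Q_bound: "wnorm N \<rho> (Q M i) \<le> KQ"
    if \<rho>: "0 \<le> \<rho>" "\<rho> \<le> \<rho>0" and z: "\<And>j. wnorm N \<rho> (z j) \<le> 1" for N \<rho> M i
  proof -
    have "wnorm N \<rho> (Q M i) \<le> (\<Sum>\<alpha>\<in>{\<alpha>. mdeg \<alpha> \<le> M}. wnorm N \<rho> (fps_const (G i \<alpha>) * r \<alpha>))"
      unfolding Q_def by (rule wnorm_sum[OF \<rho>(1)])
    also have "\<dots> \<le> (\<Sum>\<alpha>\<in>{\<alpha>. mdeg \<alpha> \<le> M}. norm (G i \<alpha>) * (4 ^ mdeg \<alpha> * \<eta> ^ mdeg \<alpha>) / \<eta>\<^sup>2)"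
    proof (rule sum_mono)
      fix \<alpha> :: "'l option option \<Rightarrow> nat"
      let ?n = "mdeg \<alpha>"
      have "real ?n \<le> 2 ^ ?n" using less_imp_le[OF of_nat_less_two_power[of ?n]] .
      then have "real ?n ^ 2 \<le> (2 ^ ?n) ^ 2" by (rule power_mono[OF _ of_nat_0_le_iff])
      also have "(2 ^ ?n) ^ 2 = (4::real) ^ ?n" by (simp add: power2_eq_square flip: power_mult_distrib)
      finally have n4: "real ?n ^ 2 \<le> 4 ^ ?n" .
      have "wnorm N \<rho> (r \<alpha>) \<le> real ?n ^ 2 * \<eta> ^ ?n / \<eta>\<^sup>2"
        by (rule r_bound[OF \<rho>(1) \<eta>(1) v_bound[OF \<rho>] z])
      also have "\<dots> \<le> 4 ^ ?n * \<eta> ^ ?n / \<eta>\<^sup>2"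
        using n4 \<eta>(1) by (intro divide_right_mono mult_right_mono) auto
      finally show "wnorm N \<rho> (fps_const (G i \<alpha>) * r \<alpha>) \<le> norm (G i \<alpha>) * (4 ^ ?n * \<eta> ^ ?n) / \<eta>\<^sup>2"
        unfolding wnorm_const_mult[OF \<rho>(1)] times_divide_eq_right[symmetric] by (rule mult_left_mono) simp
    qed
    also have "\<dots> \<le> K1 i / \<eta>\<^sup>2"
      unfolding sum_divide_distrib[symmetric] using g1(2)[of \<eta> i M] \<eta> by (intro divide_right_mono) (auto intro: less_imp_le)
    also have "\<dots> \<le> KQ"
      unfolding KQ_def using member_le_sum[of i UNIV "\<lambda>i. \<bar>K1 i\<bar>"] by (intro divide_right_mono) fastforce+
    finally show ?thesis .
  qed
  define c where "c = real CARD('l)"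
  \<comment> \<open>The right-hand side of the fixed point equation has norm at most
    \<open>\<rho> * D\<close> at radius \<open>\<rho>\<close>: \<open>b\<close> contributes by its
    zero constant term, \<open>W\<close> by the factor \<open>X\<close>.\<close>
  define D where "D = Kb / \<rho>0 + (c * KY + c * (KP * KQ)) + 1"
  have D: "D > 0" using Kb KY KP KQ \<rho>0 by (simp add: D_def c_def add_nonneg_pos)
  define \<rho> where "\<rho> = min \<rho>0 (1 / D)"
  have \<rho>: "0 < \<rho>" "\<rho> \<le> \<rho>0" "\<rho> * D \<le> 1"
  proof -
    show "0 < \<rho>" "\<rho> \<le> \<rho>0" using \<rho>0 D by (simp_all add: \<rho>_def)
    have "\<rho> \<le> 1 / D" by (simp add: \<rho>_def)
    then show "\<rho> * D \<le> 1" by (subst (asm) pos_le_divide_eq[OF D])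
  qed
  have \<rho>': "\<rho> \<ge> 0" using \<rho> by simp
  \<comment> \<open>Induction on the cutoff. By the factor \<open>X\<close>, level N + 1 of
    \<open>z\<close> needs \<open>W\<close> only at level N, where the induction hypothesis bounds
    the \<open>z\<close> occurring in it.\<close>
  have z_bound: "\<forall>j. wnorm N \<rho> (z j) \<le> 1" for N
  proof (induction N)
    case 0
    then show ?case using z0 by (auto simp: wnorm_def fvanish_def)
  next
    case (Suc N)
    have "wnorm (Suc N) \<rho> (z (yvar m)) \<le> 1" for m
    proof -
      let ?W = "W (s + k + Suc N) m"
      have "wnorm (Suc N) \<rho> (z (yvar m)) = wnorm (Suc N) \<rho> (b m + fps_X * ?W)"
        unfolding wnorm_def
      proof (intro sum.cong refl)
        fix n assume "n \<in> {..Suc N}"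
        then have "fps_nth (z (yvar m)) n + fps_nth (b m + fps_X * ?W) n = 0"
          using fixpoint[of "Suc N" m] unfolding fvanish_def by (metis atMost_iff fps_add_nth less_Suc_eq_le)
        then have "fps_nth (z (yvar m)) n = - fps_nth (b m + fps_X * ?W) n" by (simp only: eq_neg_iff_add_eq_0)
        then show "norm (fps_nth (z (yvar m)) n) * \<rho> ^ n = norm (fps_nth (b m + fps_X * ?W) n) * \<rho> ^ n"
          by (simp only: norm_minus_cancel)
      qed
      also have "\<dots> \<le> wnorm (Suc N) \<rho> (b m) + wnorm (Suc N) \<rho> (fps_X * ?W)" by (rule wnorm_add[OF \<rho>'])
      also have "wnorm (Suc N) \<rho> (fps_X * ?W) = \<rho> * wnorm N \<rho> ?W" by (rule wnorm_Suc_X_mult[OF \<rho>'])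
      also have "wnorm (Suc N) \<rho> (b m) \<le> \<rho> / \<rho>0 * wnorm (Suc N) \<rho>0 (b m)"
        by (rule wnorm_zero_const[OF \<rho>' \<rho>(2) \<rho>0(1) b0])
      also have "\<dots> \<le> \<rho> / \<rho>0 * Kb" using \<rho> \<rho>0 Kb by (intro mult_left_mono) auto
      also have "wnorm N \<rho> ?W \<le> (\<Sum>j\<in>(UNIV::'l set). KY) + (\<Sum>i\<in>(UNIV::'l set). KP * KQ)"
      proof -
        have 1: "wnorm N \<rho> (\<Sum>j\<in>UNIV. Y m j * z (yvar j)) \<le> (\<Sum>j\<in>(UNIV::'l set). KY)"
        proof (rule order.trans[OF wnorm_sum[OF \<rho>']], rule sum_mono)
          fix j
          have "wnorm N \<rho> (Y m j * z (yvar j)) \<le> wnorm N \<rho> (Y m j) * wnorm N \<rho> (z (yvar j))" by (rule wnorm_mult[OF \<rho>'])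
          also have "\<dots> \<le> KY * 1"
            using order.trans[OF wnorm_mono_radius[OF \<rho>' \<rho>(2)] KY(2)[of N "(m, j)"]] Suc KY(1)
            by (intro mult_mono) (auto simp: wnorm_nonneg[OF \<rho>'])
          finally show "wnorm N \<rho> (Y m j * z (yvar j)) \<le> KY" by simp
        qed
        have 2: "wnorm N \<rho> (\<Sum>i\<in>UNIV. P' m i * Q (Suc (s + k + Suc N)) i) \<le> (\<Sum>i\<in>(UNIV::'l set). KP * KQ)"
        proof (rule order.trans[OF wnorm_sum[OF \<rho>']], rule sum_mono)
          fix i
          have "wnorm N \<rho> (P' m i * Q (Suc (s + k + Suc N)) i) \<le> wnorm N \<rho> (P' m i) * wnorm N \<rho> (Q (Suc (s + k + Suc N)) i)"
            by (rule wnorm_mult[OF \<rho>'])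
          also have "\<dots> \<le> KP * KQ"
            using order.trans[OF wnorm_mono_radius[OF \<rho>' \<rho>(2)] KP(2)[of N "(m, i)"]] Q_bound[OF \<rho>' \<rho>(2)] Suc KP(1)
            by (intro mult_mono) (auto simp: wnorm_nonneg[OF \<rho>'])
          finally show "wnorm N \<rho> (P' m i * Q (Suc (s + k + Suc N)) i) \<le> KP * KQ" .
        qed
        show ?thesis unfolding W_def by (rule order.trans[OF wnorm_add[OF \<rho>'] add_mono[OF 1 2]])
      qed
      finally have "wnorm (Suc N) \<rho> (z (yvar m)) \<le> \<rho> / \<rho>0 * Kb + \<rho> * (c * KY + c * (KP * KQ))"
        using \<rho>' by (simp add: c_def mult_left_mono)
      also have "\<dots> \<le> \<rho> * D" using \<rho> \<rho>0 by (simp add: D_def algebra_simps)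
      finally show ?thesis using \<rho>(3) by linarith
    qed
    then have "wnorm (Suc N) \<rho> (z j) \<le> 1" for j
      by (cases j rule: vars_cases) (auto simp: zx wnorm_def)
    then show ?case by blast
  qed
  have "bounded_wnorm \<rho> (U j)" for j
    unfolding Uv[of j]
  proof (intro bounded_wnorm_add bounded_wnorm_mult \<rho>')
    show "bounded_wnorm \<rho> (v j)" by (rule bounded_wnorm_poly[OF \<rho>' vpoly])
    show "bounded_wnorm \<rho> (fps_X ^ s)" by (rule bounded_wnorm_poly[OF \<rho>', of s]) auto
    show "bounded_wnorm \<rho> (z j)" using z_bound by (auto simp: bounded_wnorm_def)
  qed
  then show ?thesis using \<rho>(1) by blast
qed

section \<open>Convergence on lines\<close>

text \<open>The restriction of a series in two variables to the line $x_1 = t$, $x_2 = c t$.\<close>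

definition on_line :: "complex \<Rightarrow> fps2 \<Rightarrow> complex fps" where
  "on_line c w = Abs_fps (\<lambda>k. \<Sum>m\<le>k. coeff2 w (k - m) m * c ^ m)"

lemma on_line_nth: "fps_nth (on_line c w) k = (\<Sum>m\<le>k. coeff2 w (k - m) m * c ^ m)"
  by (simp add: on_line_def)

lemma on_line_add: "on_line c (v + w) = on_line c v + on_line c w"
  by (simp add: fps_eq_iff on_line_nth distrib_right sum.distrib)

lemma on_line_diff: "on_line c (v - w) = on_line c v - on_line c w"
  by (simp add: fps_eq_iff on_line_nth left_diff_distrib sum_subtractf)

lemma on_line_0 [simp]: "on_line c 0 = 0"
  by (simp add: fps_eq_iff on_line_nth)

lemma coeff2_cst: "coeff2 (cst a) n m = (if n = 0 \<and> m = 0 then a else 0)"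
  by (simp add: coeff2_def cst_def)

lemma on_line_cst: "on_line c (cst a) = fps_const a"
proof -
  have "(\<Sum>m\<le>k. coeff2 (cst a) (k - m) m * c ^ m) = (\<Sum>m\<le>k. if m = 0 then if k = 0 then a else 0 else 0)" for k
    by (intro sum.cong) (auto simp: coeff2_cst)
  then show ?thesis by (simp add: fps_eq_iff on_line_nth)
qed

lemma on_line_1 [simp]: "on_line c 1 = 1"
  using on_line_cst[of c 1] by simp

lemma on_line_mult: "on_line c (v * w) = on_line c v * on_line c w"
proof (rule fps_ext)
  fix k
  let ?f = "\<lambda>i j i' j'. coeff2 v i j * coeff2 w i' j' * c ^ (j + j')"
  have "fps_nth (on_line c v * on_line c w) k =
      (\<Sum>i\<in>{..k}. \<Sum>a\<in>{..i}. \<Sum>b\<in>{..k - i}. ?f (i - a) a (k - i - b) b)"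
    unfolding fps_mult_nth on_line_nth sum_product atLeast0AtMost
    by (intro sum.cong refl) (simp add: power_add)
  also have "\<dots> = (\<Sum>(i, a, b)\<in>Sigma {..k} (\<lambda>i. {..i} \<times> {..k - i}). ?f (i - a) a (k - i - b) b)"
    by (simp add: sum.Sigma sum.cartesian_product case_prod_unfold)
  also have "\<dots> = (\<Sum>(m, i, j)\<in>Sigma {..k} (\<lambda>m. {..k - m} \<times> {..m}). coeff2 v i j * coeff2 w (k - m - i) (m - j) * c ^ m)"
    by (rule sum.reindex_bij_witness[of _ "\<lambda>(m, i, j). (i + j, j, m - j)" "\<lambda>(i, a, b). (a + b, i - a, a)"])
      (auto simp: add.commute)
  also have "\<dots> = (\<Sum>m\<in>{..k}. \<Sum>i\<in>{..k - m}. \<Sum>j\<in>{..m}. coeff2 v i j * coeff2 w (k - m - i) (m - j) * c ^ m)"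
    by (simp add: sum.Sigma sum.cartesian_product case_prod_unfold)
  also have "\<dots> = fps_nth (on_line c (v * w)) k"
    unfolding on_line_nth coeff2_mult sum_distrib_right atLeast0AtMost
    by (intro sum.cong refl)
  finally show "fps_nth (on_line c (v * w)) k = fps_nth (on_line c v * on_line c w) k" ..
qed

lemma on_line_sum: "on_line c (sum f A) = (\<Sum>x\<in>A. on_line c (f x))"
  by (induction A rule: infinite_finite_induct) (auto simp: on_line_add)

lemma on_line_prod: "on_line c (prod f A) = (\<Prod>x\<in>A. on_line c (f x))"
  by (induction A rule: infinite_finite_induct) (auto simp: on_line_mult)

lemma on_line_power: "on_line c (w ^ n) = on_line c w ^ n"
  by (induction n) (auto simp: on_line_mult)

lemma on_line_mon: "on_line c (mon u \<alpha>) = mon (\<lambda>j. on_line c (u j)) \<alpha>"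
  by (simp add: mon_def on_line_prod on_line_power)

lemma on_line_of_int: "on_line c (of_int n) = of_int n"
proof -
  have "cst (of_int n) = of_int n" by (simp add: cst_def fps_of_int)
  then show ?thesis using on_line_cst[of c "of_int n"] by (simp add: fps_of_int)
qed

lemma on_line_det:
  fixes A :: "fps2^'n^'n"
  shows "on_line c (det A) = det (mmap (on_line c) A)"
  by (simp add: det_def on_line_sum on_line_mult on_line_of_int on_line_prod)

lemma fvanish_on_line: "vanish N w \<Longrightarrow> fvanish N (on_line c w)"
  by (auto simp: vanish_def fvanish_def on_line_nth intro!: sum.neutral)

lemma on_line_X1: "on_line c X1 = fps_X"
proof -
  have "(\<Sum>m\<le>k. coeff2 X1 (k - m) m * c ^ m) = (\<Sum>m\<le>k. if m = 0 then if k = 1 then 1 else 0 else 0)" for k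
    by (intro sum.cong) (auto simp: coeff2_def X1_def fps_X_nth)
  then show ?thesis by (auto simp: fps_eq_iff on_line_nth fps_X_nth)
qed

lemma on_line_X2: "on_line c X2 = fps_const c * fps_X"
proof -
  have "(\<Sum>m\<le>k. coeff2 X2 (k - m) m * c ^ m) = (\<Sum>m\<le>k. if m = 1 then if k = 1 then c else 0 else 0)" for k
    by (intro sum.cong) (auto simp: coeff2_def X2_def fps_X_nth)
  then show ?thesis by (auto simp: fps_eq_iff on_line_nth fps_X_nth)
qed

lemma on_line_psubst:
  assumes u: "\<And>j. vanish 1 (u j)"
  shows "on_line c (psubst F u) = fpsubst F (\<lambda>j. on_line c (u j))"
proof (rule fps_ext)
  fix n
  have "on_line c (psum n F u) = fpsum n F (\<lambda>j. on_line c (u j))"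
    by (simp add: psum_def fpsum_def on_line_sum on_line_mult on_line_cst on_line_mon)
  moreover have "vanish (n + 1) (psubst F u - psum n F u)" by (rule psubst_approx) (rule u)
  then have "fvanish (n + 1) (on_line c (psubst F u) - on_line c (psum n F u))"
    using fvanish_on_line by (simp only: on_line_diff[symmetric])
  ultimately show "fps_nth (on_line c (psubst F u)) n = fps_nth (fpsubst F (\<lambda>j. on_line c (u j))) n"
    by (simp add: fvanish_def fpsubst_def)
qed

text \<open>The coefficient of t^k on the line as a polynomial in the slope; its own coefficients
  are those of \<open>w\<close> in total degree k.\<close>

definition line_poly :: "fps2 \<Rightarrow> nat \<Rightarrow> complex poly" where
  "line_poly w k = (\<Sum>m\<le>k. monom (coeff2 w (k - m) m) m)"

lemma poly_line_poly: "poly (line_poly w k) c = fps_nth (on_line c w) k"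
  by (simp add: line_poly_def on_line_nth poly_sum poly_monom)

lemma coeff_line_poly: "coeff (line_poly w k) m = (if m \<le> k then coeff2 w (k - m) m else 0)"
  by (simp add: line_poly_def coeff_sum)

lemma degree_line_poly: "degree (line_poly w k) \<le> k"
  by (rule degree_le) (simp add: coeff_line_poly)

text \<open>Some homogeneous part of \<open>w\<close> is nonzero, and a slope on which
  \<open>w\<close> vanishes is a root of the corresponding polynomial.\<close>

lemma finite_on_line_zero:
  assumes "w \<noteq> 0"
  shows "finite {c. on_line c w = 0}"
proof -
  obtain n m where nm: "coeff2 w n m \<noteq> 0"
    using assms coeff2_eqI[of w 0] by auto
  then have "coeff (line_poly w (n + m)) m \<noteq> 0" by (simp add: coeff_line_poly)
  then have "line_poly w (n + m) \<noteq> 0" by auto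
  then have "finite {c. poly (line_poly w (n + m)) c = 0}" by (rule poly_roots_finite)
  then show ?thesis by (rule rev_finite_subset) (auto simp: poly_line_poly)
qed

section \<open>From bounds on a disc of slopes to coefficients in two variables\<close>

lemma poly_coeff_Cauchy:
  fixes q :: "complex poly"
  assumes "r > 0" "\<And>w. norm w \<le> r \<Longrightarrow> norm (poly q w) \<le> B"
  shows "norm (coeff q i) \<le> B / r ^ i"
proof -
  have d: "(deriv ^^ i) (poly q) = poly ((pderiv ^^ i) q)" for i
  proof (induction i)
    case (Suc i)
    then show ?case
      by (simp only: funpow.simps o_apply) (simp add: fun_eq_iff DERIV_imp_deriv[OF poly_DERIV])
  qed simp
  have "norm ((deriv ^^ i) (poly q) 0) \<le> fact i * B / r ^ i"
    by (rule Cauchy_inequality) (use assms in \<open>auto intro!: holomorphic_intros continuous_intros\<close>)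
  moreover have "(deriv ^^ i) (poly q) 0 = fact i * coeff q i"
    unfolding d poly_0_coeff_0 coeff_higher_pderiv by (simp add: pochhammer_fact)
  ultimately have "fact i * norm (coeff q i) \<le> fact i * (B / r ^ i)" by (simp add: norm_mult)
  then show ?thesis by (rule mult_left_le_imp_le) simp
qed

text \<open>Cauchy's estimate at \<open>c0\<close> bounds the expansion of the polynomial there,
  hence its values on the unit disc; a second Cauchy estimate at 0 bounds the coefficients. The loss
  is geometric in the degree bound \<open>k\<close>, with \<open>2 ^ k\<close> absorbing the number
  of terms.\<close>

lemma poly_bound_from_disc:
  fixes p :: "complex poly"
  assumes \<delta>: "\<delta> > 0" and p: "\<And>c. norm (c - c0) \<le> \<delta> \<Longrightarrow> norm (poly p c) \<le> B" and "degree p \<le> k"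
    and L: "L \<ge> 1" "(1 + norm c0) / \<delta> \<le> L"
  shows "norm (coeff p m) \<le> B * (2 * L) ^ k"
proof -
  define q where "q = pcompose p [:c0, 1:]"
  have q: "poly q w = poly p (w + c0)" for w by (simp add: q_def poly_pcompose add.commute)
  have B0: "B \<ge> 0" using order.trans[OF norm_ge_zero p[of c0]] \<delta> by simp
  have cq: "norm (coeff q i) \<le> B / \<delta> ^ i" for i
    by (rule poly_coeff_Cauchy[OF \<delta>]) (simp add: q p)
  have dq: "degree q \<le> k" using degree_pcompose_le[of p "[:c0, 1:]"] assms(3) by (simp add: q_def)
  have "norm (poly p c) \<le> B * (2 * L) ^ k" if c: "norm c \<le> 1" for c
  proof -
    have "norm (c - c0) \<le> 1 + norm c0" using norm_triangle_ineq4[of c c0] c by linarith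
    have "poly p c = (\<Sum>i\<le>degree q. coeff q i * (c - c0) ^ i)"
      using q[of "c - c0"] by (simp add: poly_altdef)
    also have "norm \<dots> \<le> (\<Sum>i\<le>degree q. B * L ^ k)"
    proof (rule sum_norm_le)
      fix i assume i: "i \<in> {..degree q}"
      have "norm (coeff q i * (c - c0) ^ i) \<le> B / \<delta> ^ i * (1 + norm c0) ^ i"
        unfolding norm_mult norm_power using \<open>norm (c - c0) \<le> 1 + norm c0\<close> B0 \<delta>
        by (intro mult_mono cq power_mono) auto
      also have "\<dots> = B * ((1 + norm c0) / \<delta>) ^ i" by (simp add: power_divide)
      also have "\<dots> \<le> B * L ^ i" using L B0 \<delta> by (intro mult_left_mono power_mono) auto
      also have "\<dots> \<le> B * L ^ k" using L B0 i dq by (intro mult_left_mono power_increasing) auto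
      finally show "norm (coeff q i * (c - c0) ^ i) \<le> B * L ^ k" .
    qed
    also have "\<dots> = real (Suc (degree q)) * (B * L ^ k)" by simp
    also have "\<dots> \<le> 2 ^ k * (B * L ^ k)"
    proof (rule mult_right_mono)
      have "Suc (degree q) \<le> Suc k" using dq by simp
      also have "Suc k \<le> 2 ^ k" using less_exp[of k] by (simp add: Suc_le_eq)
      finally show "real (Suc (degree q)) \<le> 2 ^ k" by (metis of_nat_le_iff of_nat_numeral of_nat_power)
    qed (use B0 L in auto)
    finally show ?thesis by (simp add: power_mult_distrib mult_ac)
  qed
  then show ?thesis using poly_coeff_Cauchy[of 1 p "B * (2 * L) ^ k" m] by simp
qed

lemma coeff_bound_imp_fps2_convergent:
  fixes u :: "fps2^'l"
  assumes K: "K \<ge> 1" "\<And>j n m. norm (coeff2 (u $ j) n m) \<le> C * K ^ (n + m)"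
  shows "fps2_convergent u"
  unfolding fps2_convergent_def
proof (intro exI conjI allI impI)
  show "1 / (2 * K) > 0" using K by simp
  fix x1 x2 :: complex assume x: "norm x1 < 1 / (2 * K)" "norm x2 < 1 / (2 * K)"
  have C0: "C \<ge> 0" using order.trans[OF norm_ge_zero K(2)[of undefined 0 0]] by simp
  \<comment> \<open>Pairs of exponents are read as functions on \<open>bool\<close>, which makes the
    summability of the geometric family in several variables available.\<close>
  let ?g = "\<lambda>(n, m) b. if b then n else m :: nat"
  have bij: "bij_betw ?g UNIV (UNIV :: (bool \<Rightarrow> nat) set)"
    by (rule bij_betw_byWitness[where f' = "\<lambda>\<alpha>. (\<alpha> True, \<alpha> False)"]) (auto simp: fun_eq_iff)
  have "(\<lambda>\<alpha>::bool \<Rightarrow> nat. (1/2::real) ^ mdeg \<alpha>) summable_on UNIV"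
    by (rule summable_on_mdeg_geometric) auto
  then have "(\<lambda>x. (1/2::real) ^ mdeg (?g x)) summable_on UNIV"
    by (rule summable_on_reindex_bij_betw[OF bij, THEN iffD2])
  moreover have "(1/2::real) ^ mdeg (?g p) = (case p of (n, m) \<Rightarrow> (1/2) ^ (n + m))" for p
    by (cases p) (simp add: UNIV_bool add.commute)
  ultimately have "(\<lambda>(n, m). (1/2::real) ^ (n + m)) summable_on UNIV"
    by (simp only: case_prod_unfold)
  then have s: "(\<lambda>p. real CARD('l) * C * (case p of (n, m) \<Rightarrow> (1/2::real) ^ (n + m))) summable_on UNIV"
    by (rule summable_on_cmult_right)
  show "(\<lambda>(n, m). (x1 ^ n * x2 ^ m) *s vcoeff u n m) summable_on UNIV"
  proof (rule abs_summable_summable, rule summable_on_comparison_test[OF s])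
    fix p :: "nat \<times> nat"
    obtain n m where p: "p = (n, m)" by (cases p)
    have "norm ((x1 ^ n * x2 ^ m) *s vcoeff u n m) \<le> (\<Sum>j\<in>UNIV. norm (((x1 ^ n * x2 ^ m) *s vcoeff u n m) $ j))"
      unfolding norm_vec_def by (rule L2_set_le_sum) simp
    also have "\<dots> \<le> (\<Sum>j\<in>(UNIV::'l set). C * (1/2) ^ (n + m))"
    proof (rule sum_mono)
      fix j
      have "norm (((x1 ^ n * x2 ^ m) *s vcoeff u n m) $ j) = norm x1 ^ n * norm x2 ^ m * norm (coeff2 (u $ j) n m)"
        by (simp add: vcoeff_def norm_mult norm_power)
      also have "\<dots> \<le> (1 / (2 * K)) ^ n * (1 / (2 * K)) ^ m * (C * K ^ (n + m))"
        using x K by (intro mult_mono power_mono K) auto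
      also have "\<dots> = C * (1 / 2) ^ (n + m)" using K by (simp add: power_add power_divide power_mult_distrib)
      finally show "norm (((x1 ^ n * x2 ^ m) *s vcoeff u n m) $ j) \<le> C * (1 / 2) ^ (n + m)" .
    qed
    finally show "norm (case p of (n, m) \<Rightarrow> (x1 ^ n * x2 ^ m) *s vcoeff u n m)
        \<le> real CARD('l) * C * (case p of (n, m) \<Rightarrow> (1/2::real) ^ (n + m))"
      by (simp add: p)
  qed auto
qed

text \<open>By Baire's theorem the bounds on the single lines are uniform on a disc of slopes; Cauchy's
  estimates then carry them over to the coefficients.\<close>

lemma convergent_on_lines_imp_convergent:
  fixes u :: "fps2^'l"
  assumes Z: "finite Z" and lines: "\<And>c j. c \<notin> Z \<Longrightarrow> \<exists>\<rho>>0. bounded_wnorm \<rho> (on_line c (u $ j))"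
  shows "fps2_convergent u"
proof -
  \<comment> \<open>Slopes with one common geometric bound for all components and degrees. The sets
    are closed because each condition is on a polynomial in the slope.\<close>
  define T where "T M = {c. \<forall>j k. norm (poly (line_poly (u $ j) k) c) \<le> real M ^ Suc k}" for M
  have closed: "closed (T M)" for M
    unfolding T_def by (intro closed_Collect_all closed_Collect_le continuous_intros)
  have cover: "\<exists>M. c \<in> T M" if c: "c \<notin> Z" for c
  proof -
    have "\<exists>M. \<forall>k. norm (fps_nth (on_line c (u $ j)) k) \<le> real M ^ Suc k" for j
    proof -
      obtain \<rho> K where \<rho>: "\<rho> > 0" and K: "\<And>N. wnorm N \<rho> (on_line c (u $ j)) \<le> K"
        using lines[OF c, of j] by (auto simp: bounded_wnorm_def)
      \<comment> \<open>One integer dominates both the bound \<open>K\<close> and the growth rate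
        \<open>1 / \<rho>\<close>, which is why the exponent in \<open>T\<close> is
        \<open>Suc k\<close>.\<close>
      obtain M :: nat where M: "max 1 (max K (1 / \<rho>)) \<le> real M" using real_arch_simple by blast
      have "norm (fps_nth (on_line c (u $ j)) k) \<le> real M ^ Suc k" for k
      proof -
        have "norm (fps_nth (on_line c (u $ j)) k) * \<rho> ^ k \<le> wnorm k \<rho> (on_line c (u $ j))"
          unfolding wnorm_def by (rule member_le_sum) (use \<rho> in auto)
        also have "\<dots> \<le> real M" using K[of k] M by simp
        finally have "norm (fps_nth (on_line c (u $ j)) k) \<le> real M * (1 / \<rho>) ^ k"
          using \<rho> by (simp add: power_divide field_simps)
        also have "\<dots> \<le> real M * real M ^ k" using M \<rho> by (intro mult_left_mono power_mono) auto
        finally show ?thesis by simp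
      qed
      then show ?thesis by blast
    qed
    then obtain M where M: "\<And>j k. norm (fps_nth (on_line c (u $ j)) k) \<le> real (M j) ^ Suc k" by metis
    have "norm (fps_nth (on_line c (u $ j)) k) \<le> real (\<Sum>j\<in>UNIV. M j) ^ Suc k" for j k
      by (rule order.trans[OF M]) (intro power_mono of_nat_mono member_le_sum, auto)
    then have "c \<in> T (\<Sum>j\<in>UNIV. M j)" by (simp add: T_def poly_line_poly)
    then show ?thesis by blast
  qed
  have "\<exists>M. interior (T M) \<noteq> {}"
  proof (rule ccontr)
    assume "\<not> ?thesis"
    then have e: "interior (T M) = {}" for M by blast
    \<comment> \<open>If no \<open>T M\<close> had interior, the complements would be open and
      dense, and so would be their intersection dense; but it lies in the finite, hence closed, set
      \<open>Z\<close>.\<close>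
    have "UNIV \<subseteq> closure (\<Inter> (range (\<lambda>M. - T M)))"
    proof (rule Baire)
      fix X assume "X \<in> range (\<lambda>M. - T M)"
      then obtain M where X: "X = - T M" by blast
      show "openin (top_of_set UNIV) X \<and> UNIV \<subseteq> closure X"
        using closed[of M] e[of M] by (simp add: X closure_complement open_Compl)
    qed auto
    moreover have "\<Inter> (range (\<lambda>M. - T M)) \<subseteq> Z"
    proof
      fix c assume "c \<in> \<Inter> (range (\<lambda>M. - T M))"
      then have "\<not> (\<exists>M. c \<in> T M)" by simp
      then show "c \<in> Z" using cover[of c] by argo
    qed
    then have "closure (\<Inter> (range (\<lambda>M. - T M))) \<subseteq> Z"
      using Z by (intro closure_minimal finite_imp_closed)
    ultimately have "UNIV \<subseteq> Z" by (rule order.trans)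
    then have "finite (UNIV :: complex set)" using Z by (rule finite_subset)
    then show False using infinite_UNIV_char_0[where 'a = complex] by simp
  qed
  then obtain M c0 where "c0 \<in> interior (T M)" by blast
  then obtain \<delta> where \<delta>: "\<delta> > 0" "cball c0 \<delta> \<subseteq> T M" using mem_interior_cball by blast
  define L where "L = max 1 ((1 + norm c0) / \<delta>)"
  define K where "K = max 1 (real M * (2 * L))"
  have "norm (coeff2 (u $ j) n m) \<le> real M * K ^ (n + m)" for j n m
  proof -
    have "norm (coeff (line_poly (u $ j) (n + m)) m) \<le> real M ^ Suc (n + m) * (2 * L) ^ (n + m)"
    proof (rule poly_bound_from_disc[OF \<delta>(1) _ degree_line_poly])
      show "norm (poly (line_poly (u $ j) (n + m)) c) \<le> real M ^ Suc (n + m)" if "norm (c - c0) \<le> \<delta>" for c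
        using \<delta>(2) that unfolding T_def by (auto simp: dist_norm norm_minus_commute subset_iff)
    qed (auto simp: L_def)
    also have "\<dots> = real M * (real M * (2 * L)) ^ (n + m)" by (simp add: power_mult_distrib)
    also have "\<dots> \<le> real M * K ^ (n + m)"
      by (intro mult_left_mono power_mono) (auto simp: K_def L_def)
    finally show ?thesis by (simp add: coeff_line_poly)
  qed
  then show ?thesis by (rule coeff_bound_imp_fps2_convergent[rotated]) (simp add: K_def)
qed

section \<open>The Pfaffian system\<close>

text \<open>The exceptional slopes are those on which the determinant of the relations vanishes
  identically; on every other line the restricted relations satisfy the hypotheses of the
  one-variable theorem.\<close>

lemma formal_solution_convergent:
  fixes f1 f2 :: "complex \<times> complex \<times> (complex^'l) \<Rightarrow> complex^'l"
  assumes f: "holomorphic3_on f1 U" "holomorphic3_on f2 U" "(0, 0, 0) \<in> U"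
    and pos: "p > 0" "q > 0" "p' > 0" "q' > 0" and ne: "(p, q) \<noteq> (p', q')"
    and inv: "invertible (jac_y f1 0 0 0)" "invertible (jac_y f2 0 0 0)"
    and u: "formal_solution p q p' q' f1 f2 u"
  shows "fps2_convergent u"
proof -
  from holomorphic3_power_series[OF f(1,3)] obtain F1 \<rho>1 where h1: "\<rho>1 > 0" "\<forall>i. convergent_ps (F1 i)"
    "\<forall>z i. (\<forall>j. norm (z j) < \<rho>1) \<longrightarrow> cvec z \<in> U \<and> ((\<lambda>\<alpha>. F1 i \<alpha> * mon z \<alpha>) has_sum f1 (cvec z) $ i) UNIV"
    by (elim exE conjE)
  have F1: "\<rho>1 > 0" "convergent_ps (F1 i)" "(\<And>j. norm (z j) < \<rho>1) \<Longrightarrow>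
      cvec z \<in> U \<and> ((\<lambda>\<alpha>. F1 i \<alpha> * mon z \<alpha>) has_sum f1 (cvec z) $ i) UNIV" for i z
    using h1 by auto
  from holomorphic3_power_series[OF f(2,3)] obtain F2 \<rho>2 where h2: "\<rho>2 > 0" "\<forall>i. convergent_ps (F2 i)"
    "\<forall>z i. (\<forall>j. norm (z j) < \<rho>2) \<longrightarrow> cvec z \<in> U \<and> ((\<lambda>\<alpha>. F2 i \<alpha> * mon z \<alpha>) has_sum f2 (cvec z) $ i) UNIV"
    by (elim exE conjE)
  have F2: "\<rho>2 > 0" "convergent_ps (F2 i)" "(\<And>j. norm (z j) < \<rho>2) \<Longrightarrow>
      cvec z \<in> U \<and> ((\<lambda>\<alpha>. F2 i \<alpha> * mon z \<alpha>) has_sum f2 (cvec z) $ i) UNIV" for i z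
    using h2 by auto
  have s1: "((\<lambda>\<alpha>. F1 i \<alpha> * mon z \<alpha>) has_sum f1 (cvec z) $ i) UNIV" if "\<And>j. norm (z j) < \<rho>1" for i z
    by (rule conjunct2[OF F1(3)]) (rule that)
  have s2: "((\<lambda>\<alpha>. F2 i \<alpha> * mon z \<alpha>) has_sum f2 (cvec z) $ i) UNIV" if "\<And>j. norm (z j) < \<rho>2" for i z
    by (rule conjunct2[OF F2(3)]) (rule that)
  have jac1: "jac_y f1 0 0 0 = (\<chi> i j. F1 i (unit_exp (yvar j)))"
    by (rule jac_y_power_series[OF F1(1)]) (rule s1)
  have jac2: "jac_y f2 0 0 0 = (\<chi> i j. F2 i (unit_exp (yvar j)))"
    by (rule jac_y_power_series[OF F2(1)]) (rule s2)
  have sub1: "fsubst f1 u $ i = psubst (F1 i) (with_x u)" for i and u :: "fps2^'l"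
    by (rule fsubst_eq_psubst[OF taylor_coeffs[OF F1(1) s1]])
  have sub2: "fsubst f2 u $ i = psubst (F2 i) (with_x u)" for i and u :: "fps2^'l"
    by (rule fsubst_eq_psubst[OF taylor_coeffs[OF F2(1) s2]])
  have u0: "vcoeff u 0 0 = 0" using u by (simp add: formal_solution_def)
  have eq1: "X2 ^ q * X1 ^ (p + 1) * fdx1 (u $ i) = psubst (F1 i) (with_x u)" for i
    using u sub1[of u i] by (auto simp: formal_solution_def vec_eq_iff)
  have eq2: "X1 ^ p' * X2 ^ (q' + 1) * fdx2 (u $ i) = psubst (F2 i) (with_x u)" for i
    using u sub2[of u i] by (auto simp: formal_solution_def vec_eq_iff)
  have J1: "det (\<chi> i j. F1 i (unit_exp (yvar j))) \<noteq> 0"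
    using inv(1) unfolding jac1 invertible_det_nz .
  have J2: "det (\<chi> i j. F2 i (unit_exp (yvar j))) \<noteq> 0"
    using inv(2) unfolding jac2 invertible_det_nz .
  obtain g :: "'l \<Rightarrow> ('l option option \<Rightarrow> nat) \<Rightarrow> complex"
    where g: "\<And>i. convergent_ps (g i)" "\<And>i. psubst (g i) (with_x u) = 0"
      "det (\<chi> i j. psubst (pd (yvar j) (g i)) (with_x u)) \<noteq> 0"
    by (rule exists_nondegenerate_relations[OF u0 eq1 eq2 F1(2) F2(2) J1 J2 pos ne]) (rule that)
  let ?\<Delta> = "det (\<chi> i j. psubst (pd (yvar j) (g i)) (with_x u))"
  have van: "vanish 1 (with_x u j)" for j by (rule vanish_with_x[OF u0])
  show ?thesis
  proof (rule convergent_on_lines_imp_convergent[OF finite_on_line_zero[OF g(3)]])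
    fix c j assume c: "c \<notin> {c. on_line c ?\<Delta> = 0}"
    define V where "V j = on_line c (with_x u j)" for j
    have "\<exists>\<rho>>0. \<forall>j. bounded_wnorm \<rho> (V j)"
    proof (rule formal_implicit_function_convergent)
      show "fvanish 1 (V j)" for j unfolding V_def by (rule fvanish_on_line[OF van])
      show "fps_nth (V None) n = 0" if "n > 1" for n using that by (simp add: V_def on_line_X1)
      show "fps_nth (V (Some None)) n = 0" if "n > 1" for n using that by (simp add: V_def on_line_X2)
      show "convergent_ps (g i)" for i by (rule g)
      have sub: "fpsubst F V = on_line c (psubst F (with_x u))" for F
        unfolding V_def[abs_def] by (rule on_line_psubst[OF van, symmetric])
      show "fpsubst (g i) V = 0" for i by (simp add: sub g(2))
      have "(\<chi> i j. fpsubst (pd (yvar j) (g i)) V) = mmap (on_line c) (\<chi> i j. psubst (pd (yvar j) (g i)) (with_x u))"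
        by (simp add: vec_eq_iff sub)
      then show "det (\<chi> i j. fpsubst (pd (yvar j) (g i)) V) \<noteq> 0"
        using c by (simp add: on_line_det)
    qed
    then obtain \<rho> where "\<rho> > 0" "\<And>j. bounded_wnorm \<rho> (V j)" by blast
    then show "\<exists>\<rho>>0. bounded_wnorm \<rho> (on_line c (u $ j))"
      by (intro exI[of _ \<rho>]) (metis V_def with_x_simps(3))
  qed
qed

text \<open>Exponents supported on these two indices are the ones without a factor $y_j$.\<close>

abbreviation xvars :: "'l option option set" where
  "xvars \<equiv> {None, Some None}"

text \<open>If \<open>u\<close> has order N + 1, then \<open>L\<close> raises it to N + 2, and so
  does every term of the substitution that contains a y-factor and another factor. Hence the
  invertible linear part annihilates the coefficients of degree N + 1. The operator is kept abstract
  so that either equation of the system can be used.\<close>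

lemma formal_solution_zero:
  fixes u :: "fps2^'l" and F :: "'l \<Rightarrow> ('l option option \<Rightarrow> nat) \<Rightarrow> complex"
  assumes u0: "vcoeff u 0 0 = 0"
    and L: "\<And>N w. vanish N w \<Longrightarrow> vanish (Suc N) (L w)"
    and eq: "\<And>i. L (u $ i) = psubst (F i) (with_x u)"
    and F0: "\<And>i \<alpha>. \<alpha> \<in> supported xvars \<Longrightarrow> F i \<alpha> = 0"
    and J: "det (\<chi> i j. F i (unit_exp (yvar j))) \<noteq> 0"
  shows "u = 0"
proof -
  have van: "vanish 1 (with_x u j)" for j by (rule vanish_with_x[OF u0])
  have "\<forall>i. vanish (Suc N) (u $ i)" for N
  proof (induction N)
    case 0
    then show ?case using van[of "yvar i" for i] by simp
  next
    case (Suc N)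
    let ?e = "\<lambda>j. unit_exp (yvar j) :: 'l option option \<Rightarrow> nat"
    have lin: "vanish (Suc (Suc N)) (\<Sum>j\<in>UNIV. cst (F i (?e j)) * u $ j)" for i
    proof -
      let ?A = "{\<alpha> :: 'l option option \<Rightarrow> nat. mdeg \<alpha> \<le> Suc N}"
      have mdeg_e: "mdeg (?e j) = 1" for j using mdeg_inc_exp[where j = "yvar j" and \<alpha> = "\<lambda>_. 0"] by simp
      have inj: "inj ?e" by (rule injI) (metis fun_upd_apply option.inject zero_neq_one)
      have "psum (Suc N) (F i) (with_x u) - (\<Sum>j\<in>UNIV. cst (F i (?e j)) * u $ j)
          = psum (Suc N) (F i) (with_x u) - (\<Sum>\<alpha>\<in>range ?e. cst (F i \<alpha>) * mon (with_x u) \<alpha>)"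
        by (simp only: sum.reindex[OF inj] o_def mon_unit_exp with_x_simps)
      also have "\<dots> = (\<Sum>\<alpha>\<in>?A - range ?e. cst (F i \<alpha>) * mon (with_x u) \<alpha>)"
        unfolding psum_def by (rule sum_diff[symmetric]) (use mdeg_e in auto)
      also have "vanish (Suc (Suc N)) \<dots>"
      proof (rule vanish_sum)
        fix \<alpha> assume \<alpha>: "\<alpha> \<in> ?A - range ?e"
        show "vanish (Suc (Suc N)) (cst (F i \<alpha>) * mon (with_x u) \<alpha>)"
        proof (cases "\<alpha> \<in> supported xvars")
          case False
          then obtain v where v: "v \<notin> xvars" "\<alpha> v \<noteq> 0" by (auto simp: supported_def)
          then obtain j where j: "v = yvar j" by (cases v rule: vars_cases) auto
          define \<beta> where "\<beta> = \<alpha>(v := \<alpha> v - 1)"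
          have inc: "\<alpha> = inc_exp v \<beta>" using v by (auto simp: \<beta>_def)
          have "\<beta> \<noteq> (\<lambda>_. 0)" using \<alpha> inc j by auto
          then have "mdeg \<beta> \<noteq> 0" by (auto simp: fun_eq_iff)
          then have "1 \<le> mdeg \<beta>" by linarith
          then have "vanish 1 (mon (with_x u) \<beta>)"
            by (rule vanish_mono[OF vanish_mon[OF van]])
          then have "vanish (Suc N + 1) (u $ j * mon (with_x u) \<beta>)"
            using Suc by (intro vanish_mult) auto
          moreover have "mon (with_x u) \<alpha> = u $ j * mon (with_x u) \<beta>"
            unfolding inc mon_inc_exp by (simp add: j)
          ultimately show ?thesis by (simp add: vanish_mult_left)
        qed (simp add: F0)
      qed
      finally have 1: "vanish (Suc (Suc N)) (psum (Suc N) (F i) (with_x u) - (\<Sum>j\<in>UNIV. cst (F i (?e j)) * u $ j))" .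
      have 2: "vanish (Suc (Suc N)) (psubst (F i) (with_x u) - psum (Suc N) (F i) (with_x u))"
        using psubst_approx[where N = "Suc N" and F = "F i" and u = "with_x u", OF van] by simp
      have 3: "vanish (Suc (Suc N)) (psubst (F i) (with_x u))"
        unfolding eq[symmetric] using L Suc by blast
      from vanish_diff[OF vanish_diff[OF 3 2] 1] show ?thesis by simp
    qed
    have "coeff2 (u $ j) n m = 0" if "n + m < Suc (Suc N)" for j n m
    proof -
      let ?J = "\<chi> i j. F i (?e j)"
      have "?J *v vcoeff u n m = 0"
        using lin that by (simp add: vanish_def coeff2_sum vec_eq_iff matrix_vector_mult_def vcoeff_def)
      moreover obtain Y where "Y ** ?J = mat 1" using J by (auto simp flip: invertible_det_nz simp: invertible_def)
      ultimately have "Y *v (?J *v vcoeff u n m) = 0" by simp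
      then have "vcoeff u n m = 0" unfolding matrix_vector_mul_assoc \<open>Y ** ?J = mat 1\<close> by simp
      then show ?thesis by (simp add: vcoeff_def vec_eq_iff)
    qed
    then show ?case by (simp add: vanish_def)
  qed
  then have "vanish N (u $ i)" for i N using vanish_mono[of "Suc N" "u $ i" N] by simp
  then show ?thesis using vanish_all by (simp add: vec_eq_iff)
qed

lemma psubst_with_x_zero:
  assumes "\<And>\<alpha>. \<alpha> \<in> supported xvars \<Longrightarrow> F \<alpha> = 0"
  shows "psubst F (with_x (0 :: fps2^'l)) = 0"
proof -
  have "cst (F \<alpha>) * mon (with_x (0 :: fps2^'l)) \<alpha> = 0" for \<alpha>
  proof (cases "\<alpha> \<in> supported xvars")
    case False
    then obtain v where v: "v \<notin> xvars" "\<alpha> v \<noteq> 0" by (auto simp: supported_def)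
    then have "with_x (0 :: fps2^'l) v ^ \<alpha> v = 0" by (cases v rule: vars_cases) auto
    then have "mon (with_x (0 :: fps2^'l)) \<alpha> = 0" unfolding mon_def by (intro prod_zero) auto
    then show ?thesis by simp
  qed (simp add: assms)
  then have P0: "psum n F (with_x (0 :: fps2^'l)) = 0" for n unfolding psum_def by (intro sum.neutral ballI)
  have "psubst F (with_x (0 :: fps2^'l)) = Abs_fps (\<lambda>n. Abs_fps (\<lambda>m. coeff2 0 n m))"
    unfolding psubst_def P0 ..
  then show ?thesis by (simp add: fps_eq_iff)
qed

text \<open>At y = 0 only exponents in \<open>supported xvars\<close> survive, and the identity
  theorem for these variables applies.\<close>

lemma power_series_vanishing_at_y0:
  fixes f :: "complex \<times> complex \<times> (complex^'l) \<Rightarrow> complex^'m"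
  assumes \<rho>: "\<rho> > 0"
    and F: "\<And>z. (\<And>j. norm (z j) < \<rho>) \<Longrightarrow> cvec z \<in> U \<and> ((\<lambda>\<alpha>. F \<alpha> * mon z \<alpha>) has_sum f (cvec z) $ i) UNIV"
    and f: "\<And>x1 x2. (x1, x2, 0) \<in> U \<Longrightarrow> f (x1, x2, 0) = 0"
    and \<alpha>: "\<alpha> \<in> supported xvars"
  shows "F \<alpha> = 0"
proof (rule power_series_identity_theorem[OF \<rho> _ \<alpha>])
  fix z :: "'l option option \<Rightarrow> complex" assume z: "\<And>j. norm (z j) < \<rho>"
  define z' where "z' v = (if v \<in> xvars then z v else 0)" for v
  have z': "norm (z' j) < \<rho>" for j using z \<rho> by (simp add: z'_def)
  have cv: "cvec z' = (z None, z (Some None), 0)" by (simp add: cvec_def z'_def vec_eq_iff)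
  have "f (cvec z') = 0" using F[of z', OF z'] f unfolding cv by blast
  then have "((\<lambda>\<alpha>. F \<alpha> * mon z' \<alpha>) has_sum 0) UNIV" using F[of z', OF z'] by simp
  note all = this
  have zero: "mon z' \<alpha> = 0" if "\<alpha> \<notin> supported xvars" for \<alpha>
  proof -
    have "\<exists>v. v \<notin> xvars \<and> \<alpha> v \<noteq> 0"
      using that unfolding supported_def mem_Collect_eq by (simp only: not_all not_imp)
    then obtain v where v: "v \<notin> xvars" "\<alpha> v \<noteq> 0" by (elim exE conjE)
    have "z' v = 0" unfolding z'_def using v(1) by (simp only: if_False)
    then have "z' v ^ \<alpha> v = 0" using v(2) by simp
    then show ?thesis unfolding mon_def by (intro prod_zero) auto
  qed
  have "((\<lambda>\<alpha>. F \<alpha> * mon z' \<alpha>) has_sum 0) (supported xvars)"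
    using all by (rule has_sum_cong_neutral[THEN iffD1, rotated -1]) (auto simp: zero)
  moreover have "mon z' \<alpha> = mon z \<alpha>" if "\<alpha> \<in> supported xvars" for \<alpha>
    by (rule mon_cong_supported[OF that]) (simp add: z'_def)
  then have "((\<lambda>\<alpha>. F \<alpha> * mon z' \<alpha>) has_sum 0) (supported xvars) \<longleftrightarrow> ((\<lambda>\<alpha>. F \<alpha> * mon z \<alpha>) has_sum 0) (supported xvars)"
    by (intro has_sum_cong) (simp only:)
  ultimately show "((\<lambda>\<alpha>. F \<alpha> * mon z \<alpha>) has_sum 0) (supported xvars)" by simp
qed

text \<open>Uniqueness uses only the equation whose Jacobian is invertible; that 0 solves both
  equations comes from \<open>f1\<close> and \<open>f2\<close> vanishing at y = 0.\<close>

lemma formal_solution_iff_zero: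
  fixes f1 f2 :: "complex \<times> complex \<times> (complex^'l) \<Rightarrow> complex^'l"
  assumes f: "holomorphic3_on f1 U" "holomorphic3_on f2 U" "(0, 0, 0) \<in> U"
    and pos: "p > 0" "q > 0" "p' > 0" "q' > 0"
    and ci: "completely_integrable p q p' q' U f1 f2"
    and inv: "invertible (jac_y f1 0 0 0) \<or> invertible (jac_y f2 0 0 0)"
  shows "formal_solution p q p' q' f1 f2 u \<longleftrightarrow> u = 0"
proof -
  from holomorphic3_power_series[OF f(1,3)] obtain F1 \<rho>1 where h1: "\<rho>1 > 0" "\<forall>i. convergent_ps (F1 i)"
    "\<forall>z i. (\<forall>j. norm (z j) < \<rho>1) \<longrightarrow> cvec z \<in> U \<and> ((\<lambda>\<alpha>. F1 i \<alpha> * mon z \<alpha>) has_sum f1 (cvec z) $ i) UNIV"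
    by (elim exE conjE)
  have F1: "\<rho>1 > 0" "convergent_ps (F1 i)" "(\<And>j. norm (z j) < \<rho>1) \<Longrightarrow>
      cvec z \<in> U \<and> ((\<lambda>\<alpha>. F1 i \<alpha> * mon z \<alpha>) has_sum f1 (cvec z) $ i) UNIV" for i z
    using h1 by auto
  from holomorphic3_power_series[OF f(2,3)] obtain F2 \<rho>2 where h2: "\<rho>2 > 0" "\<forall>i. convergent_ps (F2 i)"
    "\<forall>z i. (\<forall>j. norm (z j) < \<rho>2) \<longrightarrow> cvec z \<in> U \<and> ((\<lambda>\<alpha>. F2 i \<alpha> * mon z \<alpha>) has_sum f2 (cvec z) $ i) UNIV"
    by (elim exE conjE)
  have F2: "\<rho>2 > 0" "convergent_ps (F2 i)" "(\<And>j. norm (z j) < \<rho>2) \<Longrightarrow>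
      cvec z \<in> U \<and> ((\<lambda>\<alpha>. F2 i \<alpha> * mon z \<alpha>) has_sum f2 (cvec z) $ i) UNIV" for i z
    using h2 by auto
  have s1: "((\<lambda>\<alpha>. F1 i \<alpha> * mon z \<alpha>) has_sum f1 (cvec z) $ i) UNIV" if "\<And>j. norm (z j) < \<rho>1" for i z
    by (rule conjunct2[OF F1(3)]) (rule that)
  have s2: "((\<lambda>\<alpha>. F2 i \<alpha> * mon z \<alpha>) has_sum f2 (cvec z) $ i) UNIV" if "\<And>j. norm (z j) < \<rho>2" for i z
    by (rule conjunct2[OF F2(3)]) (rule that)
  have f0: "f1 (x1, x2, 0) = 0" "f2 (x1, x2, 0) = 0" if "(x1, x2, 0) \<in> U" for x1 x2
    using ci that by (auto simp: completely_integrable_def)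
  have F10: "F1 i \<alpha> = 0" if "\<alpha> \<in> supported xvars" for i \<alpha>
    by (rule power_series_vanishing_at_y0[OF F1(1,3) f0(1) that])
  have F20: "F2 i \<alpha> = 0" if "\<alpha> \<in> supported xvars" for i \<alpha>
    by (rule power_series_vanishing_at_y0[OF F2(1,3) f0(2) that])
  have jac1: "jac_y f1 0 0 0 = (\<chi> i j. F1 i (unit_exp (yvar j)))"
    by (rule jac_y_power_series[OF F1(1)]) (rule s1)
  have jac2: "jac_y f2 0 0 0 = (\<chi> i j. F2 i (unit_exp (yvar j)))"
    by (rule jac_y_power_series[OF F2(1)]) (rule s2)
  have sub1: "fsubst f1 u $ i = psubst (F1 i) (with_x u)" for i and u :: "fps2^'l"
    by (rule fsubst_eq_psubst[OF taylor_coeffs[OF F1(1) s1]])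
  have sub2: "fsubst f2 u $ i = psubst (F2 i) (with_x u)" for i and u :: "fps2^'l"
    by (rule fsubst_eq_psubst[OF taylor_coeffs[OF F2(1) s2]])
  have X: "vanish (a + b) (X1 ^ a * X2 ^ b)" for a b
    by (intro vanish_mult vanish_power vanish_X1 vanish_X2)
  \<comment> \<open>The derivative costs one order, the monomial gains \<open>p + q + 1\<close>. The
    truncated \<open>N - 1\<close> also covers N = 0.\<close>
  have L1: "vanish (Suc N) (X2 ^ q * X1 ^ (p + 1) * fdx1 w)" if "vanish N w" for N w
  proof -
    have "vanish (N - 1) (fdx1 w)" using that by (auto simp: vanish_def coeff2_fdx1)
    from vanish_mult[OF X[of "p + 1" q] this] show ?thesis
      using pos by (intro vanish_mono[of _ _ "Suc N"]) (auto simp: mult_ac)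
  qed
  have L2: "vanish (Suc N) (X1 ^ p' * X2 ^ (q' + 1) * fdx2 w)" if "vanish N w" for N w
  proof -
    have "vanish (N - 1) (fdx2 w)" using that by (auto simp: vanish_def coeff2_fdx2)
    from vanish_mult[OF X[of p' "q' + 1"] this] show ?thesis
      using pos by (intro vanish_mono[of _ _ "Suc N"]) auto
  qed
  show ?thesis
  proof
    assume u: "formal_solution p q p' q' f1 f2 u"
    then have u0: "vcoeff u 0 0 = 0"
      and e1: "X2 ^ q * X1 ^ (p + 1) * fdx1 (u $ i) = psubst (F1 i) (with_x u)"
      and e2: "X1 ^ p' * X2 ^ (q' + 1) * fdx2 (u $ i) = psubst (F2 i) (with_x u)" for i
      by (auto simp: formal_solution_def vec_eq_iff sub1 sub2)
    from inv show "u = 0"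
    proof
      assume "invertible (jac_y f1 0 0 0)"
      then have J: "det (\<chi> i j. F1 i (unit_exp (yvar j))) \<noteq> 0"
        unfolding jac1 invertible_det_nz .
      show ?thesis
        by (rule formal_solution_zero[where L = "\<lambda>w. X2 ^ q * X1 ^ (p + 1) * fdx1 w", OF u0 L1 e1 F10 J])
    next
      assume "invertible (jac_y f2 0 0 0)"
      then have J: "det (\<chi> i j. F2 i (unit_exp (yvar j))) \<noteq> 0"
        unfolding jac2 invertible_det_nz .
      show ?thesis
        by (rule formal_solution_zero[where L = "\<lambda>w. X1 ^ p' * X2 ^ (q' + 1) * fdx2 w", OF u0 L2 e2 F20 J])
    qed
  next
    assume u: "u = 0"
    have "fdx1 0 = 0" "fdx2 0 = 0" by (auto simp: fdx1_def fdx2_def fps_eq_iff)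
    then show "formal_solution p q p' q' f1 f2 u"
      unfolding u by (simp add: formal_solution_def vec_eq_iff sub1 sub2 psubst_with_x_zero F10 F20)
        (simp add: vcoeff_def)
  qed
qed

section \<open>Summability of the zero series\<close>

lemma angle_in_long_interval:
  assumes "b - a > 2 * pi"
  shows "\<exists>\<theta>. a < \<theta> \<and> \<theta> < b \<and> w = of_real (norm w) * cis \<theta>"
proof -
  define k where "k = \<lfloor>(a - Arg w) / (2 * pi)\<rfloor> + 1"
  define \<theta> where "\<theta> = Arg w + 2 * pi * of_int k"
  have "(a - Arg w) / (2 * pi) < of_int k" "of_int k \<le> (a - Arg w) / (2 * pi) + 1"
    unfolding k_def by linarith+
  then have "a < \<theta>" "\<theta> \<le> a + 2 * pi" by (simp_all add: \<theta>_def field_simps)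
  moreover have "cis \<theta> = cis (Arg w)"
    by (simp only: \<theta>_def cis_mult[symmetric] cis_multiple_2pi[OF Ints_of_int] mult_1_right)
  moreover have "w = of_real (norm w) * cis (Arg w)"
    by (metis rcis_def rcis_cmod_Arg)
  ultimately show ?thesis using assms by (intro exI[of _ \<theta>]) auto
qed

text \<open>The zero function and zero blocks serve in every direction. A sector wider than a full
  turn is the whole punctured polydisc, so its openness needs no discussion of arguments.\<close>

lemma msummable_zero:
  assumes "p > 0" "q > 0"
  shows "msummable p q 1 (0 :: fps2^'l)"
proof -
  have vc: "vcoeff (0 :: fps2^'l) n m = 0" for n m by (simp add: vcoeff_def vec_eq_iff)
  have vc': "vcoeff (0 :: fps2^'l) n = (\<lambda>_. 0)" for n by (simp add: vc fun_eq_iff)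
  have "bounded_holomorphic_series 1 (\<lambda>m. 0 :: complex^'l)"
    unfolding bounded_holomorphic_series_def by (intro exI[of _ "\<lambda>_. 0"]) (auto simp: image_constant_conv)
  then have C: "(0 :: fps2^'l) \<in> C_space"
    unfolding C_space_def by (intro CollectI exI[of _ 1]) (simp add: vc vc')
  have hol: "holomorphic2_on (\<lambda>_. 0 :: complex^'l) V" if "open V" for V
    unfolding holomorphic2_on_def using that by (intro conjI ballI exI[of _ "\<lambda>_. 0"]) auto
  have "msummable_dir p q 1 d (0 :: fps2^'l)" for d
    unfolding msummable_dir_def
  proof (intro conjI C exI)
    show "(1::real) > 0" by simp
    \<comment> \<open>Since \<open>pi < 4\<close>, the opening 8 exceeds both \<open>pi\<close> and
      \<open>2 * pi\<close>.\<close>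
    show "(d - 4 + (d + 4)) / 2 = d" by simp
    show "(d + 4) - (d - 4) > pi / 1" using pi_less_4 by simp
    have "msector p q (d - 4) (d + 4) 1 = {x. 0 < norm (fst x) ^ p \<and> norm (fst x) ^ p < 1 \<and> 0 < norm (snd x) ^ q \<and> norm (snd x) ^ q < 1}"
      using angle_in_long_interval[where a = "d - 4" and b = "d + 4"] pi_less_4 unfolding msector_def by auto
    moreover have "open {x :: complex \<times> complex. 0 < norm (fst x) ^ p \<and> norm (fst x) ^ p < 1 \<and> 0 < norm (snd x) ^ q \<and> norm (snd x) ^ q < 1}"
      by (intro open_Collect_conj open_Collect_less continuous_intros)
    ultimately show "holomorphic2_on (\<lambda>_. 0 :: complex^'l) (msector p q (d - 4) (d + 4) 1)" by (intro hol) simp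
    have dz: "(deriv ^^ n) (\<lambda>_. 0 :: complex) = (\<lambda>_. 0)" for n by (induction n) auto
    have "(\<lambda>_. 0 :: complex^'l) \<in> E_space p q 1"
      unfolding E_space_def by (auto simp: dz image_constant_conv intro!: hol open_Times)
    then have "T_series p q 1 (0 :: fps2^'l) (\<lambda>_ _. 0)"
      by (auto simp: T_series_def block_coeff_def vc case_prod_unfold intro!: has_sum_0)
    then show "masymptotic p q (1 / 1) (d - 4) (d + 4) 1 (\<lambda>_. 0) (0 :: fps2^'l)"
      unfolding masymptotic_def
      by (intro exI[of _ 1] exI[of _ "\<lambda>_ _. 0"] conjI allI impI) (auto intro!: exI[of _ 1])
  qed
  then show ?thesis unfolding msummable_def using C by blast
qed

theorem theorem4p6:
  fixes p q p' q' :: nat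
    and U :: "(complex \<times> complex \<times> (complex^'l)) set"
    and f1 f2 :: "complex \<times> complex \<times> (complex^'l) \<Rightarrow> complex^'l"
  assumes "p > 0" and "q > 0" and "p' > 0" and "q' > 0"
    and "open U" and "(0, 0, 0) \<in> U"
    and "holomorphic3_on f1 U" and "holomorphic3_on f2 U"
  shows "(\<forall>u. formal_solution p q p' q' f1 f2 u \<longrightarrow>
            invertible (jac_y f1 0 0 0) \<longrightarrow> invertible (jac_y f2 0 0 0) \<longrightarrow>
            (p, q) \<noteq> (p', q') \<longrightarrow> fps2_convergent u)
      \<and> (completely_integrable p q p' q' U f1 f2 \<longrightarrow> invertible (jac_y f1 0 0 0) \<longrightarrow>
            (\<exists>!u. formal_solution p q p' q' f1 f2 u) \<and>
            (\<forall>u. formal_solution p q p' q' f1 f2 u \<longrightarrow> msummable p q 1 u))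
      \<and> (completely_integrable p q p' q' U f1 f2 \<longrightarrow> invertible (jac_y f2 0 0 0) \<longrightarrow>
            (\<exists>!u. formal_solution p q p' q' f1 f2 u) \<and>
            (\<forall>u. formal_solution p q p' q' f1 f2 u \<longrightarrow> msummable p' q' 1 u))"
proof (intro conjI allI impI)
  fix u
  assume "formal_solution p q p' q' f1 f2 u" "invertible (jac_y f1 0 0 0)" "invertible (jac_y f2 0 0 0)"
    "(p, q) \<noteq> (p', q')"
  then show "fps2_convergent u"
    using assms by (intro formal_solution_convergent[of f1 U f2 p q p' q' u])
next
  assume "completely_integrable p q p' q' U f1 f2" "invertible (jac_y f1 0 0 0)"
  then have sol: "formal_solution p q p' q' f1 f2 u \<longleftrightarrow> u = 0" for u
    using assms by (intro formal_solution_iff_zero) auto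
  show "\<exists>!u. formal_solution p q p' q' f1 f2 u" by (simp add: sol)
  show "msummable p q 1 u" if "formal_solution p q p' q' f1 f2 u" for u
    using that msummable_zero[OF assms(1,2)] by (simp add: sol)
next
  assume "completely_integrable p q p' q' U f1 f2" "invertible (jac_y f2 0 0 0)"
  then have sol: "formal_solution p q p' q' f1 f2 u \<longleftrightarrow> u = 0" for u
    using assms by (intro formal_solution_iff_zero) auto
  show "\<exists>!u. formal_solution p q p' q' f1 f2 u" by (simp add: sol)
  show "msummable p' q' 1 u" if "formal_solution p q p' q' f1 f2 u" for u
    using that msummable_zero[OF assms(3,4)] by (simp add: sol)
qed

end
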